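(* Assume that one of the following holds: (i) $a,b>0$ and $c=d=e=0$; (ii) $a,c>0$, $b=d=e=0$ and $G_1\neq G_3$; (iii) $b,c>0$, $a=d=e=0$ and $\frac{E_1}{\rho_1}\neq\frac{E_3}{\rho_3}$; (iv) $b,e>0$, $a=c=d=0$, $G_1\neq G_3$ and $\frac{E_1}{\rho_1}\neq\frac{E_3}{\rho_3}$; (v) $a,e>0$ and $b=c=d=0$. Then the $C_0$-semigroup of contractions $(e^{t\mathcal A})_{t\ge0}$ is strongly stable on $\mathcal H$, i.e. $\lim_{t\to+\infty}\|e^{t\mathcal A}U_0\|_{\mathcal H}=0$ for every $U_0\in\mathcal H$.
   Context: Fix $L>0$ and constants $\rho_1,\rho_2,\rho_3,h_1,h_2,h_3,E_1,E_3,I_1,I_3,G_1,G_3>0$; write $\rho h:=\rho_1h_1+\rho_2h_2+\rho_3h_3$ and $EI:=E_1I_1+E_3I_3$ (each treated as a single symbol). Let $a,b,c,d,e\ge 0$ be damping coefficients. All functions are complex valued on $(0,L)$ and $\|\cdot\|$ is the $L^2(0,L)$ norm. Energy space: $\mathcal H=(H_0^1\times L^2)^2\times H_0^2\times L^2\times (H_0^1\times L^2)^2$ (spaces on $(0,L)$), with elements $U=(u^1,v^1,y^1,z^1,\omega,\psi,u^3,v^3,y^3,z^3)$. Put $\tau=-u^1+u^3+h_2\omega_x-\frac{h_1}{2}y^1-\frac{h_3}{2}y^3$. $\mathcal H$ is a Hilbert space with the norm $$\|U\|_{\mathcal H}^2=E_1h_1\|u^1_x\|^2+\rho_1h_1\|v^1\|^2+E_3h_3\|u^3_x\|^2+\rho_3h_3\|v^3\|^2+EI\|\omega_{xx}\|^2+\rho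 h\|\psi\|^2+E_1I_1\|y^1_x\|^2+\rho_1I_1\|z^1\|^2+E_3I_3\|y^3_x\|^2+\rho_3I_3\|z^3\|^2+G_1h_1\|\omega_x+y^1\|^2+\|\tau\|^2+G_3h_3\|\omega_x+y^3\|^2 .$$ Operator: $D(\mathcal A)=[(H^2\cap H_0^1)\times H_0^1]^2\times (H^4\cap H_0^2)\times H_0^2\times[(H^2\cap H_0^1)\times H_0^1]^2$ and $\mathcal AU$ has the ten components, in order: $v^1$; $(\rho_1h_1)^{-1}[E_1h_1u^1_{xx}+\tau-av^1]$; $z^1$; $(\rho_1I_1)^{-1}[E_1I_1y^1_{xx}+\frac{h_1}{2}\tau-G_1h_1(\omega_x+y^1)-bz^1]$; $\psi$; $(\rho h)^{-1}[-EI\omega_{xxxx}+G_1h_1(\omega_x+y^1)_x+G_3h_3(\omega_x+y^3)_x+h_2\tau_x-c\psi]$; $v^3$; $(\rho_3h_3)^{-1}[E_3h_3u^3_{xx}-\tau-dv^3]$; $z^3$; $(\rho_3I_3)^{-1}[E_3I_3y^3_{xx}+\frac{h_3}{2}\tau-G_3h_3(\omega_x+y^3)-ez^3]$. $\mathcal A$ is m-dissipative and generates a $C_0$-semigroup of contractions $(e^{t\mathcal A})_{t\ge0}$ on $\mathcal H$. *)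

theory Defs
  imports "HOL-Analysis.Analysis"
begin

(* Functions on (0,L) are represented by functions real => complex; elements of L^2(0,L) are
   representatives, so equality in L^2 and in the spaces built from it means "the norm of the
   difference is 0".  Values outside (0,L) are irrelevant. *)

section \<open>Sobolev spaces on (0,L)\<close>

definition L2 :: "real \<Rightarrow> (real \<Rightarrow> complex) set" where
  "L2 L = {f. f \<in> borel_measurable (lebesgue_on {0<..<L}) \<and>
              integrable (lebesgue_on {0<..<L}) (\<lambda>x. (cmod (f x))\<^sup>2)}"

definition L2_norm :: "real \<Rightarrow> (real \<Rightarrow> complex) \<Rightarrow> real" where
  "L2_norm L f = sqrt (integral\<^sup>L (lebesgue_on {0<..<L}) (\<lambda>x. (cmod (f x))\<^sup>2))"

definition nth_deriv :: "nat \<Rightarrow> (real \<Rightarrow> complex) \<Rightarrow> real \<Rightarrow> complex" where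
  "nth_deriv k = (\<lambda>g x. vector_derivative g (at x)) ^^ k"

definition test_functions :: "real \<Rightarrow> (real \<Rightarrow> complex) set" where
  "test_functions L = {\<phi>. (\<forall>k x. nth_deriv k \<phi> differentiable at x) \<and>
      compact (closure {x. \<phi> x \<noteq> 0}) \<and> closure {x. \<phi> x \<noteq> 0} \<subseteq> {0<..<L}}"

definition has_weak_deriv ::
  "real \<Rightarrow> nat \<Rightarrow> (real \<Rightarrow> complex) \<Rightarrow> (real \<Rightarrow> complex) \<Rightarrow> bool" where
  "has_weak_deriv L k f g \<longleftrightarrow> f \<in> L2 L \<and> g \<in> L2 L \<and>
     (\<forall>\<phi>\<in>test_functions L.
        integral\<^sup>L (lebesgue_on {0<..<L}) (\<lambda>x. f x * nth_deriv k \<phi> x) =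
        (- 1) ^ k * integral\<^sup>L (lebesgue_on {0<..<L}) (\<lambda>x. g x * \<phi> x))"

(* Some representative of the k-th weak derivative, which is unique up to null sets;
   meaningful only if such a derivative exists in L^2. *)
definition weak_deriv :: "real \<Rightarrow> nat \<Rightarrow> (real \<Rightarrow> complex) \<Rightarrow> real \<Rightarrow> complex" where
  "weak_deriv L k f = (SOME g. has_weak_deriv L k f g)"

definition sobolev :: "real \<Rightarrow> nat \<Rightarrow> (real \<Rightarrow> complex) set" where
  "sobolev L k = {f \<in> L2 L. \<forall>j\<le>k. \<exists>g. has_weak_deriv L j f g}"

definition sobolev_norm :: "real \<Rightarrow> nat \<Rightarrow> (real \<Rightarrow> complex) \<Rightarrow> real" where
  "sobolev_norm L k f = sqrt (\<Sum>j\<le>k. (L2_norm L (weak_deriv L j f))\<^sup>2)"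

(* H^k_0: closure of the test functions in H^k. *)
definition sobolev0 :: "real \<Rightarrow> nat \<Rightarrow> (real \<Rightarrow> complex) set" where
  "sobolev0 L k = {f \<in> sobolev L k.
     \<forall>\<epsilon>>0. \<exists>\<phi>\<in>test_functions L. sobolev_norm L k (\<lambda>x. f x - \<phi> x) < \<epsilon>}"

section \<open>The beam: energy space and operator\<close>

record beam =
  len :: real
  rho1 :: real  rho2 :: real  rho3 :: real
  h1 :: real  h2 :: real  h3 :: real
  E1 :: real  E3 :: real
  I1 :: real  I3 :: real
  G1 :: real  G3 :: real
  damp_a :: real  damp_b :: real  damp_c :: real  damp_d :: real  damp_e :: real

definition admissible :: "beam \<Rightarrow> bool" where
  "admissible p \<longleftrightarrow> len p > 0 \<and>
     rho1 p > 0 \<and> rho2 p > 0 \<and> rho3 p > 0 \<and> h1 p > 0 \<and> h2 p > 0 \<and> h3 p > 0 \<and>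
     E1 p > 0 \<and> E3 p > 0 \<and> I1 p > 0 \<and> I3 p > 0 \<and> G1 p > 0 \<and> G3 p > 0 \<and>
     damp_a p \<ge> 0 \<and> damp_b p \<ge> 0 \<and> damp_c p \<ge> 0 \<and> damp_d p \<ge> 0 \<and> damp_e p \<ge> 0"

definition rho_h :: "beam \<Rightarrow> real" where
  "rho_h p = rho1 p * h1 p + rho2 p * h2 p + rho3 p * h3 p"

definition EI :: "beam \<Rightarrow> real" where
  "EI p = E1 p * I1 p + E3 p * I3 p"

datatype comp = Cu1 | Cv1 | Cy1 | Cz1 | Comega | Cpsi | Cu3 | Cv3 | Cy3 | Cz3

(* U = (u^1, v^1, y^1, z^1, omega, psi, u^3, v^3, y^3, z^3), indexed by component *)
type_synonym state = "comp \<Rightarrow> real \<Rightarrow> complex"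

definition tau :: "beam \<Rightarrow> state \<Rightarrow> real \<Rightarrow> complex" where
  "tau p U = (\<lambda>x. - U Cu1 x + U Cu3 x + h2 p *\<^sub>R weak_deriv (len p) 1 (U Comega) x
                 - (h1 p / 2) *\<^sub>R U Cy1 x - (h3 p / 2) *\<^sub>R U Cy3 x)"

(* omega_x + y, for y = y^1 or y = y^3 *)
definition shear :: "beam \<Rightarrow> comp \<Rightarrow> state \<Rightarrow> real \<Rightarrow> complex" where
  "shear p i U = (\<lambda>x. weak_deriv (len p) 1 (U Comega) x + U i x)"

definition energy_space :: "beam \<Rightarrow> state set" where
  "energy_space p = {U.
     U Cu1 \<in> sobolev0 (len p) 1 \<and> U Cv1 \<in> L2 (len p) \<and>
     U Cy1 \<in> sobolev0 (len p) 1 \<and> U Cz1 \<in> L2 (len p) \<and>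
     U Comega \<in> sobolev0 (len p) 2 \<and> U Cpsi \<in> L2 (len p) \<and>
     U Cu3 \<in> sobolev0 (len p) 1 \<and> U Cv3 \<in> L2 (len p) \<and>
     U Cy3 \<in> sobolev0 (len p) 1 \<and> U Cz3 \<in> L2 (len p)}"

definition energy_norm :: "beam \<Rightarrow> state \<Rightarrow> real" where
  "energy_norm p U = (let nrm = L2_norm (len p); D = weak_deriv (len p) in sqrt (
     E1 p * h1 p * (nrm (D 1 (U Cu1)))\<^sup>2 + rho1 p * h1 p * (nrm (U Cv1))\<^sup>2
   + E3 p * h3 p * (nrm (D 1 (U Cu3)))\<^sup>2 + rho3 p * h3 p * (nrm (U Cv3))\<^sup>2
   + EI p * (nrm (D 2 (U Comega)))\<^sup>2 + rho_h p * (nrm (U Cpsi))\<^sup>2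
   + E1 p * I1 p * (nrm (D 1 (U Cy1)))\<^sup>2 + rho1 p * I1 p * (nrm (U Cz1))\<^sup>2
   + E3 p * I3 p * (nrm (D 1 (U Cy3)))\<^sup>2 + rho3 p * I3 p * (nrm (U Cz3))\<^sup>2
   + G1 p * h1 p * (nrm (shear p Cy1 U))\<^sup>2 + (nrm (tau p U))\<^sup>2
   + G3 p * h3 p * (nrm (shear p Cy3 U))\<^sup>2))"

definition dom_A :: "beam \<Rightarrow> state set" where
  "dom_A p = {U.
     U Cu1 \<in> sobolev (len p) 2 \<inter> sobolev0 (len p) 1 \<and> U Cv1 \<in> sobolev0 (len p) 1 \<and>
     U Cy1 \<in> sobolev (len p) 2 \<inter> sobolev0 (len p) 1 \<and> U Cz1 \<in> sobolev0 (len p) 1 \<and>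
     U Comega \<in> sobolev (len p) 4 \<inter> sobolev0 (len p) 2 \<and> U Cpsi \<in> sobolev0 (len p) 2 \<and>
     U Cu3 \<in> sobolev (len p) 2 \<inter> sobolev0 (len p) 1 \<and> U Cv3 \<in> sobolev0 (len p) 1 \<and>
     U Cy3 \<in> sobolev (len p) 2 \<inter> sobolev0 (len p) 1 \<and> U Cz3 \<in> sobolev0 (len p) 1}"

definition op_A :: "beam \<Rightarrow> state \<Rightarrow> state" where
  "op_A p U = (let D = weak_deriv (len p) in (\<lambda>i. case i of
     Cu1 \<Rightarrow> U Cv1
   | Cv1 \<Rightarrow> (\<lambda>x. (1 / (rho1 p * h1 p)) *\<^sub>R
       ((E1 p * h1 p) *\<^sub>R D 2 (U Cu1) x + tau p U x - damp_a p *\<^sub>R U Cv1 x))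
   | Cy1 \<Rightarrow> U Cz1
   | Cz1 \<Rightarrow> (\<lambda>x. (1 / (rho1 p * I1 p)) *\<^sub>R
       ((E1 p * I1 p) *\<^sub>R D 2 (U Cy1) x + (h1 p / 2) *\<^sub>R tau p U x
        - (G1 p * h1 p) *\<^sub>R shear p Cy1 U x - damp_b p *\<^sub>R U Cz1 x))
   | Comega \<Rightarrow> U Cpsi
   | Cpsi \<Rightarrow> (\<lambda>x. (1 / rho_h p) *\<^sub>R
       (- (EI p *\<^sub>R D 4 (U Comega) x) + (G1 p * h1 p) *\<^sub>R D 1 (shear p Cy1 U) x
        + (G3 p * h3 p) *\<^sub>R D 1 (shear p Cy3 U) x + h2 p *\<^sub>R D 1 (tau p U) x
        - damp_c p *\<^sub>R U Cpsi x))
   | Cu3 \<Rightarrow> U Cv3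
   | Cv3 \<Rightarrow> (\<lambda>x. (1 / (rho3 p * h3 p)) *\<^sub>R
       ((E3 p * h3 p) *\<^sub>R D 2 (U Cu3) x - tau p U x - damp_d p *\<^sub>R U Cv3 x))
   | Cy3 \<Rightarrow> U Cz3
   | Cz3 \<Rightarrow> (\<lambda>x. (1 / (rho3 p * I3 p)) *\<^sub>R
       ((E3 p * I3 p) *\<^sub>R D 2 (U Cy3) x + (h3 p / 2) *\<^sub>R tau p U x
        - (G3 p * h3 p) *\<^sub>R shear p Cy3 U x - damp_e p *\<^sub>R U Cz3 x))))"

section \<open>Semigroups\<close>

(* X is a space of representatives and N its norm, so identities in X read N (U - V) = 0.
   Linearity and contractivity make T t compatible with this identification. *)

definition C0_contraction_semigroup ::
  "state set \<Rightarrow> (state \<Rightarrow> real) \<Rightarrow> (real \<Rightarrow> state \<Rightarrow> state) \<Rightarrow> bool" where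
  "C0_contraction_semigroup X N T \<longleftrightarrow>
     (\<forall>t\<ge>0. \<forall>U\<in>X. T t U \<in> X) \<and>
     (\<forall>t\<ge>0. \<forall>U\<in>X. \<forall>V\<in>X. \<forall>\<alpha> \<beta>.
        N (T t (\<lambda>i x. \<alpha> * U i x + \<beta> * V i x) - (\<lambda>i x. \<alpha> * T t U i x + \<beta> * T t V i x)) = 0) \<and>
     (\<forall>U\<in>X. N (T 0 U - U) = 0) \<and>
     (\<forall>s\<ge>0. \<forall>t\<ge>0. \<forall>U\<in>X. N (T (s + t) U - T s (T t U)) = 0) \<and>
     (\<forall>U\<in>X. ((\<lambda>t. N (T t U - U)) \<longlongrightarrow> 0) (at_right 0)) \<and>
     (\<forall>t\<ge>0. \<forall>U\<in>X. N (T t U) \<le> N U)"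

(* The graph of the infinitesimal generator of T is the graph of A with domain D. *)
definition generated_by ::
  "state set \<Rightarrow> (state \<Rightarrow> real) \<Rightarrow> (real \<Rightarrow> state \<Rightarrow> state) \<Rightarrow> state set \<Rightarrow> (state \<Rightarrow> state) \<Rightarrow> bool" where
  "generated_by X N T D A \<longleftrightarrow> (\<forall>U\<in>X. \<forall>F\<in>X.
     ((\<lambda>t. N ((\<lambda>i x. (1 / t) *\<^sub>R (T t U i x - U i x)) - F)) \<longlongrightarrow> 0) (at_right 0)
     \<longleftrightarrow> U \<in> D \<and> N (F - A U) = 0)"

end

theory Submission
  imports Defs
begin

text \<open>
  Instead of spectral theory, the proof is a quantitative version of LaSalle's principle that works along
  smooth trajectories \<open>U(t) = e\<^bsup>tA\<^esup> U\<^sub>0\<close>, where all components of \<open>U\<^sub>0\<close> are test functions. Such data lie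
  in the domain of every power of \<open>A\<close> and are dense, so contractivity reduces the theorem to them.
  Comparing the energies at \<open>t\<close> and \<open>t + h\<close> up to an error \<open>O(h\<^sup>2)\<close> uniform in \<open>t\<close> shows that the
  dissipation tends to \<open>0\<close>; hence the damped velocities, and all their time derivatives, decay in \<open>L\<^sup>2\<close>.
  So for \<open>A U(t)\<close> the damped displacements decay together with their time derivatives. From there the
  unique continuation argument for \<open>A U = i \<lambda> U\<close> is repeated with ``tends to \<open>0\<close> in \<open>L\<^sup>2\<close>'' in place of
  ``vanishes'': testing the weak equations with bounded families of functions in \<open>H\<^sup>1\<^sub>0\<close> turns the decay of
  some displacements into the decay of the stresses, and then of the remaining displacements. Finally the
  energy of \<open>U(t)\<close> is expressed by pairings of its bounded displacements with velocities and
  accelerations, that is, with the displacements of \<open>A U(t)\<close> and \<open>A\<^sup>2 U(t)\<close>, which decay.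
\<close>

section \<open>Smooth functions and test functions\<close>

text \<open>The obstacle is the plate equation. A wave-type equation may be tested with its own
  force, which stays bounded in H^1_0, so decay of the displacement makes the force decay. The plate
  equation accepts only test functions from H^2_0 and contains its force, \<open>stress\<close>,
  paired with their first derivatives; decay of omega therefore makes \<open>stress\<close> merely
  almost constant in x. The boundary conditions remove the constant: the u's, the y's and omega_x
  all vanish at the end points, so \<open>stress\<close> is bounded in H^1_0 and cannot stay close
  to a nonzero constant. Differentiation in time is never performed:
  \<open>T t ((op_A p ^^ k) V)\<close> plays the k-th derivative, and decay is asserted for all k at
  once because each use of an equation at level k consumes the levels k + 1 and k + 2. The
  assumptions G1 \<noteq> G3 and E1/rho1 \<noteq> E3/rho3 say that a coefficient left over after
  eliminating the decaying quantities does not vanish.\<close>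

lemma nth_deriv_0 [simp]: "nth_deriv 0 f = f"
  by (simp add: nth_deriv_def)

lemma nth_deriv_Suc: "nth_deriv (Suc k) f = (\<lambda>x. vector_derivative (nth_deriv k f) (at x))"
  by (simp add: nth_deriv_def)

lemma nth_deriv_add: "nth_deriv (j + k) f = nth_deriv j (nth_deriv k f)"
  by (simp add: nth_deriv_def funpow_add)

definition smooth :: "(real \<Rightarrow> complex) \<Rightarrow> bool" where
  "smooth f \<longleftrightarrow> (\<forall>k x. nth_deriv k f differentiable at x)"

lemma smooth_has_deriv:
  "smooth f \<Longrightarrow> (nth_deriv k f has_vector_derivative nth_deriv (Suc k) f x) (at x)"
  unfolding smooth_def nth_deriv_Suc using vector_derivative_works by blast

lemma smooth_continuous: "smooth f \<Longrightarrow> continuous_on A (nth_deriv k f)"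
  by (meson continuous_at_imp_continuous_on has_vector_derivative_continuous smooth_has_deriv)

text \<open>Smoothness of concrete functions is shown by guessing all derivatives at once as a
  sequence \<open>d\<close>; the guess is then also the value of \<open>nth_deriv\<close>.\<close>

lemma nth_deriv_eqI:
  assumes "d 0 = f" "\<And>k x. (d k has_vector_derivative d (Suc k) x) (at x)"
  shows "nth_deriv k f = d k"
  by (induction k) (auto simp: assms(1) nth_deriv_Suc intro: vector_derivative_at assms(2))

lemma smoothI:
  assumes "d 0 = f" "\<And>k x. (d k has_vector_derivative d (Suc k) x) (at x)"
  shows "smooth f"
  unfolding smooth_def nth_deriv_eqI[of d f, OF assms]
  using assms(2) differentiableI_vector by blast

text \<open>For functions whose derivatives have no convenient closed form: choosing a derivative
  within the class and iterating the choice yields the sequence that \<open>smoothI\<close> asks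
  for.\<close>

lemma smooth_class:
  assumes "f \<in> F" "\<And>f. f \<in> F \<Longrightarrow> \<exists>g\<in>F. \<forall>x. (f has_vector_derivative g x) (at x)"
  shows "smooth f"
proof -
  obtain D where D: "\<And>f. f \<in> F \<Longrightarrow> D f \<in> F \<and> (\<forall>x. (f has_vector_derivative D f x) (at x))"
    using assms(2) by metis
  have "(D ^^ k) f \<in> F" for k
    by (induction k) (auto simp: D assms(1))
  then show ?thesis
    by (intro smoothI[of "\<lambda>k. (D ^^ k) f"]) (auto simp: D)
qed

lemma
  assumes "smooth f" "smooth g"
  shows smooth_lin: "smooth (\<lambda>x. c * f x + d * g x)"
    and nth_deriv_lin:
      "nth_deriv k (\<lambda>x. c * f x + d * g x) = (\<lambda>x. c * nth_deriv k f x + d * nth_deriv k g x)"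
proof -
  let ?d = "\<lambda>k x. c * nth_deriv k f x + d * nth_deriv k g x"
  have *: "(?d k has_vector_derivative ?d (Suc k) x) (at x)" for k x
    by (intro derivative_intros smooth_has_deriv assms)
  show "smooth (\<lambda>x. c * f x + d * g x)"
    by (rule smoothI[of ?d, OF _ *]) simp
  show "nth_deriv k (\<lambda>x. c * f x + d * g x) = ?d k"
    by (rule nth_deriv_eqI[of ?d, OF _ *]) simp
qed

text \<open>Conjugation will turn the bilinear pairing in the definition of weak derivatives into a
  Hermitian one.\<close>

lemma
  assumes "smooth f"
  shows smooth_cnj: "smooth (\<lambda>x. cnj (f x))"
    and nth_deriv_cnj: "nth_deriv k (\<lambda>x. cnj (f x)) = (\<lambda>x. cnj (nth_deriv k f x))"
proof -
  let ?d = "\<lambda>k x. cnj (nth_deriv k f x)"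
  have *: "(?d k has_vector_derivative ?d (Suc k) x) (at x)" for k x
    by (rule has_vector_derivative_cnj) (rule smooth_has_deriv[OF assms])
  show "smooth (\<lambda>x. cnj (f x))"
    by (rule smoothI[of ?d, OF _ *]) simp
  show "nth_deriv k (\<lambda>x. cnj (f x)) = ?d k"
    by (rule nth_deriv_eqI[of ?d, OF _ *]) simp
qed

lemma
  assumes "smooth f"
  shows smooth_nth_deriv: "smooth (nth_deriv j f)"
  using assms unfolding smooth_def by (simp add: nth_deriv_add[symmetric])

lemma
  assumes "smooth f" "\<And>x. (g has_vector_derivative f x) (at x)"
  shows smooth_antideriv: "smooth g"
    and nth_deriv_antideriv: "nth_deriv (Suc k) g = nth_deriv k f"
proof -
  let ?d = "\<lambda>k. case k of 0 \<Rightarrow> g | Suc k \<Rightarrow> nth_deriv k f"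
  have *: "(?d k has_vector_derivative ?d (Suc k) x) (at x)" for k x
    using assms(2) smooth_has_deriv[OF assms(1)] by (cases k) auto
  show "smooth g"
    by (rule smoothI[of ?d, OF _ *]) simp
  show "nth_deriv (Suc k) g = nth_deriv k f"
    using nth_deriv_eqI[of ?d, OF _ *, of g "Suc k"] by simp
qed

text \<open>Replaces the compact closed support by an interval with explicit end points. With L > 0
  even the zero function has such an interval.\<close>

lemma test_functions_iff:
  "f \<in> test_functions L \<longleftrightarrow> smooth f \<and> (\<exists>a b. 0 < a \<and> a < b \<and> b < L \<and> (\<forall>x. x \<notin> {a..b} \<longrightarrow> f x = 0))"
  if "L > 0"
proof
  assume f: "f \<in> test_functions L"
  let ?K = "closure {x. f x \<noteq> 0}"
  have K: "compact ?K" "?K \<subseteq> {0<..<L}" and sm: "smooth f"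
    using f by (auto simp: test_functions_def smooth_def)
  have sub: "x \<in> ?K" if "f x \<noteq> 0" for x
    using that closure_subset by fastforce
  show "smooth f \<and> (\<exists>a b. 0 < a \<and> a < b \<and> b < L \<and> (\<forall>x. x \<notin> {a..b} \<longrightarrow> f x = 0))"
  proof (cases "?K = {}")
    case True
    then have "f x = 0" for x
      using sub by blast
    then show ?thesis
      using sm that by (intro conjI exI[of _ "L/3"] exI[of _ "L/2"]) auto
  next
    case False
    obtain s t where "s \<in> ?K" "t \<in> ?K" and st: "\<And>x. x \<in> ?K \<Longrightarrow> s \<le> x" "\<And>x. x \<in> ?K \<Longrightarrow> x \<le> t"
      using compact_attains_inf[OF K(1) False] compact_attains_sup[OF K(1) False] by blast
    then have "0 < s" "t < L" "s < L" "s \<le> t"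
      using K(2) by auto
    \<comment> \<open>Only s \<le> t is known, so the left end is moved to s/2 to get a strict
      inequality.\<close>
    then show ?thesis
      using sm st sub
      by (intro conjI exI[of _ "s/2"] exI[of _ t]) fastforce+
  qed
next
  assume "smooth f \<and> (\<exists>a b. 0 < a \<and> a < b \<and> b < L \<and> (\<forall>x. x \<notin> {a..b} \<longrightarrow> f x = 0))"
  then obtain a b where *: "smooth f" "0 < a" "b < L" "\<And>x. x \<notin> {a..b} \<Longrightarrow> f x = 0"
    by blast
  have sub: "closure {x. f x \<noteq> 0} \<subseteq> {a..b}"
    by (intro closure_minimal) (use *(4) in blast)+
  have "compact (closure {x. f x \<noteq> 0})"
    using sub by (meson bounded_closed_interval bounded_subset closed_closure compact_eq_bounded_closed)
  then show "f \<in> test_functions L"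
    using * sub by (auto simp: test_functions_def smooth_def)
qed

lemma test_functionsI:
  assumes "smooth f" "0 < a" "a < b" "b < L" "\<And>x. x \<notin> {a..b} \<Longrightarrow> f x = 0"
  shows "f \<in> test_functions L"
proof -
  have "L > 0" using assms by linarith
  then show ?thesis
    using assms by (subst test_functions_iff) blast+
qed

text \<open>The functions \<open>p (1/x) exp (-1/x)\<close>, extended by \<open>0\<close> to \<open>x \<le> 0\<close>, with \<open>p\<close> a polynomial,
  are closed under differentiation, hence smooth.\<close>

definition flat_fun :: "real poly \<Rightarrow> real \<Rightarrow> real" where
  "flat_fun p x = (if x > 0 then poly p (1 / x) * exp (- (1 / x)) else 0)"

text \<open>The chain rule with y = 1/x, where dy/dx = -y^2: the derivative of p(y) exp(-y) with
  respect to x is y^2 (p(y) - p'(y)) exp(-y).\<close>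

definition flat_deriv :: "real poly \<Rightarrow> real poly" where
  "flat_deriv p = monom 1 2 * (p - pderiv p)"

lemma tendsto_poly_div_exp: "((\<lambda>x. poly p x / exp x) \<longlongrightarrow> (0::real)) at_top"
proof -
  have "((\<lambda>x. \<Sum>i\<le>degree p. coeff p i * (x ^ i / exp x)) \<longlongrightarrow> (\<Sum>i\<le>degree p. coeff p i * 0)) at_top"
    by (intro tendsto_intros tendsto_power_div_exp_0)
  then show ?thesis
    by (simp add: poly_altdef sum_divide_distrib)
qed

lemma flat_fun_deriv: "(flat_fun p has_real_derivative flat_fun (flat_deriv p) x) (at x)"
proof -
  consider "x > 0" | "x < 0" | "x = 0" by linarith
  then show ?thesis
  proof cases
    case 1
    have "((\<lambda>x. poly p (1 / x) * exp (- (1 / x))) has_real_derivative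
           flat_fun (flat_deriv p) x) (at x)"
      using 1
      apply (auto intro!: derivative_eq_intros DERIV_chain2[of "poly p"] poly_DERIV
                  simp: flat_fun_def flat_deriv_def poly_monom)
      apply (simp add: field_simps power2_eq_square)
      done
    moreover have "eventually (\<lambda>y. flat_fun p y = poly p (1 / y) * exp (- (1 / y))) (nhds x)"
      using eventually_nhds_in_open[of "{0<..}" x] 1
      by (auto simp: flat_fun_def elim!: eventually_mono)
    ultimately show ?thesis
      by (simp add: DERIV_cong_ev[OF refl, of "flat_fun p" "\<lambda>y. poly p (1 / y) * exp (- (1 / y))"])
  next
    case 2
    have "eventually (\<lambda>y. flat_fun p y = 0) (nhds x)"
      using eventually_nhds_in_open[of "{..<0}" x] 2
      by (auto simp: flat_fun_def elim!: eventually_mono)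
    then have "(flat_fun p has_real_derivative 0) (at x)"
      using DERIV_cong_ev[OF refl, of "flat_fun p" "\<lambda>_. 0" x 0 0] by auto
    then show ?thesis
      using 2 by (simp add: flat_fun_def[of _ x])
  next
    case 3
    \<comment> \<open>For h > 0 the difference quotient at 0 is (1/h) p(1/h) exp(-1/h); the factor
      1/h is absorbed into the polynomial.\<close>
    have "((\<lambda>h. poly (monom 1 1 * p) (inverse h) / exp (inverse h)) \<longlongrightarrow> 0) (at_right 0)"
      by (rule filterlim_compose[OF tendsto_poly_div_exp filterlim_inverse_at_top_right])
    then have "((\<lambda>h. (flat_fun p (0 + h) - flat_fun p 0) / h) \<longlongrightarrow> 0) (at_right 0)"
      by (rule Lim_transform_eventually)
         (auto simp: flat_fun_def poly_monom field_simps exp_minus eventually_at_right_less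
               intro!: eventually_mono[OF eventually_at_right_less])
    moreover have "((\<lambda>h. (flat_fun p (0 + h) - flat_fun p 0) / h) \<longlongrightarrow> 0) (at_left 0)"
      by (rule Lim_transform_eventually[OF tendsto_const])
         (auto simp: flat_fun_def eventually_at_filter)
    ultimately have "((\<lambda>h. (flat_fun p (0 + h) - flat_fun p 0) / h) \<longlongrightarrow> 0) (at 0)"
      by (simp add: filterlim_split_at)
    then show ?thesis
      using 3 by (simp add: DERIV_def flat_fun_def[of "flat_deriv p"])
  qed
qed

text \<open>The parameter \<open>n\<close> leaves the support alone and steepens the flanks: as n
  grows, the values inside (a, b) increase to 1.\<close>

definition bump :: "real \<Rightarrow> real \<Rightarrow> real \<Rightarrow> real \<Rightarrow> real" where
  "bump n a b x = flat_fun 1 (n * (x - a)) * flat_fun 1 (n * (b - x))"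

text \<open>Sums of products of two flat functions, encoded as lists of pairs of polynomials, are
  closed under differentiation; the factors \<open>n\<close> and \<open>-n\<close> of the chain rule
  are absorbed into the polynomials.\<close>

lemma smooth_bump: "smooth (\<lambda>x. of_real (bump n a b x))"
proof -
  define G :: "(real poly \<times> real poly) list \<Rightarrow> real \<Rightarrow> real" where
    "G = (\<lambda>xs x. \<Sum>(p, q)\<leftarrow>xs. flat_fun p (n * (x - a)) * flat_fun q (n * (b - x)))"
  have G: "\<exists>ys. \<forall>x. (G xs has_real_derivative G ys x) (at x)" for xs
  proof (induction xs)
    case Nil
    then show ?case by (auto simp: G_def intro!: exI[of _ "[]"])
  next
    case (Cons pq xs)
    obtain p q where pq: "pq = (p, q)" by fastforce
    obtain ys where ys: "\<And>x. (G xs has_real_derivative G ys x) (at x)"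
      using Cons by blast
    let ?ys = "(smult n (flat_deriv p), q) # (smult (-n) p, flat_deriv q) # ys"
    have sm: "flat_fun (smult c r) y = c * flat_fun r y" for c r y
      by (simp add: flat_fun_def)
    have mn: "flat_fun (- r) y = - flat_fun r y" for r y
      by (simp add: flat_fun_def)
    have e: "G (pq # xs) = (\<lambda>x. flat_fun p (n * (x - a)) * flat_fun q (n * (b - x)) + G xs x)"
      by (simp add: G_def pq fun_eq_iff)
    have d1: "((\<lambda>x. flat_fun p (n * (x - a))) has_real_derivative n * flat_fun (flat_deriv p) (n * (x - a))) (at x)" for x
      by (rule DERIV_chain2[OF flat_fun_deriv, THEN DERIV_cong]) (auto intro!: derivative_eq_intros)
    have d2: "((\<lambda>x. flat_fun q (n * (b - x))) has_real_derivative (-n) * flat_fun (flat_deriv q) (n * (b - x))) (at x)" for x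
      by (rule DERIV_chain2[OF flat_fun_deriv, THEN DERIV_cong]) (auto intro!: derivative_eq_intros)
    have "(G (pq # xs) has_real_derivative G ?ys x) (at x)" for x
      unfolding e by (rule DERIV_add[OF DERIV_mult[OF d1 d2] ys, THEN DERIV_cong])
        (simp add: G_def sm mn algebra_simps)
    then show ?case by blast
  qed
  show ?thesis
  proof (rule smooth_class[where F = "range (\<lambda>xs x. complex_of_real (G xs x))"])
    show "(\<lambda>x. complex_of_real (bump n a b x)) \<in> range (\<lambda>xs x. complex_of_real (G xs x))"
      by (auto simp: G_def bump_def intro!: image_eqI[of _ _ "[(1, 1)]"])
  next
    fix f :: "real \<Rightarrow> complex" assume "f \<in> range (\<lambda>xs x. complex_of_real (G xs x))"
    then obtain xs where f: "f = (\<lambda>x. complex_of_real (G xs x))" by blast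
    obtain ys where "\<And>x. (G xs has_real_derivative G ys x) (at x)"
      using G by blast
    then show "\<exists>g\<in>range (\<lambda>xs x. complex_of_real (G xs x)). \<forall>x. (f has_vector_derivative g x) (at x)"
      unfolding f
      by (intro bexI[of _ "\<lambda>x. complex_of_real (G ys x)"] allI has_vector_derivative_of_real)
         (auto simp: has_real_derivative_iff_has_vector_derivative)
  qed
qed

lemma bump_eq:
  "n > 0 \<Longrightarrow> bump n a b x = (if a < x \<and> x < b then exp (- (1 / (n * (x - a)) + 1 / (n * (b - x)))) else 0)"
  by (auto simp: bump_def flat_fun_def zero_less_mult_iff exp_add[symmetric])

lemma bump_test:
  assumes "n > 0" "0 < a" "a < b" "b < L"
  shows "(\<lambda>x. complex_of_real (bump n a b x)) \<in> test_functions L"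
  by (rule test_functionsI[of _ a b], rule smooth_bump) (use assms in \<open>auto simp: bump_eq\<close>)

lemma test_smooth: "f \<in> test_functions L \<Longrightarrow> smooth f"
  by (auto simp: test_functions_def smooth_def)

lemma test_lin:
  assumes "f \<in> test_functions L" "g \<in> test_functions L" "L > 0"
  shows "(\<lambda>x. c * f x + d * g x) \<in> test_functions L"
proof -
  obtain a b where 1: "0 < a" "a < b" "b < L" "\<And>x. x \<notin> {a..b} \<Longrightarrow> f x = 0"
    using assms test_functions_iff by metis
  obtain a' b' where 2: "0 < a'" "a' < b'" "b' < L" "\<And>x. x \<notin> {a'..b'} \<Longrightarrow> g x = 0"
    using assms test_functions_iff by metis
  show ?thesis
  proof (rule test_functionsI[of _ "min a a'" "max b b'"])
    fix x assume "x \<notin> {min a a'..max b b'}"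
    then have "x \<notin> {a..b}" "x \<notin> {a'..b'}" by auto
    then show "c * f x + d * g x = 0" using 1(4)[of x] 2(4)[of x] by auto
  next
    show "min a a' < max b b'" using 1 2 by linarith
  qed (use 1 2 assms in \<open>auto intro: smooth_lin test_smooth\<close>)
qed

lemma test_cnj: "f \<in> test_functions L \<Longrightarrow> L > 0 \<Longrightarrow> (\<lambda>x. cnj (f x)) \<in> test_functions L"
  by (auto simp: test_functions_iff intro: smooth_cnj)

lemma test_nth_deriv:
  assumes "f \<in> test_functions L" "L > 0"
  shows "nth_deriv k f \<in> test_functions L"
proof -
  obtain a b where 1: "0 < a" "a < b" "b < L" "\<And>x. x \<notin> {a..b} \<Longrightarrow> f x = 0"
    using assms test_functions_iff by metis
  have "nth_deriv k f x = 0" if "x \<notin> {a..b}" for x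
    using that
  proof (induction k arbitrary: x)
    case (Suc k)
    have "open (- {a..b})" by auto
    have "(nth_deriv k f has_vector_derivative 0) (at x)"
      by (rule has_vector_derivative_transform_within_open[of "\<lambda>_. 0" _ _ "- {a..b}"])
         (use Suc in auto)
    then show ?case by (simp add: nth_deriv_Suc vector_derivative_at)
  qed (use 1 in auto)
  then show ?thesis
    using 1 assms by (auto simp: test_functions_iff intro!: smooth_nth_deriv)
qed

section \<open>The real Hilbert space structure of the square-integrable functions\<close>

text \<open>The values are multiplied by the inner product of the complex plane as a real space, so
  this is the real part of the usual Hermitian product. It is symmetric and real bilinear, which
  fits a system with real coefficients.\<close>

definition ip :: "real \<Rightarrow> (real \<Rightarrow> complex) \<Rightarrow> (real \<Rightarrow> complex) \<Rightarrow> real" where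
  "ip L f g = integral\<^sup>L (lebesgue_on {0<..<L}) (\<lambda>x. f x \<bullet> g x)"

lemma L2_norm_ip: "L2_norm L f = sqrt (ip L f f)"
  by (simp add: L2_norm_def ip_def power2_norm_eq_inner)

lemma ip_commute: "ip L f g = ip L g f"
  by (simp add: ip_def inner_commute)

lemma ip_self_nonneg [simp]: "0 \<le> ip L f f"
  by (simp add: ip_def)

lemma ip_self: "ip L f f = (L2_norm L f)\<^sup>2"
  by (simp add: L2_norm_ip)

lemma L2_norm_nonneg [simp]: "0 \<le> L2_norm L f"
  by (simp add: L2_norm_ip)

lemma L2_inner_integrable:
  assumes "f \<in> L2 L" "g \<in> L2 L"
  shows "integrable (lebesgue_on {0<..<L}) (\<lambda>x. f x \<bullet> g x)"
proof (rule Bochner_Integration.integrable_bound)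
  show "integrable (lebesgue_on {0<..<L}) (\<lambda>x. (cmod (f x))\<^sup>2 + (cmod (g x))\<^sup>2)"
    using assms by (auto simp: L2_def)
  show "(\<lambda>x. f x \<bullet> g x) \<in> borel_measurable (lebesgue_on {0<..<L})"
    using assms by (auto simp: L2_def)
  have "\<bar>f x \<bullet> g x\<bar> \<le> (cmod (f x))\<^sup>2 + (cmod (g x))\<^sup>2" for x
  proof -
    have "\<bar>f x \<bullet> g x\<bar> \<le> cmod (f x) * cmod (g x)"
      by (rule Cauchy_Schwarz_ineq2)
    also have "\<dots> \<le> (cmod (f x))\<^sup>2 + (cmod (g x))\<^sup>2"
      using sum_squares_bound[of "cmod (f x)" "cmod (g x)"]
        mult_nonneg_nonneg[OF norm_ge_zero norm_ge_zero, of "f x" "g x"] by linarith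
    finally show ?thesis .
  qed
  then show "AE x in lebesgue_on {0<..<L}. norm (f x \<bullet> g x) \<le> norm ((cmod (f x))\<^sup>2 + (cmod (g x))\<^sup>2)"
    by simp
qed

lemma L2_add [simp, intro]:
  assumes "f \<in> L2 L" "g \<in> L2 L"
  shows "(\<lambda>x. f x + g x) \<in> L2 L"
proof -
  have "integrable (lebesgue_on {0<..<L}) (\<lambda>x. f x \<bullet> f x + g x \<bullet> g x + 2 * (f x \<bullet> g x))"
    using assms by (intro Bochner_Integration.integrable_add integrable_mult_right L2_inner_integrable) auto
  then show ?thesis
    using assms by (auto simp: L2_def power2_norm_eq_inner algebra_simps inner_commute)
qed

lemma L2_mult [simp, intro]:
  assumes "f \<in> L2 L"
  shows "(\<lambda>x. c * f x) \<in> L2 L"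
  using assms by (auto simp: L2_def norm_mult power_mult_distrib)

lemma L2_scaleR [simp, intro]: "f \<in> L2 L \<Longrightarrow> (\<lambda>x. (c::real) *\<^sub>R f x) \<in> L2 L"
  using L2_mult[of f L "of_real c"] by (simp add: scaleR_conv_of_real)

lemma L2_minus [simp, intro]: "f \<in> L2 L \<Longrightarrow> (\<lambda>x. - f x) \<in> L2 L"
  using L2_scaleR[of f L "-1"] by simp

lemma L2_diff [simp, intro]:
  "f \<in> L2 L \<Longrightarrow> g \<in> L2 L \<Longrightarrow> (\<lambda>x. f x - g x) \<in> L2 L"
  using L2_add[of f L "\<lambda>x. - g x"] by simp

lemma ip_add_left [simp]:
  "f \<in> L2 L \<Longrightarrow> g \<in> L2 L \<Longrightarrow> h \<in> L2 L \<Longrightarrow> ip L (\<lambda>x. f x + g x) h = ip L f h + ip L g h"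
  by (simp add: ip_def inner_add_left L2_inner_integrable)

lemma ip_diff_left [simp]:
  "f \<in> L2 L \<Longrightarrow> g \<in> L2 L \<Longrightarrow> h \<in> L2 L \<Longrightarrow> ip L (\<lambda>x. f x - g x) h = ip L f h - ip L g h"
  by (simp add: ip_def inner_diff_left L2_inner_integrable)

lemma ip_scaleR_left [simp]: "ip L (\<lambda>x. (c::real) *\<^sub>R f x) h = c * ip L f h"
  by (simp add: ip_def)

lemma ip_minus_left [simp]: "ip L (\<lambda>x. - f x) h = - ip L f h"
  using ip_scaleR_left[of L "-1" f h] by simp

lemma ip_add_right [simp]:
  "f \<in> L2 L \<Longrightarrow> g \<in> L2 L \<Longrightarrow> h \<in> L2 L \<Longrightarrow> ip L h (\<lambda>x. f x + g x) = ip L h f + ip L h g"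
  by (simp add: ip_commute[of L h])

lemma ip_diff_right [simp]:
  "f \<in> L2 L \<Longrightarrow> g \<in> L2 L \<Longrightarrow> h \<in> L2 L \<Longrightarrow> ip L h (\<lambda>x. f x - g x) = ip L h f - ip L h g"
  by (simp add: ip_commute[of L h])

lemma ip_scaleR_right [simp]: "ip L h (\<lambda>x. (c::real) *\<^sub>R f x) = c * ip L h f"
  by (simp add: ip_commute[of L h])

lemma ip_minus_right [simp]: "ip L h (\<lambda>x. - f x) = - ip L h f"
  by (simp add: ip_commute[of L h])

lemma ip_zero [simp]: "ip L (\<lambda>x. 0) h = 0" "ip L h (\<lambda>x. 0) = 0"
  by (simp_all add: ip_def)

lemma L2_norm_zero [simp]: "L2_norm L (\<lambda>x. 0) = 0"
  by (simp add: L2_norm_ip)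

text \<open>The core of the Cauchy-Schwarz inequality, shared by \<open>ip\<close> and, later, by
  the energy form. Neither is definite on representatives, hence the case c = 0.\<close>

lemma discriminant_bound:
  fixes a b c :: real
  assumes q: "\<And>t. 0 \<le> a + 2 * t * b + t\<^sup>2 * c" and c: "c \<ge> 0"
  shows "\<bar>b\<bar> \<le> sqrt a * sqrt c"
proof -
  have "b\<^sup>2 \<le> a * c"
  proof (cases "c = 0")
    case True
    have "b = 0"
    proof (rule ccontr)
      assume "b \<noteq> 0"
      \<comment> \<open>For c = 0 the quadratic is linear in t, and this t gives it the value
        -1.\<close>
      then show False
        using q[of "- (a + 1) / (2 * b)"] True by (simp add: field_simps)
    qed
    then show ?thesis using True by simp
  next
    case False
    then have pos: "c > 0" using c by simp
    have "0 \<le> a - b\<^sup>2 / c"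
      using q[of "- b / c"] pos by (simp add: field_simps power2_eq_square)
    then show ?thesis
      using pos by (simp add: field_simps)
  qed
  then have "sqrt (b\<^sup>2) \<le> sqrt (a * c)"
    by (rule real_sqrt_le_mono)
  then show ?thesis
    by (simp add: real_sqrt_mult)
qed

lemma ip_bound:
  assumes "f \<in> L2 L" "g \<in> L2 L"
  shows "\<bar>ip L f g\<bar> \<le> L2_norm L f * L2_norm L g"
  unfolding L2_norm_ip
proof (rule discriminant_bound)
  show "0 \<le> ip L f f + 2 * t * ip L f g + t\<^sup>2 * ip L g g" for t
    using ip_self_nonneg[of L "\<lambda>x. f x + t *\<^sub>R g x"] assms
    by (simp add: algebra_simps power2_eq_square ip_commute[of L g f])
qed simp

lemma L2_norm_add_le:
  assumes "f \<in> L2 L" "g \<in> L2 L"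
  shows "L2_norm L (\<lambda>x. f x + g x) \<le> L2_norm L f + L2_norm L g"
proof -
  have "(L2_norm L (\<lambda>x. f x + g x))\<^sup>2 = (L2_norm L f)\<^sup>2 + 2 * ip L f g + (L2_norm L g)\<^sup>2"
    using assms by (simp flip: ip_self add: ip_commute[of L g f])
  also have "\<dots> \<le> (L2_norm L f + L2_norm L g)\<^sup>2"
    using ip_bound[OF assms] by (simp add: power2_sum)
  finally show ?thesis
    by (rule power2_le_imp_le) simp
qed

lemma L2_norm_mult [simp]: "L2_norm L (\<lambda>x. c * f x) = cmod c * L2_norm L f"
  by (simp add: L2_norm_def norm_mult power_mult_distrib real_sqrt_mult)

lemma L2_norm_scaleR [simp]: "L2_norm L (\<lambda>x. c *\<^sub>R f x) = \<bar>c\<bar> * L2_norm L f"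
  using L2_norm_mult[of L "of_real c" f] by (simp add: scaleR_conv_of_real)

lemma L2_norm_minus [simp]: "L2_norm L (\<lambda>x. - f x) = L2_norm L f"
  by (simp add: L2_norm_def)

lemma L2_norm_minus_commute: "L2_norm L (\<lambda>x. f x - g x) = L2_norm L (\<lambda>x. g x - f x)"
  by (simp add: L2_norm_def norm_minus_commute)

lemma L2_norm_diff_le:
  "f \<in> L2 L \<Longrightarrow> g \<in> L2 L \<Longrightarrow> L2_norm L (\<lambda>x. f x - g x) \<le> L2_norm L f + L2_norm L g"
  using L2_norm_add_le[of f L "\<lambda>x. - g x"] by simp

lemma L2_norm_triangle:
  assumes "f \<in> L2 L" "g \<in> L2 L" "h \<in> L2 L"
  shows "L2_norm L (\<lambda>x. f x - h x) \<le> L2_norm L (\<lambda>x. f x - g x) + L2_norm L (\<lambda>x. g x - h x)"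
  using L2_norm_add_le[of "\<lambda>x. f x - g x" L "\<lambda>x. g x - h x"] assms by simp

lemma L2_norm_le_diff:
  assumes "f \<in> L2 L" "g \<in> L2 L"
  shows "L2_norm L f \<le> L2_norm L g + L2_norm L (\<lambda>x. f x - g x)"
  using L2_norm_add_le[of g L "\<lambda>x. f x - g x"] assms by simp

text \<open>Equality in L^2 for representatives. Membership is included so that one fact also
  supplies the side conditions of the rules for \<open>ip\<close>.\<close>

definition eqv :: "real \<Rightarrow> (real \<Rightarrow> complex) \<Rightarrow> (real \<Rightarrow> complex) \<Rightarrow> bool" where
  "eqv L f g \<longleftrightarrow> f \<in> L2 L \<and> g \<in> L2 L \<and> L2_norm L (\<lambda>x. f x - g x) = 0"

lemma eqv_refl: "f \<in> L2 L \<Longrightarrow> eqv L f f"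
  by (simp add: eqv_def)

lemma eqv_sym: "eqv L f g \<Longrightarrow> eqv L g f"
  by (simp add: eqv_def L2_norm_minus_commute[of L f g])

lemma eqv_trans:
  assumes "eqv L f g" "eqv L g h" shows "eqv L f h"
  using L2_norm_triangle[of f L g h] L2_norm_nonneg[of L "\<lambda>x. f x - h x"] assms
  unfolding eqv_def by (auto simp del: L2_norm_nonneg)

lemma eqv_ip:
  assumes "eqv L f f'" "g \<in> L2 L"
  shows "ip L f g = ip L f' g" "ip L g f = ip L g f'"
  using ip_bound[of "\<lambda>x. f x - f' x" L g] assms by (auto simp: eqv_def ip_commute[of L g])

lemma eqv_norm: "eqv L f f' \<Longrightarrow> L2_norm L f = L2_norm L f'"
  using eqv_ip(1)[of L f f' f] eqv_ip(2)[of L f f' f'] by (auto simp: eqv_def L2_norm_ip)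

lemma eqv_add:
  assumes "eqv L f f'" "eqv L g g'"
  shows "eqv L (\<lambda>x. f x + g x) (\<lambda>x. f' x + g' x)"
  using L2_norm_add_le[of "\<lambda>x. f x - f' x" L "\<lambda>x. g x - g' x"] assms
    L2_norm_nonneg[of L "\<lambda>x. f x + g x - (f' x + g' x)"]
  unfolding eqv_def by (auto simp: algebra_simps simp del: L2_norm_nonneg)

lemma eqv_mult:
  assumes "eqv L f f'"
  shows "eqv L (\<lambda>x. c * f x) (\<lambda>x. c * f' x)"
proof -
  have "(\<lambda>x. c * f x - c * f' x) = (\<lambda>x. c * (f x - f' x))"
    by (simp add: algebra_simps)
  then show ?thesis using assms by (simp add: eqv_def)
qed

lemma eqv_scaleR: "eqv L f f' \<Longrightarrow> eqv L (\<lambda>x. (c::real) *\<^sub>R f x) (\<lambda>x. c *\<^sub>R f' x)"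
  using eqv_mult[of L f f' "of_real c"] by (simp add: scaleR_conv_of_real)

lemma eqv_diff:
  "eqv L f f' \<Longrightarrow> eqv L g g' \<Longrightarrow> eqv L (\<lambda>x. f x - g x) (\<lambda>x. f' x - g' x)"
  using eqv_add[of L f f' "\<lambda>x. -1 * g x" "\<lambda>x. -1 * g' x"] eqv_mult[of L g g' "-1"] by simp

section \<open>Criteria for membership in L^2 and dominated convergence\<close>

lemma L2_bounded:
  assumes "f \<in> borel_measurable (lebesgue_on {0<..<L})" "\<And>x. 0 < x \<Longrightarrow> x < L \<Longrightarrow> cmod (f x) \<le> B"
  shows "f \<in> L2 L"
proof -
  interpret finite_measure "lebesgue_on {0<..<L}"
    by (rule finite_measure_lebesgue_on) auto
  have "integrable (lebesgue_on {0<..<L}) (\<lambda>x. (cmod (f x))\<^sup>2)"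
    by (rule integrable_const_bound[where B = "B\<^sup>2"])
       (use assms in \<open>auto simp: AE_restrict_space_iff intro!: AE_I2 power_mono\<close>)
  then show ?thesis using assms by (simp add: L2_def)
qed

lemma L2_continuous:
  assumes "continuous_on {0..L} f"
  shows "f \<in> L2 L"
proof -
  obtain B where "\<And>x. x \<in> {0..L} \<Longrightarrow> cmod (f x) \<le> B"
    using compact_imp_bounded[OF compact_continuous_image[OF assms compact_Icc]] by (metis bounded_iff imageI)
  moreover have "f \<in> borel_measurable (lebesgue_on {0<..<L})"
    by (rule continuous_imp_measurable_on_sets_lebesgue) (auto intro: continuous_on_subset[OF assms])
  ultimately show ?thesis by (intro L2_bounded[of f L B]) auto
qed

lemma test_L2 [simp, intro]: "f \<in> test_functions L \<Longrightarrow> f \<in> L2 L"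
  using smooth_continuous[OF test_smooth, of f L "{0..L}" 0] by (intro L2_continuous) simp

lemma L2_norm_dominated:
  assumes fn: "\<And>n. f n \<in> L2 L" and f: "f' \<in> borel_measurable (lebesgue_on {0<..<L})"
    and g: "g \<in> L2 L"
    and bd: "\<And>n x. 0 < x \<Longrightarrow> x < L \<Longrightarrow> cmod (f n x) \<le> cmod (g x)"
    and lim: "\<And>x. 0 < x \<Longrightarrow> x < L \<Longrightarrow> (\<lambda>n. f n x) \<longlonglongrightarrow> f' x"
  shows "f' \<in> L2 L" "(\<lambda>n. L2_norm L (\<lambda>x. f' x - f n x)) \<longlonglongrightarrow> 0"
proof -
  let ?M = "lebesgue_on {0<..<L}"
  have bd': "cmod (f' x) \<le> cmod (g x)" if "0 < x" "x < L" for x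
    by (rule LIMSEQ_le_const2[OF tendsto_norm[OF lim]]) (use that bd in auto)
  have gi: "integrable ?M (\<lambda>x. (cmod (g x))\<^sup>2)" and gm: "g \<in> borel_measurable ?M"
    using g by (auto simp: L2_def)
  have "integrable ?M (\<lambda>x. (cmod (f' x))\<^sup>2)"
    by (rule Bochner_Integration.integrable_bound[OF gi])
       (use f bd' in \<open>auto intro!: AE_I2 power_mono\<close>)
  then show L: "f' \<in> L2 L" using f by (simp add: L2_def)
  have "(\<lambda>n. integral\<^sup>L ?M (\<lambda>x. (cmod (f' x - f n x))\<^sup>2)) \<longlonglongrightarrow> integral\<^sup>L ?M (\<lambda>x. 0)"
  proof (rule integral_dominated_convergence[where w = "\<lambda>x. 4 * (cmod (g x))\<^sup>2"])
    show "(\<lambda>x. (cmod (f' x - f n x))\<^sup>2) \<in> borel_measurable ?M" for n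
      using L2_diff[OF L fn[of n]] by (auto simp: L2_def)
    show "AE x in ?M. norm ((cmod (f' x - f n x))\<^sup>2) \<le> 4 * (cmod (g x))\<^sup>2" for n
    proof (rule AE_I2)
      fix x assume "x \<in> space ?M"
      then have x: "0 < x" "x < L" by auto
      have "cmod (f' x - f n x) \<le> 2 * cmod (g x)"
        using norm_triangle_ineq4[of "f' x" "f n x"] bd[OF x] bd'[OF x] by (smt (verit))
      then have "(cmod (f' x - f n x))\<^sup>2 \<le> (2 * cmod (g x))\<^sup>2"
        by (rule power_mono) simp
      then show "norm ((cmod (f' x - f n x))\<^sup>2) \<le> 4 * (cmod (g x))\<^sup>2"
        by (simp add: power_mult_distrib)
    qed
    show "AE x in ?M. (\<lambda>n. (cmod (f' x - f n x))\<^sup>2) \<longlonglongrightarrow> 0"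
    proof (rule AE_I2)
      fix x assume "x \<in> space ?M"
      then have "(\<lambda>n. (cmod (f' x - f n x))\<^sup>2) \<longlonglongrightarrow> (cmod (f' x - f' x))\<^sup>2"
        by (intro tendsto_intros lim) auto
      then show "(\<lambda>n. (cmod (f' x - f n x))\<^sup>2) \<longlonglongrightarrow> 0" by simp
    qed
  qed (use gi in auto)
  then have "(\<lambda>n. sqrt (integral\<^sup>L ?M (\<lambda>x. (cmod (f' x - f n x))\<^sup>2))) \<longlonglongrightarrow> sqrt 0"
    by (intro tendsto_real_sqrt) simp
  then show "(\<lambda>n. L2_norm L (\<lambda>x. f' x - f n x)) \<longlonglongrightarrow> 0"
    by (simp add: L2_norm_def)
qed

section \<open>Density of the test functions\<close>

text \<open>The L^2 closure of the test functions. Its stability under limits and linear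
  combinations drives the passage from intervals to Borel sets, Lebesgue sets and simple
  functions.\<close>

definition approx :: "real \<Rightarrow> (real \<Rightarrow> complex) \<Rightarrow> bool" where
  "approx L f \<longleftrightarrow> f \<in> L2 L \<and> (\<forall>e>0. \<exists>\<phi>\<in>test_functions L. L2_norm L (\<lambda>x. f x - \<phi> x) < e)"

lemma approx_limit:
  assumes "\<And>n. approx L (f n)" "f' \<in> L2 L" "(\<lambda>n. L2_norm L (\<lambda>x. f' x - f n x)) \<longlonglongrightarrow> 0"
  shows "approx L f'"
  unfolding approx_def
proof (intro conjI allI impI assms(2))
  fix e :: real assume "e > 0"
  then obtain n where n: "L2_norm L (\<lambda>x. f' x - f n x) < e / 2"
    using order_tendstoD(2)[OF assms(3), of "e/2"] by (auto simp: eventually_sequentially)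
  obtain \<phi> where \<phi>: "\<phi> \<in> test_functions L" "L2_norm L (\<lambda>x. f n x - \<phi> x) < e / 2"
    using assms(1)[of n] \<open>e > 0\<close> unfolding approx_def by (meson half_gt_zero)
  have "L2_norm L (\<lambda>x. f' x - \<phi> x) \<le> L2_norm L (\<lambda>x. f' x - f n x) + L2_norm L (\<lambda>x. f n x - \<phi> x)"
    using assms \<phi> by (intro L2_norm_triangle) (auto simp: approx_def)
  then show "\<exists>\<phi>\<in>test_functions L. L2_norm L (\<lambda>x. f' x - \<phi> x) < e"
    using n \<phi> by (intro bexI[of _ \<phi>]) auto
qed

lemma approx_test: "\<phi> \<in> test_functions L \<Longrightarrow> approx L \<phi>"
  by (auto simp: approx_def intro!: bexI[of _ \<phi>])

lemma approx_eqv: "approx L f \<Longrightarrow> eqv L f g \<Longrightarrow> approx L g"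
  by (rule approx_limit[of L "\<lambda>_. f"]) (auto simp: eqv_def L2_norm_minus_commute[of L f g])

lemma approx_dominated:
  assumes "\<And>n. approx L (f n)" "f' \<in> borel_measurable (lebesgue_on {0<..<L})"
    "g \<in> L2 L" "\<And>n x. 0 < x \<Longrightarrow> x < L \<Longrightarrow> cmod (f n x) \<le> cmod (g x)"
    "\<And>x. 0 < x \<Longrightarrow> x < L \<Longrightarrow> (\<lambda>n. f n x) \<longlonglongrightarrow> f' x"
  shows "approx L f'"
proof -
  have "f n \<in> L2 L" for n using assms(1) by (simp add: approx_def)
  note * = L2_norm_dominated[OF this assms(2-5)]
  show ?thesis by (rule approx_limit[OF assms(1) *])
qed

lemma approx_zero: "L > 0 \<Longrightarrow> approx L (\<lambda>x. 0)"
  by (intro approx_test test_functionsI[of _ "L/3" "L/2"] smooth_class[where F = "{\<lambda>x. 0}"]) auto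

lemma approx_lin:
  assumes "approx L f" "approx L g" "L > 0"
  shows "approx L (\<lambda>x. c * f x + d * g x)"
  unfolding approx_def
proof (intro conjI allI impI)
  show "(\<lambda>x. c * f x + d * g x) \<in> L2 L" using assms by (auto simp: approx_def)
  fix e :: real assume e: "e > 0"
  \<comment> \<open>The summand 1 keeps the denominator positive when c = d = 0 and makes the final
    estimate strict.\<close>
  define e' where "e' = e / (cmod c + cmod d + 1)"
  have pos: "cmod c + cmod d + 1 > 0" by (smt (verit) norm_ge_zero)
  have "e' > 0" using e pos by (simp add: e'_def)
  obtain \<phi> where \<phi>: "\<phi> \<in> test_functions L" "L2_norm L (\<lambda>x. f x - \<phi> x) < e'"
    using assms(1) \<open>e' > 0\<close> by (auto simp: approx_def)
  obtain \<psi> where \<psi>: "\<psi> \<in> test_functions L" "L2_norm L (\<lambda>x. g x - \<psi> x) < e'"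
    using assms(2) \<open>e' > 0\<close> by (auto simp: approx_def)
  have "(\<lambda>x. c * f x + d * g x - (c * \<phi> x + d * \<psi> x)) = (\<lambda>x. c * (f x - \<phi> x) + d * (g x - \<psi> x))"
    by (simp add: algebra_simps)
  then have "L2_norm L (\<lambda>x. c * f x + d * g x - (c * \<phi> x + d * \<psi> x))
    \<le> L2_norm L (\<lambda>x. c * (f x - \<phi> x)) + L2_norm L (\<lambda>x. d * (g x - \<psi> x))"
    using assms \<phi> \<psi> by (simp only:) (intro L2_norm_add_le L2_mult L2_diff, auto simp: approx_def)
  also have "\<dots> \<le> cmod c * e' + cmod d * e'"
    using \<phi> \<psi> by (simp add: add_mono mult_left_mono)
  also have "\<dots> < e' * (cmod c + cmod d + 1)"
    using \<open>e' > 0\<close> by (simp add: algebra_simps)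
  finally show "\<exists>\<phi>\<in>test_functions L. L2_norm L (\<lambda>x. c * f x + d * g x - \<phi> x) < e"
    using \<phi> \<psi> pos assms(3) by (intro bexI[of _ "\<lambda>x. c * \<phi> x + d * \<psi> x"] test_lin) (auto simp: e'_def)
qed

lemma approx_sum:
  assumes "L > 0" "finite A" "\<And>i. i \<in> A \<Longrightarrow> approx L (f i)"
  shows "approx L (\<lambda>x. \<Sum>i\<in>A. f i x)"
  using assms(2,3)
proof (induction A)
  case (insert i A)
  then show ?case
    using approx_lin[of L "f i" "\<lambda>x. \<Sum>i\<in>A. f i x" 1 1] assms(1) by simp
qed (simp add: approx_zero assms(1))

text \<open>Bumps with growing \<open>n\<close> approximate the indicator of an interval well inside
  (0, L). An interval that may touch an end point is exhausted from inside by intervals of that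
  kind.\<close>

lemma approx_interval:
  assumes "0 \<le> a" "b \<le> L" "L > 0"
  shows "approx L (\<lambda>x. indicator {a<..<b} x)"
proof (cases "a < b")
  case False
  then show ?thesis using approx_zero[OF assms(3)] by (simp add: indicator_def[abs_def])
next
  case ab: True
  have inner: "approx L (\<lambda>x. indicator {a<..<b} x)" if "0 < a" "a < b" "b < L" for a b
  proof (rule approx_dominated[where f = "\<lambda>n x. complex_of_real (bump (real (Suc n)) a b x)" and g = "\<lambda>_. 1"])
    show "approx L (\<lambda>x. complex_of_real (bump (real (Suc n)) a b x))" for n
      by (intro approx_test bump_test that) auto
    show "(\<lambda>_. 1) \<in> L2 L"
      by (rule L2_continuous) auto
    show "cmod (complex_of_real (bump (real (Suc n)) a b x)) \<le> cmod 1" for n x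
      by (auto simp: bump_eq intro!: add_nonneg_nonneg simp flip: minus_add_distrib)
    show "(\<lambda>n. complex_of_real (bump (real (Suc n)) a b x)) \<longlonglongrightarrow> indicator {a<..<b} x" for x
    proof (cases "a < x \<and> x < b")
      case True
      define c where "c = 1 / (x - a) + 1 / (b - x)"
      have "bump (real (Suc n)) a b x = exp (- (c * inverse (real (Suc n))))" for n
        using True by (simp add: bump_eq c_def algebra_simps inverse_eq_divide)
      moreover have "(\<lambda>n. exp (- (c * inverse (real (Suc n))))) \<longlonglongrightarrow> exp (- (c * 0))"
        by (intro tendsto_intros LIMSEQ_inverse_real_of_nat)
      ultimately have "(\<lambda>n. bump (real (Suc n)) a b x) \<longlonglongrightarrow> 1" by simp
      then have "(\<lambda>n. complex_of_real (bump (real (Suc n)) a b x)) \<longlonglongrightarrow> complex_of_real 1"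
        by (rule tendsto_of_real)
      then show ?thesis using True by simp
    next
      case False
      then have "bump (real (Suc n)) a b x = 0" for n
        by (auto simp: bump_eq)
      then show ?thesis using False by (auto simp: indicator_def)
    qed
    show "(\<lambda>x. indicator {a<..<b} x :: complex) \<in> borel_measurable (lebesgue_on {0<..<L})"
      by (intro borel_measurable_indicator)
         (use that in \<open>auto simp: sets_restrict_space intro!: image_eqI[of _ _ "{a<..<b}"]\<close>)
  qed
  \<comment> \<open>A third of the length keeps the shrunken interval nonempty from n = 0
    on.\<close>
  define r where "r n = (b - a) / 3 * inverse (real (Suc n))" for n
  have r: "r n > 0" "a + r n < b - r n" for n
  proof -
    show "r n > 0" using ab by (simp add: r_def)
    have "r n \<le> (b - a) / 3 * 1"
      unfolding r_def using ab by (intro mult_left_mono) (auto simp: inverse_le_1_iff)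
    then show "a + r n < b - r n" using ab by simp
  qed
  have r0: "r \<longlonglongrightarrow> 0"
    unfolding r_def using tendsto_mult_left[OF LIMSEQ_inverse_real_of_nat, of "(b - a) / 3"] by simp
  show ?thesis
  proof (rule approx_dominated[where f = "\<lambda>n x. indicator {a + r n<..<b - r n} x" and g = "\<lambda>_. 1"])
    show "approx L (\<lambda>x. indicator {a + r n<..<b - r n} x)" for n
      using r[of n] assms by (intro inner) auto
    show "(\<lambda>_. 1) \<in> L2 L"
      by (rule L2_continuous) auto
    show "cmod (indicator {a + r n<..<b - r n} x) \<le> cmod 1" for n x
      by (auto simp: indicator_def)
    show "(\<lambda>n. indicator {a + r n<..<b - r n} x :: complex) \<longlonglongrightarrow> indicator {a<..<b} x" for x
    proof (cases "a < x \<and> x < b")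
      case True
      have "eventually (\<lambda>n. r n < min (x - a) (b - x)) sequentially"
        using order_tendstoD(2)[OF r0, of "min (x - a) (b - x)"] True by simp
      then show ?thesis
        by (intro tendsto_eventually, eventually_elim) (use True in \<open>auto simp: indicator_def\<close>)
    next
      case False
      then have "indicator {a + r n<..<b - r n} x = (indicator {a<..<b} x :: complex)" for n
        using r(1)[of n] by (auto simp: indicator_def)
      then show ?thesis by simp
    qed
    show "(\<lambda>x. indicator {a<..<b} x :: complex) \<in> borel_measurable (lebesgue_on {0<..<L})"
      by (intro borel_measurable_indicator)
         (use assms in \<open>auto simp: sets_restrict_space intro!: image_eqI[of _ _ "{a<..<b}"]\<close>)
  qed
qed

text \<open>Dynkin's pi-lambda theorem with the open intervals as generator. Disjointness of the
  sets makes each partial sum an indicator again, hence bounded by 1.\<close>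

lemma approx_borel:
  assumes "L > 0" "A \<in> sets borel"
  shows "approx L (\<lambda>x. indicator (A \<inter> {0<..<L}) x)"
proof -
  have meas: "(\<lambda>x. indicator (B \<inter> {0<..<L}) x :: complex) \<in> borel_measurable (lebesgue_on {0<..<L})"
    if "B \<in> sets borel" for B
    by (intro borel_measurable_indicator)
       (use that in \<open>auto simp: sets_restrict_space intro!: image_eqI[of _ _ B]\<close>)
  have "Int_stable (range (\<lambda>(a, b). box a b :: real set))"
    by (auto simp: Int_stable_def box_Int_box)
  moreover have "range (\<lambda>(a, b). box a b :: real set) \<subseteq> Pow UNIV" by auto
  moreover have sig: "sigma_sets UNIV (range (\<lambda>(a, b). box a b :: real set)) = sets borel"
    by (simp add: borel_eq_box[where 'a = real])
  then have "A \<in> sigma_sets UNIV (range (\<lambda>(a, b). box a b :: real set))"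
    using assms by simp
  ultimately show ?thesis
  proof (induction rule: sigma_sets_induct_disjoint)
    case (basic A)
    then obtain a b where A: "A = {a<..<b}" by (auto simp: box_real)
    then have "A \<inter> {0<..<L} = {max a 0<..<min b L}" by auto
    then show ?case using approx_interval[of "max a 0" "min b L" L] assms by simp
  next
    case empty
    then show ?case using approx_zero[OF assms(1)] by simp
  next
    case (compl A)
    have "approx L (\<lambda>x. 1 * indicator {0<..<L} x + (-1) * indicator (A \<inter> {0<..<L}) x)"
      using assms by (intro approx_lin compl approx_interval) auto
    moreover have "(\<lambda>x. 1 * indicator {0<..<L} x + (-1) * indicator (A \<inter> {0<..<L}) x)
       = (\<lambda>x. indicator ((UNIV - A) \<inter> {0<..<L}) x :: complex)"
      by (auto simp: indicator_def)
    ultimately show ?case by simp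
  next
    case (union A)
    have ind: "(\<Sum>i<n. indicator (A i \<inter> {0<..<L}) x)
        = (indicator (\<Union>i<n. A i \<inter> {0<..<L}) x :: complex)" for n x
      by (rule indicator_UN_disjoint[symmetric])
         (use union(1) in \<open>auto simp: disjoint_family_on_def\<close>)
    show ?case
    proof (rule approx_dominated[where f = "\<lambda>n x. \<Sum>i<n. indicator (A i \<inter> {0<..<L}) x" and g = "\<lambda>_. 1"])
      show "approx L (\<lambda>x. \<Sum>i<n. indicator (A i \<inter> {0<..<L}) x)" for n
        by (intro approx_sum union assms) auto
      show "(\<lambda>_. 1) \<in> L2 L"
        by (rule L2_continuous) auto
      show "cmod (\<Sum>i<n. indicator (A i \<inter> {0<..<L}) x) \<le> cmod 1" for n x
        unfolding ind by (simp add: indicator_def)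
      show "(\<lambda>n. \<Sum>i<n. indicator (A i \<inter> {0<..<L}) x) \<longlonglongrightarrow> (indicator (\<Union> (range A) \<inter> {0<..<L}) x :: complex)" for x
      proof (cases "\<exists>i. x \<in> A i")
        case True
        then obtain i where i: "x \<in> A i" by blast
        show ?thesis
          unfolding ind
          by (rule tendsto_eventually, rule eventually_sequentiallyI[of "Suc i"])
             (use i in \<open>auto simp: indicator_def\<close>)
      next
        case False
        then show ?thesis by (simp add: indicator_def)
      qed
      show "(\<lambda>x. indicator (\<Union> (range A) \<inter> {0<..<L}) x :: complex) \<in> borel_measurable (lebesgue_on {0<..<L})"
        by (rule meas) (use union(2) sig in auto)
    qed
  qed
qed

text \<open>A Lebesgue set is a Borel set up to a subset of a null set, and the norm does not see
  the difference.\<close>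

lemma approx_lebesgue:
  assumes "L > 0" "A \<in> sets (lebesgue_on {0<..<L})"
  shows "approx L (\<lambda>x. indicator A x)"
proof -
  have A: "A \<in> sets lebesgue" "A \<subseteq> {0<..<L}"
    using assms(2) by (auto simp: sets_restrict_space_iff)
  obtain S N N' where S: "A = S \<union> N" "N \<subseteq> N'" "N' \<in> null_sets lborel" "S \<in> sets lborel"
    using A(1) by (rule sets_completionE)
  have Sint: "S \<inter> {0<..<L} = S" using A S by auto
  have ap: "approx L (\<lambda>x. indicator S x)"
    using approx_borel[OF assms(1), of S] S by (simp add: Sint)
  have m: "(\<lambda>x. indicator A x :: complex) \<in> borel_measurable (lebesgue_on {0<..<L})"
    by (intro borel_measurable_indicator assms)
  have Am: "(\<lambda>x. indicator A x) \<in> L2 L"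
    by (rule L2_bounded[OF m, of 1]) (auto simp: indicator_def)
  have "N' \<in> null_sets lebesgue"
    using S(3) by (rule null_sets_completionI)
  then have "AE x in lebesgue. x \<notin> N'"
    by (rule AE_not_in)
  then have "AE x in lebesgue_on {0<..<L}. x \<notin> N'"
    by (simp add: AE_restrict_space_iff) (erule eventually_mono, simp)
  then have "AE x in lebesgue_on {0<..<L}. (cmod (indicator S x - indicator A x))\<^sup>2 = 0"
    by eventually_elim (use S in \<open>auto simp: indicator_def\<close>)
  then have "L2_norm L (\<lambda>x. indicator S x - indicator A x) = 0"
    unfolding L2_norm_def by (subst integral_eq_zero_AE) auto
  then have "eqv L (\<lambda>x. indicator S x) (\<lambda>x. indicator A x)"
    using ap Am by (simp add: eqv_def approx_def)
  then show ?thesis using approx_eqv[OF ap] by blast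
qed

theorem test_dense_L2:
  assumes "L > 0" "f \<in> L2 L"
  shows "approx L f"
proof -
  let ?M = "lebesgue_on {0<..<L}"
  have fm: "f \<in> borel_measurable ?M" using assms by (simp add: L2_def)
  from borel_measurable_implies_sequence_metric[OF fm, of 0] obtain F where
    F': "\<forall>i. simple_function ?M (F i)" "\<forall>x\<in>space ?M. (\<lambda>i. F i x) \<longlonglongrightarrow> f x"
      "\<forall>i. \<forall>x\<in>space ?M. dist (F i x) 0 \<le> 2 * dist (f x) 0"
    by (elim exE conjE)
  note F = F'(1)[rule_format] F'(2)[rule_format] F'(3)[rule_format]
  \<comment> \<open>The simple function as a finite sum of multiples of indicators, the form that
    \<open>approx_sum\<close> accepts.\<close>
  define G where "G i x = (\<Sum>y \<in> F i ` space ?M. y * indicator (F i -` {y} \<inter> space ?M) x)" for i x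
  have GF: "G i x = F i x" if "x \<in> space ?M" for i x
    unfolding G_def
    by (subst simple_function_indicator_representation_banach[OF F(1) that, of i])
       (auto intro!: sum.cong simp: indicator_def)
  have sp: "space ?M = {0<..<L}" by simp
  show ?thesis
  proof (rule approx_dominated[where f = G and g = "\<lambda>x. 2 * f x"])
    show "approx L (G i)" for i
      unfolding G_def
    proof (rule approx_sum[OF assms(1)])
      show "finite (F i ` space ?M)"
        using F(1)[of i] by (simp add: simple_function_def)
      fix y assume y: "y \<in> F i ` space ?M"
      have "F i -` {y} \<inter> space ?M \<in> sets ?M"
        using F(1)[of i] y unfolding simple_function_def by blast
      then have "approx L (indicator (F i -` {y} \<inter> space ?M))"
        using approx_lebesgue[OF assms(1)] by simp
      from approx_lin[OF this this assms(1), of y 0]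
      show "approx L (\<lambda>x. y * indicator (F i -` {y} \<inter> space ?M) x)" by simp
    qed
    show "(\<lambda>n. G n x) \<longlonglongrightarrow> f x" if "0 < x" "x < L" for x
      using F(2)[of x] GF[of x] that sp by simp
    show "cmod (G n x) \<le> cmod (2 * f x)" if "0 < x" "x < L" for n x
      using F(3)[of x n] GF[of x n] that sp by (simp add: norm_mult)
  qed (use assms fm in auto)
qed

text \<open>Fundamental lemma of the calculus of variations in L^2: the difference of f and g is
  orthogonal to the test functions that approximate this very difference, so its norm is 0.\<close>

lemma eqv_if_ip_test_eq:
  assumes "L > 0" "f \<in> L2 L" "g \<in> L2 L" "\<And>\<phi>. \<phi> \<in> test_functions L \<Longrightarrow> ip L f \<phi> = ip L g \<phi>"
  shows "eqv L f g"
proof -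
  let ?h = "\<lambda>x. f x - g x"
  have h: "?h \<in> L2 L" using assms by simp
  have "(L2_norm L ?h)\<^sup>2 \<le> 0 + e * (L2_norm L ?h + 1)" if "e > 0" for e
  proof -
    obtain \<phi> where \<phi>: "\<phi> \<in> test_functions L" "L2_norm L (\<lambda>x. ?h x - \<phi> x) < e"
      using test_dense_L2[OF assms(1) h] \<open>e > 0\<close> by (auto simp: approx_def)
    have "ip L ?h ?h = ip L ?h (\<lambda>x. ?h x - \<phi> x) + ip L ?h \<phi>"
      using ip_diff_right[OF h test_L2[OF \<phi>(1)] h] by simp
    also have "ip L ?h \<phi> = 0"
      using assms \<phi> by simp
    also have "ip L ?h (\<lambda>x. ?h x - \<phi> x) \<le> L2_norm L ?h * e"
      using ip_bound[OF h, of "\<lambda>x. ?h x - \<phi> x"] \<phi> h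
        mult_left_mono[of "L2_norm L (\<lambda>x. ?h x - \<phi> x)" e "L2_norm L ?h"] by auto
    finally show ?thesis
      using \<open>e > 0\<close> by (simp add: ip_self algebra_simps)
  qed
  note * = this
  have pos: "L2_norm L ?h + 1 > 0" by (simp add: add_nonneg_pos)
  have "(L2_norm L ?h)\<^sup>2 \<le> 0"
  proof (rule field_le_epsilon)
    fix d :: real assume "0 < d"
    then have "d / (L2_norm L ?h + 1) > 0" using pos by simp
    from *[OF this] show "(L2_norm L ?h)\<^sup>2 \<le> 0 + d"
      using pos by simp
  qed
  then show ?thesis using assms by (simp add: eqv_def)
qed

section \<open>Weak derivatives\<close>

lemma L2_mult_integrable:
  assumes "f \<in> L2 L" "g \<in> L2 L"
  shows "integrable (lebesgue_on {0<..<L}) (\<lambda>x. f x * g x)"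
proof (rule Bochner_Integration.integrable_bound)
  have "(\<lambda>x. complex_of_real (cmod (f x))) \<in> L2 L" "(\<lambda>x. complex_of_real (cmod (g x))) \<in> L2 L"
    using assms by (auto simp: L2_def)
  then show "integrable (lebesgue_on {0<..<L}) (\<lambda>x. complex_of_real (cmod (f x)) \<bullet> complex_of_real (cmod (g x)))"
    by (rule L2_inner_integrable)
qed (use assms in \<open>auto simp: L2_def inner_complex_def norm_mult\<close>)

lemma L2_cnj: "f \<in> L2 L \<Longrightarrow> (\<lambda>x. cnj (f x)) \<in> L2 L"
  by (auto simp: L2_def intro: measurable_compose[OF _ borel_measurable_continuous_onI[OF continuous_on_cnj[OF continuous_on_id]]])

lemma Re_integral_mult:
  assumes "f \<in> L2 L" "g \<in> L2 L"
  shows "Re (integral\<^sup>L (lebesgue_on {0<..<L}) (\<lambda>x. f x * g x)) = ip L f (\<lambda>x. cnj (g x))"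
  using integral_Re[OF L2_mult_integrable[OF assms]]
  by (simp add: ip_def inner_complex_def)

lemma Im_integral_mult:
  assumes "f \<in> L2 L" "g \<in> L2 L"
  shows "Im (integral\<^sup>L (lebesgue_on {0<..<L}) (\<lambda>x. f x * g x)) = ip L f (\<lambda>x. cnj (- \<i> * g x))"
  using integral_Im[OF L2_mult_integrable[OF assms]]
  by (simp add: ip_def inner_complex_def algebra_simps)

lemma Re_of_real_mult: "Re (complex_of_real r * z) = r * Re z"
  and Im_of_real_mult: "Im (complex_of_real r * z) = r * Im z"
  by simp_all

text \<open>The definition pairs functions bilinearly over the complex numbers, whereas
  \<open>ip\<close> is the real part of the Hermitian product. Conjugating \<open>\<phi>\<close>
  matches the real parts; multiplying it by -i before conjugating matches the imaginary parts, and
  test functions are stable under both operations.\<close>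

lemma has_weak_deriv_iff:
  assumes L: "L > 0"
  shows "has_weak_deriv L k f g \<longleftrightarrow> f \<in> L2 L \<and> g \<in> L2 L \<and>
    (\<forall>\<phi>\<in>test_functions L. ip L f (nth_deriv k \<phi>) = (- 1) ^ k * ip L g \<phi>)"
    (is "?A \<longleftrightarrow> ?B")
proof
  assume A: ?A
  have "ip L f (nth_deriv k \<phi>) = (- 1) ^ k * ip L g \<phi>" if \<phi>: "\<phi> \<in> test_functions L" for \<phi>
  proof -
    have c: "(\<lambda>x. cnj (\<phi> x)) \<in> test_functions L"
      using \<phi> L by (rule test_cnj)
    have nd: "nth_deriv k (\<lambda>x. cnj (\<phi> x)) = (\<lambda>x. cnj (nth_deriv k \<phi> x))"
      by (rule nth_deriv_cnj[OF test_smooth[OF \<phi>]])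
    have fg: "f \<in> L2 L" "g \<in> L2 L" using A by (auto simp: has_weak_deriv_def)
    have n: "(\<lambda>x. cnj (nth_deriv k \<phi> x)) \<in> L2 L"
      by (intro L2_cnj test_L2 test_nth_deriv \<phi> L)
    have "Re (integral\<^sup>L (lebesgue_on {0<..<L}) (\<lambda>x. f x * cnj (nth_deriv k \<phi> x)))
      = Re ((- 1) ^ k * integral\<^sup>L (lebesgue_on {0<..<L}) (\<lambda>x. g x * cnj (\<phi> x)))"
      using A c nd unfolding has_weak_deriv_def by metis
    also have "(- 1) ^ k = complex_of_real ((-1) ^ k)" by simp
    finally show ?thesis
      using Re_integral_mult[OF fg(1) n] Re_integral_mult[OF fg(2) L2_cnj[OF test_L2[OF \<phi>]]]
      by (simp only: complex_cnj_cnj Re_of_real_mult)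
  qed
  then show ?B using A by (simp add: has_weak_deriv_def)
next
  assume B: ?B
  then have fg: "f \<in> L2 L" "g \<in> L2 L" by auto
  have "integral\<^sup>L (lebesgue_on {0<..<L}) (\<lambda>x. f x * nth_deriv k \<phi> x) =
        (- 1) ^ k * integral\<^sup>L (lebesgue_on {0<..<L}) (\<lambda>x. g x * \<phi> x)"
    if \<phi>: "\<phi> \<in> test_functions L" for \<phi>
  proof -
    have n: "nth_deriv k \<phi> \<in> L2 L" by (intro test_L2 test_nth_deriv \<phi> L)
    have c: "(\<lambda>x. cnj (\<phi> x)) \<in> test_functions L"
      using \<phi> L by (rule test_cnj)
    have c': "(\<lambda>x. cnj (- \<i> * \<phi> x)) \<in> test_functions L"
      using test_cnj[OF test_lin[OF \<phi> \<phi> L, of "- \<i>" 0] L] by simp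
    have nd: "nth_deriv k (\<lambda>x. cnj (\<phi> x)) = (\<lambda>x. cnj (nth_deriv k \<phi> x))"
      by (rule nth_deriv_cnj[OF test_smooth[OF \<phi>]])
    have nd': "nth_deriv k (\<lambda>x. cnj (- \<i> * \<phi> x)) = (\<lambda>x. cnj (- \<i> * nth_deriv k \<phi> x))"
      using nth_deriv_cnj[OF smooth_lin[OF test_smooth test_smooth, OF \<phi> \<phi>, of "-\<i>" 0], of k]
        nth_deriv_lin[OF test_smooth test_smooth, OF \<phi> \<phi>, of k "-\<i>" 0]
      by simp
    have s: "(- 1) ^ k = complex_of_real ((-1) ^ k)" by simp
    show ?thesis
      unfolding s
    proof (rule complex_eqI)
      show "Re (integral\<^sup>L (lebesgue_on {0<..<L}) (\<lambda>x. f x * nth_deriv k \<phi> x)) =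
        Re (complex_of_real ((-1) ^ k) * integral\<^sup>L (lebesgue_on {0<..<L}) (\<lambda>x. g x * \<phi> x))"
        unfolding Re_of_real_mult Re_integral_mult[OF fg(1) n] Re_integral_mult[OF fg(2) test_L2[OF \<phi>]]
        using B c nd by metis
      show "Im (integral\<^sup>L (lebesgue_on {0<..<L}) (\<lambda>x. f x * nth_deriv k \<phi> x)) =
        Im (complex_of_real ((-1) ^ k) * integral\<^sup>L (lebesgue_on {0<..<L}) (\<lambda>x. g x * \<phi> x))"
        unfolding Im_of_real_mult Im_integral_mult[OF fg(1) n] Im_integral_mult[OF fg(2) test_L2[OF \<phi>]]
        using B c' nd' by metis
    qed
  qed
  then show ?A using fg by (simp add: has_weak_deriv_def)
qed

lemma has_weak_deriv_L2:
  "has_weak_deriv L k f g \<Longrightarrow> f \<in> L2 L" "has_weak_deriv L k f g \<Longrightarrow> g \<in> L2 L"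
  by (auto simp: has_weak_deriv_def)

lemma weak_deriv_unique:
  assumes "L > 0" "has_weak_deriv L k f g" "has_weak_deriv L k f' g'" "eqv L f f'"
  shows "eqv L g g'"
proof (rule eqv_if_ip_test_eq)
  fix \<phi> assume \<phi>: "\<phi> \<in> test_functions L"
  then have "ip L f (nth_deriv k \<phi>) = ip L f' (nth_deriv k \<phi>)"
    using assms by (intro eqv_ip test_L2 test_nth_deriv) auto
  then have "(- 1) ^ k * ip L g \<phi> = (- 1) ^ k * ip L g' \<phi>"
    using assms \<phi> by (simp add: has_weak_deriv_iff)
  then show "ip L g \<phi> = ip L g' \<phi>" by simp
qed (use assms in \<open>auto simp: has_weak_deriv_def\<close>)

lemma has_weak_deriv_eqv:
  assumes "L > 0" "has_weak_deriv L k f g" "eqv L f f'" "eqv L g g'"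
  shows "has_weak_deriv L k f' g'"
  unfolding has_weak_deriv_iff[OF assms(1)]
proof (intro conjI ballI)
  fix \<phi> assume \<phi>: "\<phi> \<in> test_functions L"
  then show "ip L f' (nth_deriv k \<phi>) = (- 1) ^ k * ip L g' \<phi>"
    using eqv_ip(1)[OF assms(3) test_L2[OF test_nth_deriv[OF \<phi> assms(1)]], of k]
      eqv_ip(1)[OF assms(4) test_L2[OF \<phi>]] assms(2) assms(1)
    by (simp add: has_weak_deriv_iff)
qed (use assms in \<open>auto simp: eqv_def\<close>)

lemma has_weak_deriv_0: "f \<in> L2 L \<Longrightarrow> has_weak_deriv L 0 f f"
  by (simp add: has_weak_deriv_def)

lemma has_weak_deriv_add:
  assumes "L > 0" "has_weak_deriv L k f g" "has_weak_deriv L k f' g'"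
  shows "has_weak_deriv L k (\<lambda>x. f x + f' x) (\<lambda>x. g x + g' x)"
  using assms by (auto simp: has_weak_deriv_iff test_nth_deriv algebra_simps)

lemma has_weak_deriv_scaleR:
  assumes "L > 0" "has_weak_deriv L k f g"
  shows "has_weak_deriv L k (\<lambda>x. (c::real) *\<^sub>R f x) (\<lambda>x. c *\<^sub>R g x)"
  using assms by (auto simp: has_weak_deriv_iff)

lemma has_weak_deriv_minus:
  assumes "L > 0" "has_weak_deriv L k f g"
  shows "has_weak_deriv L k (\<lambda>x. - f x) (\<lambda>x. - g x)"
  using assms by (auto simp: has_weak_deriv_iff)

lemma has_weak_deriv_diff:
  assumes "L > 0" "has_weak_deriv L k f g" "has_weak_deriv L k f' g'"
  shows "has_weak_deriv L k (\<lambda>x. f x - f' x) (\<lambda>x. g x - g' x)"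
  using has_weak_deriv_add[OF assms(1,2) has_weak_deriv_minus[OF assms(1,3)]] by simp

text \<open>Derivatives of test functions are test functions, so both hypotheses can be applied to f
  paired with a derivative of order j + k. Iterated and higher weak derivatives thus agree, although
  each is only some representative.\<close>

lemma has_weak_deriv_chain:
  assumes "L > 0" "has_weak_deriv L j f g" "has_weak_deriv L (j + k) f h"
  shows "has_weak_deriv L k g h"
  unfolding has_weak_deriv_iff[OF assms(1)]
proof (intro conjI ballI)
  fix \<phi> assume \<phi>: "\<phi> \<in> test_functions L"
  have "(- 1) ^ j * ip L g (nth_deriv k \<phi>) = ip L f (nth_deriv (j + k) \<phi>)"
    using assms \<phi> by (simp add: has_weak_deriv_iff test_nth_deriv nth_deriv_add)
  also have "\<dots> = (- 1) ^ j * ((- 1) ^ k * ip L h \<phi>)"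
    using assms \<phi> by (simp add: has_weak_deriv_iff power_add)
  finally show "ip L g (nth_deriv k \<phi>) = (- 1) ^ k * ip L h \<phi>" by simp
qed (use assms in \<open>auto simp: has_weak_deriv_def\<close>)

lemma weak_deriv_works: "has_weak_deriv L k f g \<Longrightarrow> has_weak_deriv L k f (weak_deriv L k f)"
  unfolding weak_deriv_def by (rule someI[of "has_weak_deriv L k f"])

lemma weak_deriv_eqv: "L > 0 \<Longrightarrow> has_weak_deriv L k f g \<Longrightarrow> eqv L (weak_deriv L k f) g"
  by (meson eqv_refl has_weak_deriv_L2(1) weak_deriv_unique weak_deriv_works)

lemma ip_integral:
  assumes "f \<in> L2 L" "g \<in> L2 L"
  shows "ip L f g = integral {0..L} (\<lambda>x. f x \<bullet> g x)"
  unfolding ip_def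
  by (subst lebesgue_integral_eq_integral[OF L2_inner_integrable[OF assms]])
     (auto simp: integral_open_interval_real)

lemma ip_test_deriv:
  assumes "L > 0" "\<phi> \<in> test_functions L" "\<xi> \<in> test_functions L"
  shows "ip L \<phi> (nth_deriv 1 \<xi>) = - ip L (nth_deriv 1 \<phi>) \<xi>"
proof -
  note d = smooth_has_deriv[OF test_smooth[OF assms(2)], of 0, simplified]
    smooth_has_deriv[OF test_smooth[OF assms(3)], of 0, simplified]
  have "((\<lambda>x. \<phi> x \<bullet> \<xi> x) has_vector_derivative (\<phi> x \<bullet> nth_deriv 1 \<xi> x + nth_deriv 1 \<phi> x \<bullet> \<xi> x)) (at x within {0..L})" for x
    using bounded_bilinear.has_vector_derivative[OF bounded_bilinear_inner has_vector_derivative_at_within[OF d(1)] has_vector_derivative_at_within[OF d(2)]]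
    by simp
  then have "((\<lambda>x. \<phi> x \<bullet> nth_deriv 1 \<xi> x + nth_deriv 1 \<phi> x \<bullet> \<xi> x) has_integral (\<phi> L \<bullet> \<xi> L - \<phi> 0 \<bullet> \<xi> 0)) {0..L}"
    using assms(1) by (intro fundamental_theorem_of_calculus) auto
  moreover have "\<phi> L = 0" "\<phi> 0 = 0"
    using assms unfolding test_functions_iff[OF assms(1)] by auto
  ultimately have z: "integral {0..L} (\<lambda>x. \<phi> x \<bullet> nth_deriv 1 \<xi> x + nth_deriv 1 \<phi> x \<bullet> \<xi> x) = 0"
    by (simp add: integral_unique)
  have int: "(\<lambda>x. \<phi> x \<bullet> nth_deriv 1 \<xi> x) integrable_on {0..L}" "(\<lambda>x. nth_deriv 1 \<phi> x \<bullet> \<xi> x) integrable_on {0..L}"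
    using assms(2,3)[THEN test_smooth, THEN smooth_continuous, of "{0..L}" 0]
      assms(2,3)[THEN test_smooth, THEN smooth_continuous, of "{0..L}" 1]
    by (auto intro!: integrable_continuous_real continuous_on_inner)
  show ?thesis
    using z Henstock_Kurzweil_Integration.integral_add[OF int] assms
    by (simp add: ip_integral test_nth_deriv)
qed

lemma has_weak_deriv_test:
  assumes "L > 0" "\<phi> \<in> test_functions L"
  shows "has_weak_deriv L k \<phi> (nth_deriv k \<phi>)"
proof -
  have "ip L \<phi> (nth_deriv k \<xi>) = (- 1) ^ k * ip L (nth_deriv k \<phi>) \<xi>" if "\<xi> \<in> test_functions L" for \<xi>
    using that
  proof (induction k arbitrary: \<xi>)
    case (Suc k)
    have "ip L \<phi> (nth_deriv (Suc k) \<xi>) = ip L \<phi> (nth_deriv k (nth_deriv 1 \<xi>))"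
      using nth_deriv_add[of k 1] by simp
    also have "\<dots> = (- 1) ^ k * ip L (nth_deriv k \<phi>) (nth_deriv 1 \<xi>)"
      using Suc assms by (intro Suc test_nth_deriv)
    also have "\<dots> = (- 1) ^ k * - ip L (nth_deriv 1 (nth_deriv k \<phi>)) \<xi>"
      using Suc assms by (subst ip_test_deriv) (auto intro: test_nth_deriv)
    also have "nth_deriv 1 (nth_deriv k \<phi>) = nth_deriv (Suc k) \<phi>"
      using nth_deriv_add[of 1 k] by simp
    finally show ?case by simp
  qed simp
  then show ?thesis
    using assms by (auto simp: has_weak_deriv_iff test_nth_deriv)
qed

section \<open>Sobolev spaces\<close>

lemma sobolevD: "f \<in> sobolev L k \<Longrightarrow> j \<le> k \<Longrightarrow> has_weak_deriv L j f (weak_deriv L j f)"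
  by (auto simp: sobolev_def intro: weak_deriv_works)

lemma sobolevI: "(\<And>j. j \<le> k \<Longrightarrow> has_weak_deriv L j f (g j)) \<Longrightarrow> f \<in> sobolev L k"
  by (auto simp: sobolev_def dest: has_weak_deriv_L2)

lemma sobolev0_sobolev: "f \<in> sobolev0 L k \<Longrightarrow> f \<in> sobolev L k"
  by (simp add: sobolev0_def)

lemma sobolev0_wd: "f \<in> sobolev0 L k \<Longrightarrow> j \<le> k \<Longrightarrow> has_weak_deriv L j f (weak_deriv L j f)"
  by (rule sobolevD[OF sobolev0_sobolev])

lemma sobolev0D:
  assumes "L > 0" "f \<in> sobolev0 L k" "e > 0"
  shows "\<exists>\<phi>\<in>test_functions L. \<forall>j\<le>k. L2_norm L (\<lambda>x. weak_deriv L j f x - nth_deriv j \<phi> x) < e"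
proof -
  obtain \<phi> where \<phi>: "\<phi> \<in> test_functions L" "sobolev_norm L k (\<lambda>x. f x - \<phi> x) < e"
    using assms by (auto simp: sobolev0_def)
  have "L2_norm L (\<lambda>x. weak_deriv L j f x - nth_deriv j \<phi> x) < e" if j: "j \<le> k" for j
  proof -
    have "eqv L (weak_deriv L j (\<lambda>x. f x - \<phi> x)) (\<lambda>x. weak_deriv L j f x - nth_deriv j \<phi> x)"
      by (intro weak_deriv_eqv has_weak_deriv_diff has_weak_deriv_test sobolev0_wd[OF assms(2) j] assms \<phi>)
    then have "L2_norm L (\<lambda>x. weak_deriv L j f x - nth_deriv j \<phi> x) = sqrt ((L2_norm L (weak_deriv L j (\<lambda>x. f x - \<phi> x)))\<^sup>2)"
      by (simp add: eqv_norm)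
    also have "\<dots> \<le> sobolev_norm L k (\<lambda>x. f x - \<phi> x)"
      unfolding sobolev_norm_def using j by (intro real_sqrt_le_mono member_le_sum) auto
    finally show ?thesis using \<phi> by simp
  qed
  then show ?thesis using \<phi> by blast
qed

lemma sobolev0I:
  assumes "L > 0" "\<And>j. j \<le> k \<Longrightarrow> has_weak_deriv L j f (g j)"
    "\<And>e. e > 0 \<Longrightarrow> \<exists>\<phi>\<in>test_functions L. \<forall>j\<le>k. L2_norm L (\<lambda>x. g j x - nth_deriv j \<phi> x) < e"
  shows "f \<in> sobolev0 L k"
  unfolding sobolev0_def
proof (intro CollectI conjI allI impI)
  show "f \<in> sobolev L k" using assms(2) by (rule sobolevI)
  fix e :: real assume "e > 0"
  \<comment> \<open>There are k + 1 derivatives up to order k, and the Euclidean norm in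
    \<open>sobolev_norm\<close> is at most the sum of its entries.\<close>
  then obtain \<phi> where \<phi>: "\<phi> \<in> test_functions L"
    "\<And>j. j \<le> k \<Longrightarrow> L2_norm L (\<lambda>x. g j x - nth_deriv j \<phi> x) < e / (real k + 1)"
    using assms(3)[of "e / (real k + 1)"] by auto
  have eq: "L2_norm L (weak_deriv L j (\<lambda>x. f x - \<phi> x)) = L2_norm L (\<lambda>x. g j x - nth_deriv j \<phi> x)" if "j \<le> k" for j
    by (intro eqv_norm weak_deriv_eqv has_weak_deriv_diff has_weak_deriv_test assms \<phi> that)
  have "sobolev_norm L k (\<lambda>x. f x - \<phi> x) \<le> (\<Sum>j\<le>k. L2_norm L (weak_deriv L j (\<lambda>x. f x - \<phi> x)))"
    unfolding sobolev_norm_def using L2_set_le_sum[of "{..k}" "\<lambda>j. L2_norm L (weak_deriv L j (\<lambda>x. f x - \<phi> x))"]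
    by (simp add: L2_set_def)
  also have "\<dots> < (\<Sum>j\<le>k. e / (real k + 1))"
    by (rule sum_strict_mono) (auto simp: eq \<phi>)
  also have "\<dots> = e" by (simp add: field_simps)
  finally show "\<exists>\<phi>\<in>test_functions L. sobolev_norm L k (\<lambda>x. f x - \<phi> x) < e"
    using \<phi> by blast
qed

lemma sobolev0_eqv:
  assumes "L > 0" "f \<in> sobolev0 L k" "eqv L f f'"
  shows "f' \<in> sobolev0 L k"
proof (rule sobolev0I[OF assms(1)])
  show "has_weak_deriv L j f' (weak_deriv L j f)" if "j \<le> k" for j
    using has_weak_deriv_eqv[OF assms(1) sobolev0_wd[OF assms(2) that] assms(3)]
    by (meson eqv_refl has_weak_deriv_L2(2) sobolev0_wd[OF assms(2) that])
qed (use sobolev0D assms in auto)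

lemma test_sobolev0: "L > 0 \<Longrightarrow> \<phi> \<in> test_functions L \<Longrightarrow> \<phi> \<in> sobolev0 L k"
  by (rule sobolev0I[of L k \<phi> "\<lambda>j. nth_deriv j \<phi>"]) (auto intro: has_weak_deriv_test bexI[of _ \<phi>])

lemma sobolev0_0: "L > 0 \<Longrightarrow> sobolev0 L 0 = L2 L"
proof (intro subset_antisym subsetI)
  fix f assume "L > 0" "f \<in> L2 L"
  then show "f \<in> sobolev0 L 0"
    using test_dense_L2[of L f]
    by (intro sobolev0I[of L 0 f "\<lambda>_. f"]) (auto simp: has_weak_deriv_0 approx_def)
qed (auto simp: sobolev0_def sobolev_def)

lemma sobolev0_mono:
  assumes "L > 0" "f \<in> sobolev0 L k" "j \<le> k"
  shows "f \<in> sobolev0 L j"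
proof (rule sobolev0I[OF assms(1), of j f "\<lambda>j. weak_deriv L j f"])
  show "has_weak_deriv L i f (weak_deriv L i f)" if "i \<le> j" for i
    using that assms by (intro sobolev0_wd[OF assms(2)]) simp
  show "\<exists>\<phi>\<in>test_functions L. \<forall>i\<le>j. L2_norm L (\<lambda>x. weak_deriv L i f x - nth_deriv i \<phi> x) < e"
    if "e > 0" for e
    using sobolev0D[OF assms(1,2) that] assms(3) by (meson le_trans)
qed

lemma sobolev0_L2: "L > 0 \<Longrightarrow> f \<in> sobolev0 L k \<Longrightarrow> f \<in> L2 L"
  using sobolev0_mono[of L f k 0] by (simp add: sobolev0_0)

lemma sobolev0_weak_deriv_L2: "f \<in> sobolev0 L k \<Longrightarrow> j \<le> k \<Longrightarrow> weak_deriv L j f \<in> L2 L"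
  using sobolev0_wd has_weak_deriv_L2 by blast

lemma sobolev0_lin:
  assumes L: "L > 0" and f: "f \<in> sobolev0 L k" and g: "g \<in> sobolev0 L k"
  shows "(\<lambda>x. (c::real) *\<^sub>R f x + (d::real) *\<^sub>R g x) \<in> sobolev0 L k"
proof (rule sobolev0I[OF L, of k _ "\<lambda>j x. c *\<^sub>R weak_deriv L j f x + d *\<^sub>R weak_deriv L j g x"])
  show "has_weak_deriv L j (\<lambda>x. c *\<^sub>R f x + d *\<^sub>R g x)
    (\<lambda>x. c *\<^sub>R weak_deriv L j f x + d *\<^sub>R weak_deriv L j g x)" if "j \<le> k" for j
    by (intro has_weak_deriv_add has_weak_deriv_scaleR sobolev0_wd[OF f that] sobolev0_wd[OF g that] L)
next
  fix e :: real assume e: "e > 0"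
  define e' where "e' = e / (\<bar>c\<bar> + \<bar>d\<bar> + 1)"
  have "e' > 0" using e by (simp add: e'_def add_nonneg_pos)
  obtain \<phi> where \<phi>: "\<phi> \<in> test_functions L"
    "\<And>j. j \<le> k \<Longrightarrow> L2_norm L (\<lambda>x. weak_deriv L j f x - nth_deriv j \<phi> x) < e'"
    using sobolev0D[OF L f \<open>e' > 0\<close>] by blast
  obtain \<psi> where \<psi>: "\<psi> \<in> test_functions L"
    "\<And>j. j \<le> k \<Longrightarrow> L2_norm L (\<lambda>x. weak_deriv L j g x - nth_deriv j \<psi> x) < e'"
    using sobolev0D[OF L g \<open>e' > 0\<close>] by blast
  let ?\<theta> = "\<lambda>x. of_real c * \<phi> x + of_real d * \<psi> x"
  have "L2_norm L (\<lambda>x. c *\<^sub>R weak_deriv L j f x + d *\<^sub>R weak_deriv L j g x - nth_deriv j ?\<theta> x) < e"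
    if j: "j \<le> k" for j
  proof -
    have m: "weak_deriv L j f \<in> L2 L" "weak_deriv L j g \<in> L2 L" "nth_deriv j \<phi> \<in> L2 L" "nth_deriv j \<psi> \<in> L2 L"
      using sobolev0_weak_deriv_L2 f g j \<phi> \<psi> L by (auto intro: test_nth_deriv)
    have "(\<lambda>x. c *\<^sub>R weak_deriv L j f x + d *\<^sub>R weak_deriv L j g x - nth_deriv j ?\<theta> x) =
      (\<lambda>x. c *\<^sub>R (weak_deriv L j f x - nth_deriv j \<phi> x) + d *\<^sub>R (weak_deriv L j g x - nth_deriv j \<psi> x))"
      using nth_deriv_lin[OF test_smooth test_smooth, OF \<phi>(1) \<psi>(1)]
      by (simp add: algebra_simps scaleR_conv_of_real)
    then have "L2_norm L (\<lambda>x. c *\<^sub>R weak_deriv L j f x + d *\<^sub>R weak_deriv L j g x - nth_deriv j ?\<theta> x)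
      \<le> L2_norm L (\<lambda>x. c *\<^sub>R (weak_deriv L j f x - nth_deriv j \<phi> x)) + L2_norm L (\<lambda>x. d *\<^sub>R (weak_deriv L j g x - nth_deriv j \<psi> x))"
      using m by (simp only:) (intro L2_norm_add_le L2_scaleR L2_diff, auto)
    also have "\<dots> \<le> \<bar>c\<bar> * e' + \<bar>d\<bar> * e'"
      using \<phi>(2)[OF j] \<psi>(2)[OF j] by (simp add: add_mono mult_left_mono)
    also have "\<dots> < e' * (\<bar>c\<bar> + \<bar>d\<bar> + 1)"
      using \<open>e' > 0\<close> by (simp add: algebra_simps)
    finally show ?thesis by (simp add: e'_def)
  qed
  then show "\<exists>\<phi>\<in>test_functions L. \<forall>j\<le>k. L2_norm L (\<lambda>x. c *\<^sub>R weak_deriv L j f x + d *\<^sub>R weak_deriv L j g x - nth_deriv j \<phi> x) < e"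
    using test_lin[OF \<phi>(1) \<psi>(1) L] by blast
qed

lemma sobolev0_add: "L > 0 \<Longrightarrow> f \<in> sobolev0 L k \<Longrightarrow> g \<in> sobolev0 L k \<Longrightarrow> (\<lambda>x. f x + g x) \<in> sobolev0 L k"
  using sobolev0_lin[of L f k g 1 1] by simp

lemma sobolev0_scaleR: "L > 0 \<Longrightarrow> f \<in> sobolev0 L k \<Longrightarrow> (\<lambda>x. (c::real) *\<^sub>R f x) \<in> sobolev0 L k"
  using sobolev0_lin[of L f k f c 0] by simp

lemma sobolev0_diff: "L > 0 \<Longrightarrow> f \<in> sobolev0 L k \<Longrightarrow> g \<in> sobolev0 L k \<Longrightarrow> (\<lambda>x. f x - g x) \<in> sobolev0 L k"
  using sobolev0_lin[of L f k g 1 "-1"] by simp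

lemma sobolev0_minus: "L > 0 \<Longrightarrow> f \<in> sobolev0 L k \<Longrightarrow> (\<lambda>x. - f x) \<in> sobolev0 L k"
  using sobolev0_scaleR[of L f k "-1"] by simp

lemma weak_deriv_chain_eqv:
  assumes "L > 0" "f \<in> sobolev L n" "j + k \<le> n"
  shows "has_weak_deriv L k (weak_deriv L j f) (weak_deriv L (j + k) f)"
  using has_weak_deriv_chain[OF assms(1) sobolevD[OF assms(2)] sobolevD[OF assms(2)]] assms(3) by simp

text \<open>The derivatives of approximating test functions approximate the derivative. This is what
  places omega_x in H^1_0.\<close>

lemma weak_deriv_sobolev0:
  assumes L: "L > 0" and f: "f \<in> sobolev0 L (j + k)"
  shows "weak_deriv L j f \<in> sobolev0 L k"
proof (rule sobolev0I[OF L, of k _ "\<lambda>i. weak_deriv L (j + i) f"])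
  show "has_weak_deriv L i (weak_deriv L j f) (weak_deriv L (j + i) f)" if "i \<le> k" for i
    using weak_deriv_chain_eqv[OF L sobolev0_sobolev[OF f], of j i] that by simp
  fix e :: real assume "e > 0"
  then obtain \<phi> where \<phi>: "\<phi> \<in> test_functions L"
    "\<And>i. i \<le> j + k \<Longrightarrow> L2_norm L (\<lambda>x. weak_deriv L i f x - nth_deriv i \<phi> x) < e"
    using sobolev0D[OF L f] by blast
  then have "L2_norm L (\<lambda>x. weak_deriv L (j + i) f x - nth_deriv i (nth_deriv j \<phi>) x) < e" if "i \<le> k" for i
    using that \<phi>(2)[of "j + i"] by (simp add: nth_deriv_add[symmetric] add.commute)
  then show "\<exists>\<phi>\<in>test_functions L. \<forall>i\<le>k. L2_norm L (\<lambda>x. weak_deriv L (j + i) f x - nth_deriv i \<phi> x) < e"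
    using test_nth_deriv[OF \<phi>(1) L] by blast
qed

lemma ip_tendsto:
  assumes "g \<in> L2 L" "f \<in> L2 L" "\<And>n. F n \<in> L2 L" "(\<lambda>n. L2_norm L (\<lambda>x. f x - F n x)) \<longlonglongrightarrow> 0"
  shows "(\<lambda>n. ip L g (F n)) \<longlonglongrightarrow> ip L g f"
proof -
  have "(\<lambda>n. ip L g f - ip L g (F n)) \<longlonglongrightarrow> 0"
  proof (rule Lim_null_comparison)
    show "\<forall>\<^sub>F n in sequentially. norm (ip L g f - ip L g (F n)) \<le> L2_norm L g * L2_norm L (\<lambda>x. f x - F n x)"
      using ip_bound[OF assms(1), of "\<lambda>x. f x - F n x" for n] assms by simp
    show "(\<lambda>n. L2_norm L g * L2_norm L (\<lambda>x. f x - F n x)) \<longlonglongrightarrow> 0"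
      using tendsto_mult_left[OF assms(4), of "L2_norm L g"] by simp
  qed
  from tendsto_diff[OF tendsto_const[of "ip L g f"] this] show ?thesis by simp
qed

lemma sobolev0_sequence:
  assumes "L > 0" "f \<in> sobolev0 L k"
  obtains \<phi> where "\<And>n. \<phi> n \<in> test_functions L"
    "\<And>j. j \<le> k \<Longrightarrow> (\<lambda>n. L2_norm L (\<lambda>x. weak_deriv L j f x - nth_deriv j (\<phi> n) x)) \<longlonglongrightarrow> 0"
proof -
  have "\<exists>\<phi>. \<phi> \<in> test_functions L \<and> (\<forall>j\<le>k. L2_norm L (\<lambda>x. weak_deriv L j f x - nth_deriv j \<phi> x) < inverse (real (Suc n)))" for n
    using sobolev0D[OF assms, of "inverse (real (Suc n))"] by auto
  then obtain \<phi> where \<phi>: "\<And>n. \<phi> n \<in> test_functions L"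
    "\<And>n j. j \<le> k \<Longrightarrow> L2_norm L (\<lambda>x. weak_deriv L j f x - nth_deriv j (\<phi> n) x) < inverse (real (Suc n))"
    by metis
  have "(\<lambda>n. L2_norm L (\<lambda>x. weak_deriv L j f x - nth_deriv j (\<phi> n) x)) \<longlonglongrightarrow> 0" if "j \<le> k" for j
    by (rule Lim_null_comparison[OF _ LIMSEQ_inverse_real_of_nat]) (use \<phi>(2)[OF that] in \<open>simp add: less_imp_le\<close>)
  then show ?thesis using that \<phi>(1) by blast
qed

text \<open>The defining identity of the weak derivative extends by density from test functions to
  H^k_0. The boundary condition sits on \<open>\<xi>\<close>, which is how the equations will be
  tested.\<close>

lemma ip_weak_deriv:
  assumes L: "L > 0" and f: "has_weak_deriv L k f g" and \<xi>: "\<xi> \<in> sobolev0 L k"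
  shows "ip L g \<xi> = (- 1) ^ k * ip L f (weak_deriv L k \<xi>)"
proof -
  obtain \<phi> where \<phi>: "\<And>n. \<phi> n \<in> test_functions L"
    "\<And>j. j \<le> k \<Longrightarrow> (\<lambda>n. L2_norm L (\<lambda>x. weak_deriv L j \<xi> x - nth_deriv j (\<phi> n) x)) \<longlonglongrightarrow> 0"
    using sobolev0_sequence[OF L \<xi>] by blast
  have e0: "eqv L (weak_deriv L 0 \<xi>) \<xi>"
    by (intro weak_deriv_eqv has_weak_deriv_0 L sobolev0_L2[OF L \<xi>])
  have "(\<lambda>n. ip L g (\<phi> n)) \<longlonglongrightarrow> ip L g (weak_deriv L 0 \<xi>)"
    using \<phi>(2)[of 0] by (intro ip_tendsto) (use f \<phi> e0 in \<open>auto simp: eqv_def dest: has_weak_deriv_L2\<close>)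
  then have 1: "(\<lambda>n. ip L g (\<phi> n)) \<longlonglongrightarrow> ip L g \<xi>"
    using eqv_ip(2)[OF e0] f by (auto dest: has_weak_deriv_L2)
  have "(\<lambda>n. ip L f (nth_deriv k (\<phi> n))) \<longlonglongrightarrow> ip L f (weak_deriv L k \<xi>)"
    using \<phi>(2)[of k] by (intro ip_tendsto)
      (use f \<phi> L \<xi> in \<open>auto dest: has_weak_deriv_L2 intro: test_nth_deriv sobolev0_weak_deriv_L2\<close>)
  then have "(\<lambda>n. (- 1) ^ k * ip L g (\<phi> n)) \<longlonglongrightarrow> ip L f (weak_deriv L k \<xi>)"
    using f \<phi>(1) by (simp add: has_weak_deriv_iff[OF L])
  from LIMSEQ_unique[OF this tendsto_mult_left[OF 1]]
  have "ip L f (weak_deriv L k \<xi>) = (- 1) ^ k * ip L g \<xi>" .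
  then show ?thesis by (simp add: power_mult_distrib[symmetric] mult.assoc[symmetric])
qed

lemma ip_weak_deriv1:
  "L > 0 \<Longrightarrow> has_weak_deriv L 1 f g \<Longrightarrow> \<xi> \<in> sobolev0 L 1 \<Longrightarrow> ip L g \<xi> = - ip L f (weak_deriv L 1 \<xi>)"
  using ip_weak_deriv[of L 1] by simp

lemma ip_weak_deriv2:
  "L > 0 \<Longrightarrow> has_weak_deriv L 2 f g \<Longrightarrow> \<xi> \<in> sobolev0 L 2 \<Longrightarrow> ip L g \<xi> = ip L f (weak_deriv L 2 \<xi>)"
  using ip_weak_deriv[of L 2] by simp

section \<open>Inequalities for functions vanishing at the end points\<close>

text \<open>Write c for the value at x. It is the integral of the derivative over (0, x), so |c|^2
  is the pairing of the derivative with the function equal to c on (0, x), whose norm is sqrt x |c|;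
  divide by |c|. The factor sqrt x records the vanishing at 0.\<close>

lemma test_bound:
  assumes L: "L > 0" and \<phi>: "\<phi> \<in> test_functions L" and x: "0 \<le> x" "x \<le> L"
  shows "cmod (\<phi> x) \<le> sqrt x * L2_norm L (nth_deriv 1 \<phi>)"
proof -
  define c where "c = \<phi> x"
  define g :: "real \<Rightarrow> complex" where "g y = (if y \<in> {0<..<x} then c else 0)" for y
  have "g \<in> borel_measurable lborel"
    unfolding g_def by measurable
  then have gm: "g \<in> borel_measurable (lebesgue_on {0<..<L})"
    by (intro measurable_restrict_space1 measurable_completion)
  have g2: "g \<in> L2 L"
    by (rule L2_bounded[of _ _ "cmod c"]) (auto simp: gm, simp add: g_def)
  have d2: "nth_deriv 1 \<phi> \<in> L2 L"
    using \<phi> L by (intro test_L2 test_nth_deriv)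
  have restr: "integral {0..L} (\<lambda>y. if y \<in> {0<..<x} then h y else 0) = integral {0..x} h" for h :: "real \<Rightarrow> real"
  proof -
    have "{0..L} \<inter> {0<..<x} = {0<..<x}" using x by auto
    then show ?thesis unfolding integral_restrict_Int by (simp add: integral_open_interval_real Int_commute)
  qed
  have d: "(\<phi> has_vector_derivative nth_deriv 1 \<phi> y) (at y)" for y
    using smooth_has_deriv[OF test_smooth[OF \<phi>], of 0 y] by simp
  have "((\<lambda>y. \<phi> y \<bullet> c) has_vector_derivative (nth_deriv 1 \<phi> y \<bullet> c)) (at y within {0..x})" for y
    by (rule bounded_linear.has_vector_derivative[OF bounded_linear_inner_left has_vector_derivative_at_within[OF d]])
  then have "((\<lambda>y. nth_deriv 1 \<phi> y \<bullet> c) has_integral (\<phi> x \<bullet> c - \<phi> 0 \<bullet> c)) {0..x}"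
    using x by (intro fundamental_theorem_of_calculus) auto
  moreover have "\<phi> 0 = 0"
    using \<phi> unfolding test_functions_iff[OF L] by auto
  ultimately have 1: "integral {0..x} (\<lambda>y. nth_deriv 1 \<phi> y \<bullet> c) = (cmod c)\<^sup>2"
    by (simp add: integral_unique c_def power2_norm_eq_inner)
  have "ip L (nth_deriv 1 \<phi>) g = integral {0..L} (\<lambda>y. if y \<in> {0<..<x} then nth_deriv 1 \<phi> y \<bullet> c else 0)"
    unfolding ip_integral[OF d2 g2] by (intro Henstock_Kurzweil_Integration.integral_cong) (simp add: g_def)
  then have a: "ip L (nth_deriv 1 \<phi>) g = (cmod c)\<^sup>2"
    unfolding restr 1 .
  have "ip L g g = integral {0..L} (\<lambda>y. if y \<in> {0<..<x} then (cmod c)\<^sup>2 else 0)"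
    unfolding ip_integral[OF g2 g2] by (intro Henstock_Kurzweil_Integration.integral_cong) (simp add: g_def power2_norm_eq_inner)
  then have "ip L g g = x * (cmod c)\<^sup>2"
    unfolding restr using x by simp
  then have "L2_norm L g = sqrt x * cmod c"
    by (simp add: L2_norm_ip real_sqrt_mult)
  then have "(cmod c)\<^sup>2 \<le> L2_norm L (nth_deriv 1 \<phi>) * (sqrt x * cmod c)"
    using ip_bound[OF d2 g2] a by simp
  then show ?thesis
    by (cases "c = 0") (use x in \<open>auto simp: power2_eq_square c_def[symmetric] mult.commute mult.left_commute\<close>)
qed

lemma L2_norm_le_bound:
  assumes "L > 0" "f \<in> L2 L" "\<And>x. 0 < x \<Longrightarrow> x < L \<Longrightarrow> cmod (f x) \<le> B" "B \<ge> 0"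
  shows "L2_norm L f \<le> sqrt L * B"
proof -
  have *: "(\<lambda>x. complex_of_real B) \<in> L2 L" by (intro L2_continuous) auto
  have "ip L (\<lambda>x. complex_of_real B) (\<lambda>x. complex_of_real B) = L * B\<^sup>2"
    unfolding ip_integral[OF * *] using assms by (simp add: inner_complex_def power2_eq_square)
  moreover have "ip L f f \<le> ip L (\<lambda>x. complex_of_real B) (\<lambda>x. complex_of_real B)"
    unfolding ip_def power2_norm_eq_inner[symmetric]
    by (rule integral_mono) (use assms * in \<open>auto simp: L2_def intro!: power_mono\<close>)
  ultimately have "L2_norm L f \<le> sqrt (L * B\<^sup>2)"
    unfolding L2_norm_ip by simp
  then show ?thesis using assms by (simp add: real_sqrt_mult)
qed

text \<open>The factor L is sqrt L from the pointwise bound times sqrt L from integrating it over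
  (0, L).\<close>

lemma poincare_test:
  assumes L: "L > 0" and \<phi>: "\<phi> \<in> test_functions L"
  shows "L2_norm L \<phi> \<le> L * L2_norm L (nth_deriv 1 \<phi>)"
proof -
  have "cmod (\<phi> x) \<le> sqrt L * L2_norm L (nth_deriv 1 \<phi>)" if "0 < x" "x < L" for x
    using test_bound[OF L \<phi>, of x] that
      mult_right_mono[of "sqrt x" "sqrt L" "L2_norm L (nth_deriv 1 \<phi>)"] by simp
  then have "L2_norm L \<phi> \<le> sqrt L * (sqrt L * L2_norm L (nth_deriv 1 \<phi>))"
    using L by (intro L2_norm_le_bound test_L2 \<phi>) auto
  then show ?thesis using L by (simp flip: mult.assoc)
qed

lemma L2_norm_tendsto:
  assumes "f \<in> L2 L" "\<And>n. F n \<in> L2 L" "(\<lambda>n. L2_norm L (\<lambda>x. f x - F n x)) \<longlonglongrightarrow> 0"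
  shows "(\<lambda>n. L2_norm L (F n)) \<longlonglongrightarrow> L2_norm L f"
proof -
  have "(\<lambda>n. L2_norm L (F n) - L2_norm L f) \<longlonglongrightarrow> 0"
  proof (rule Lim_null_comparison[OF _ assms(3)])
    have "norm (L2_norm L (F n) - L2_norm L f) \<le> L2_norm L (\<lambda>x. f x - F n x)" for n
      using L2_norm_le_diff[OF assms(1) assms(2)[of n]] L2_norm_le_diff[OF assms(2)[of n] assms(1)]
      by (simp add: L2_norm_minus_commute[of L f])
    then show "\<forall>\<^sub>F n in sequentially. norm (L2_norm L (F n) - L2_norm L f) \<le> L2_norm L (\<lambda>x. f x - F n x)"
      by simp
  qed
  from tendsto_add[OF this tendsto_const[of "L2_norm L f"]] show ?thesis by simp
qed

lemma poincare:
  assumes L: "L > 0" and f: "f \<in> sobolev0 L 1"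
  shows "L2_norm L f \<le> L * L2_norm L (weak_deriv L 1 f)"
proof -
  obtain \<phi> where \<phi>: "\<And>n. \<phi> n \<in> test_functions L"
    "\<And>j. j \<le> 1 \<Longrightarrow> (\<lambda>n. L2_norm L (\<lambda>x. weak_deriv L j f x - nth_deriv j (\<phi> n) x)) \<longlonglongrightarrow> 0"
    using sobolev0_sequence[OF L f] by blast
  have lim: "(\<lambda>n. L2_norm L (nth_deriv j (\<phi> n))) \<longlonglongrightarrow> L2_norm L (weak_deriv L j f)" if "j \<le> 1" for j
    using that \<phi> L by (intro L2_norm_tendsto sobolev0_weak_deriv_L2[OF f] test_L2 test_nth_deriv) auto
  have "L2_norm L (weak_deriv L 0 f) \<le> L * L2_norm L (weak_deriv L 1 f)"
    by (rule LIMSEQ_le[OF lim tendsto_mult_left[OF lim]]) (use poincare_test[OF L \<phi>(1)] in auto)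
  moreover have "eqv L (weak_deriv L 0 f) f"
    by (intro weak_deriv_eqv has_weak_deriv_0 L sobolev0_L2[OF L f])
  ultimately show ?thesis by (simp add: eqv_norm)
qed

text \<open>Mean zero is what makes the primitive starting at 0 vanish again to the right of the
  support of \<open>\<theta>\<close>.\<close>

lemma test_antideriv:
  assumes L: "L > 0" and \<theta>: "\<theta> \<in> test_functions L" and z: "integral {0..L} \<theta> = 0"
  shows "\<exists>\<xi>\<in>test_functions L. nth_deriv 1 \<xi> = \<theta>"
proof -
  obtain a b where ab: "0 < a" "a < b" "b < L" "\<And>x. x \<notin> {a..b} \<Longrightarrow> \<theta> x = 0"
    using \<theta> unfolding test_functions_iff[OF L] by blast
  have cont: "continuous_on A \<theta>" for A
    using smooth_continuous[OF test_smooth[OF \<theta>], of A 0] by simp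
  have int: "\<theta> integrable_on {s..t}" for s t
    by (intro integrable_continuous_real cont)
  define \<xi> where "\<xi> x = (if x \<in> {0..L} then integral {0..x} \<theta> else 0)" for x
  have out: "\<xi> x = 0" if "x \<notin> {a..b}" for x
  proof (cases "x < a")
    case True
    have "integral {0..x} \<theta> = integral {0..x} (\<lambda>_. 0)"
      by (intro Henstock_Kurzweil_Integration.integral_cong) (use ab True in auto)
    then show ?thesis by (simp add: \<xi>_def)
  next
    case False
    then have x: "b < x" using that by auto
    show ?thesis
    proof (cases "x \<le> L")
      case True
      have "integral {x..L} \<theta> = integral {x..L} (\<lambda>_. 0)"
        by (intro Henstock_Kurzweil_Integration.integral_cong) (use ab x in auto)
      moreover have "integral {0..x} \<theta> + integral {x..L} \<theta> = integral {0..L} \<theta>"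
        using x ab True by (intro Henstock_Kurzweil_Integration.integral_combine int) auto
      ultimately show ?thesis using z by (simp add: \<xi>_def)
    qed (auto simp: \<xi>_def)
  qed
  have der: "(\<xi> has_vector_derivative \<theta> x) (at x)" for x
  proof (cases "x \<in> {a..b}")
    case True
    then have x: "x \<in> {0<..<L}" using ab by auto
    have "((\<lambda>u. integral {0..u} \<theta>) has_vector_derivative \<theta> x) (at x within {0..L})"
      using x by (intro integral_has_vector_derivative cont) auto
    then have "((\<lambda>u. integral {0..u} \<theta>) has_vector_derivative \<theta> x) (at x)"
      using x by (subst (asm) at_within_interior) (auto simp: interior_atLeastAtMost_real)
    then show ?thesis
      by (rule has_vector_derivative_transform_within_open[of _ _ _ "{0<..<L}"])
         (use x in \<open>auto simp: \<xi>_def\<close>)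
  next
    case False
    have "((\<lambda>_. 0) has_vector_derivative \<theta> x) (at x)"
      using ab(4)[OF False] by simp
    then show ?thesis
      by (rule has_vector_derivative_transform_within_open[of _ _ _ "- {a..b}"])
         (use False out in auto)
  qed
  have "smooth \<xi>" "nth_deriv (Suc 0) \<xi> = nth_deriv 0 \<theta>"
    using smooth_antideriv[OF test_smooth[OF \<theta>] der] nth_deriv_antideriv[OF test_smooth[OF \<theta>] der] by auto
  then show ?thesis
    using ab out by (intro bexI[of _ \<xi>] test_functionsI[of _ a b]) auto
qed

text \<open>By \<open>test_bound\<close> a function of H^1_0 is of size sqrt d on (0, d), so a unit
  mass placed there is almost invisible to it. Such a mass can correct the mean of a test function
  at little cost.\<close>

lemma bump_near_zero:
  assumes L: "L > 0" and d: "0 < d" "d < L"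
  shows "\<exists>\<eta>\<in>test_functions L. integral {0..L} \<eta> = 1 \<and>
    (\<forall>f\<in>sobolev0 L 1. \<forall>m. \<bar>ip L f (\<lambda>x. m * \<eta> x)\<bar> \<le> cmod m * (sqrt d * L2_norm L (weak_deriv L 1 f)))"
proof -
  define b where "b = bump 1 (d / 2) d"
  have bt: "(\<lambda>x. complex_of_real (b x)) \<in> test_functions L"
    unfolding b_def using d by (intro bump_test) auto
  have b0: "b x \<ge> 0" for x by (simp add: b_def bump_eq)
  have bout: "b x = 0" if "x \<notin> {0<..<d}" for x using that d by (auto simp: b_def bump_eq)
  have cc: "continuous_on A (\<lambda>x. complex_of_real (b x))" for A
    using smooth_continuous[OF test_smooth[OF bt], of A 0] by simp
  then have bc: "continuous_on A b" for A by simp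
  have bi: "b integrable_on {0..L}" by (intro integrable_continuous_real bc)
  define I where "I = integral {0..L} b"
  have "I \<noteq> 0"
  proof
    assume "I = 0"
    then have "\<forall>x\<in>{0..L}. b x = 0"
      unfolding I_def using integral_eq_0_iff[OF bc L b0] by simp
    moreover have "b (3 * d / 4) > 0" using d by (simp add: b_def bump_eq)
    ultimately show False using d by (auto dest!: bspec[of _ _ "3 * d / 4"])
  qed
  moreover have "I \<ge> 0" unfolding I_def by (intro Henstock_Kurzweil_Integration.integral_nonneg bi b0)
  ultimately have I: "I > 0" by simp
  define \<eta> where "\<eta> x = complex_of_real (b x / I)" for x
  have \<eta>t: "\<eta> \<in> test_functions L"
    using test_lin[OF bt bt L, of "1 / of_real I" 0] by (simp add: \<eta>_def[abs_def])
  have "integral {0..L} \<eta> = of_real (integral {0..L} (\<lambda>x. b x / I))"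
    unfolding \<eta>_def using integral_linear[OF integrable_on_divide[OF bi, of I] bounded_linear_of_real]
    by (simp only: o_def)
  then have \<eta>1: "integral {0..L} \<eta> = 1"
    using I by (simp add: I_def[symmetric])
  have test_case: "\<bar>ip L f (\<lambda>x. m * \<eta> x)\<bar> \<le> cmod m * (sqrt d * L2_norm L (nth_deriv 1 f))"
    if f: "f \<in> test_functions L" for f m
  proof -
    have m: "(\<lambda>x. m * \<eta> x) \<in> L2 L" using \<eta>t by auto
    have "\<bar>ip L f (\<lambda>x. m * \<eta> x)\<bar> \<le> integral {0..L} (\<lambda>x. (cmod m * (sqrt d * L2_norm L (nth_deriv 1 f))) * (b x / I))"
      unfolding ip_integral[OF test_L2[OF f] m] real_norm_def[symmetric]
    proof (rule integral_norm_bound_integral)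
      show "(\<lambda>x. f x \<bullet> (m * \<eta> x)) integrable_on {0..L}"
        using smooth_continuous[OF test_smooth[OF f], of "{0..L}" 0]
          smooth_continuous[OF test_smooth[OF \<eta>t], of "{0..L}" 0]
        by (auto intro!: integrable_continuous_real continuous_intros)
      show "(\<lambda>x. (cmod m * (sqrt d * L2_norm L (nth_deriv 1 f))) * (b x / I)) integrable_on {0..L}"
        by (intro integrable_continuous_real continuous_intros bc) (use I in auto)
      fix x assume x: "x \<in> {0..L}"
      show "norm (f x \<bullet> (m * \<eta> x)) \<le> (cmod m * (sqrt d * L2_norm L (nth_deriv 1 f))) * (b x / I)"
      proof (cases "x < d")
        case True
        have "norm (f x \<bullet> (m * \<eta> x)) \<le> cmod (f x) * cmod (m * \<eta> x)"
          using Cauchy_Schwarz_ineq2 by simp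
        also have "\<dots> = cmod (f x) * (cmod m * (b x / I))"
          using b0[of x] I by (simp add: \<eta>_def norm_mult norm_divide)
        also have "\<dots> \<le> (sqrt d * L2_norm L (nth_deriv 1 f)) * (cmod m * (b x / I))"
        proof (rule mult_right_mono)
          show "cmod (f x) \<le> sqrt d * L2_norm L (nth_deriv 1 f)"
            using test_bound[OF L f, of x] x True
              mult_right_mono[of "sqrt x" "sqrt d" "L2_norm L (nth_deriv 1 f)"] by simp
        qed (use b0[of x] I in simp)
        finally show ?thesis by (simp add: algebra_simps)
      next
        case False
        then show ?thesis using bout[of x] by (simp add: \<eta>_def)
      qed
    qed
    also have "\<dots> = cmod m * (sqrt d * L2_norm L (nth_deriv 1 f))"
      using I by (simp add: I_def[symmetric])
    finally show ?thesis .
  qed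
  have "\<bar>ip L f (\<lambda>x. m * \<eta> x)\<bar> \<le> cmod m * (sqrt d * L2_norm L (weak_deriv L 1 f))"
    if f: "f \<in> sobolev0 L 1" for f m
  proof -
    obtain \<phi> where \<phi>: "\<And>n. \<phi> n \<in> test_functions L"
      "\<And>j. j \<le> 1 \<Longrightarrow> (\<lambda>n. L2_norm L (\<lambda>x. weak_deriv L j f x - nth_deriv j (\<phi> n) x)) \<longlonglongrightarrow> 0"
      using sobolev0_sequence[OF L f] by blast
    have m: "(\<lambda>x. m * \<eta> x) \<in> L2 L" using \<eta>t by auto
    have e0: "eqv L (weak_deriv L 0 f) f"
      by (intro weak_deriv_eqv has_weak_deriv_0 L sobolev0_L2[OF L f])
    have "(\<lambda>n. ip L (\<lambda>x. m * \<eta> x) (\<phi> n)) \<longlonglongrightarrow> ip L (\<lambda>x. m * \<eta> x) (weak_deriv L 0 f)"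
      using \<phi>(2)[of 0] by (intro ip_tendsto m sobolev0_weak_deriv_L2[OF f] test_L2 \<phi>) auto
    then have l1: "(\<lambda>n. \<bar>ip L (\<phi> n) (\<lambda>x. m * \<eta> x)\<bar>) \<longlonglongrightarrow> \<bar>ip L f (\<lambda>x. m * \<eta> x)\<bar>"
      unfolding eqv_ip(2)[OF e0 m] by (intro tendsto_rabs) (simp add: ip_commute)
    have l2: "(\<lambda>n. L2_norm L (nth_deriv 1 (\<phi> n))) \<longlonglongrightarrow> L2_norm L (weak_deriv L 1 f)"
      using \<phi> L by (intro L2_norm_tendsto sobolev0_weak_deriv_L2[OF f] test_L2 test_nth_deriv) auto
    show ?thesis
      by (rule LIMSEQ_le[OF l1 tendsto_mult_left[OF tendsto_mult_left[OF l2]]])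
         (use test_case[OF \<phi>(1)] in auto)
  qed
  then show ?thesis using \<eta>t \<eta>1 by blast
qed

text \<open>A function in \<open>H^1_0\<close> that is almost orthogonal to all derivatives of test functions is almost
  constant, hence small: test it against \<open>\<gamma> - m \<eta>\<close>, where \<open>\<gamma>\<close> approximates it, \<open>m\<close> is
  the mean of \<open>\<gamma>\<close>, and the mass of \<open>\<eta>\<close> sits so close to \<open>0\<close> that \<open>\<eta>\<close> hardly sees \<open>H^1_0\<close>.\<close>

lemma small_if_almost_constant:
  assumes L: "L > 0" and M: "M \<ge> 0" and e: "e > 0"
  shows "\<exists>C\<ge>0. \<forall>g\<in>sobolev0 L 1. \<forall>\<delta>\<ge>0. L2_norm L (weak_deriv L 1 g) \<le> M \<longrightarrow>
    (\<forall>\<xi>\<in>test_functions L. \<bar>ip L g (nth_deriv 1 \<xi>)\<bar> \<le>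
       \<delta> * (L2_norm L \<xi> + L2_norm L (nth_deriv 1 \<xi>) + L2_norm L (nth_deriv 2 \<xi>))) \<longrightarrow>
    (L2_norm L g)\<^sup>2 \<le> e + C * \<delta>"
proof -
  \<comment> \<open>\<open>\<Gamma>\<close> will bound the norm of \<open>\<gamma>\<close>: L M
    comes from the Poincare inequality for g, and 1 from the approximation error. Then
    \<open>\<mu>\<close> bounds the mean m by Cauchy-Schwarz.\<close>
  define \<Gamma> where "\<Gamma> = L * M + 1"
  define \<mu> where "\<mu> = sqrt L * \<Gamma>"
  have G: "\<Gamma> > 0" "\<mu> > 0" using L M by (simp_all add: \<Gamma>_def \<mu>_def add_nonneg_pos)
  \<comment> \<open>Chosen so that the pairing of g with m times \<open>\<eta>\<close> costs at most
    e / 2.\<close>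
  define d where "d = min (L / 2) ((e / (2 * \<mu> * (M + 1)))\<^sup>2)"
  have pos: "e / (2 * \<mu> * (M + 1)) > 0" using e G M by simp
  have d: "0 < d" "d < L" using L pos by (auto simp: d_def)
  have "sqrt d \<le> e / (2 * \<mu> * (M + 1))"
    using pos by (intro real_le_lsqrt) (auto simp: d_def)
  have sd: "\<mu> * (sqrt d * (M + 1)) \<le> e / 2"
  proof -
    have "\<mu> * (sqrt d * (M + 1)) \<le> \<mu> * (e / (2 * \<mu> * (M + 1)) * (M + 1))"
      using \<open>sqrt d \<le> _\<close> G M by (intro mult_left_mono mult_right_mono) auto
    also have "\<dots> = e / 2" using G M by (simp add: divide_simps add_nonneg_eq_0_iff)
    finally show ?thesis .
  qed
  obtain \<eta> where \<eta>: "\<eta> \<in> test_functions L" "integral {0..L} \<eta> = 1"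
    "\<And>f m. f \<in> sobolev0 L 1 \<Longrightarrow> \<bar>ip L f (\<lambda>x. m * \<eta> x)\<bar> \<le> cmod m * (sqrt d * L2_norm L (weak_deriv L 1 f))"
    using bump_near_zero[OF L d] by blast
  \<comment> \<open>Bounds the sum of the norms of \<open>\<xi>\<close> and its first two
    derivatives; the factor L + 1 covers the derivative \<open>\<theta>\<close> and, by Poincare,
    \<open>\<xi>\<close> itself. It is fixed before g and \<open>\<delta>\<close>, which will later
    vary with time.\<close>
  define C where "C = (L + 1) * (\<Gamma> + \<mu> * L2_norm L \<eta>) + (M + 1 + \<mu> * L2_norm L (nth_deriv 1 \<eta>))"
  have "C \<ge> 0" using G L M by (simp add: C_def)
  moreover have "(L2_norm L g)\<^sup>2 \<le> e + C * \<delta>"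
    if g: "g \<in> sobolev0 L 1" and \<delta>: "\<delta> \<ge> 0" and gM: "L2_norm L (weak_deriv L 1 g) \<le> M"
      and *: "\<And>\<xi>. \<xi> \<in> test_functions L \<Longrightarrow> \<bar>ip L g (nth_deriv 1 \<xi>)\<bar> \<le>
       \<delta> * (L2_norm L \<xi> + L2_norm L (nth_deriv 1 \<xi>) + L2_norm L (nth_deriv 2 \<xi>))" for g \<delta>
  proof -
    define \<kappa> where "\<kappa> = min 1 (e / (2 * \<Gamma>))"
    have \<kappa>: "\<kappa> > 0" "\<kappa> \<le> 1" "\<Gamma> * \<kappa> \<le> e / 2"
      using e G by (auto simp: \<kappa>_def min_def field_simps)
    obtain \<gamma> where \<gamma>: "\<gamma> \<in> test_functions L"
      "\<And>j. j \<le> 1 \<Longrightarrow> L2_norm L (\<lambda>x. weak_deriv L j g x - nth_deriv j \<gamma> x) < \<kappa>"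
      using sobolev0D[OF L g \<kappa>(1)] by blast
    note [simp] = test_L2[OF \<gamma>(1)] test_L2[OF \<eta>(1)] test_L2[OF test_nth_deriv[OF \<gamma>(1) L]]
      test_L2[OF test_nth_deriv[OF \<eta>(1) L]] sobolev0_L2[OF L g]
    have g1 [simp]: "weak_deriv L 1 g \<in> L2 L" by (rule sobolev0_weak_deriv_L2[OF g]) simp
    have e0: "eqv L (weak_deriv L 0 g) g"
      by (intro weak_deriv_eqv has_weak_deriv_0 L sobolev0_L2[OF L g])
    have n0: "L2_norm L (\<lambda>x. g x - \<gamma> x) < \<kappa>"
      using \<gamma>(2)[of 0] eqv_norm[OF eqv_diff[OF e0 eqv_refl[OF test_L2[OF \<gamma>(1)]]]] by simp
    have n1: "L2_norm L (\<lambda>x. weak_deriv L 1 g x - nth_deriv 1 \<gamma> x) < \<kappa>"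
      using \<gamma>(2)[of 1] by simp
    have gn: "L2_norm L g \<le> L * M"
      using poincare[OF L g] mult_left_mono[OF gM, of L] L by linarith
    have \<gamma>n: "L2_norm L \<gamma> \<le> \<Gamma>"
      using L2_norm_le_diff[of \<gamma> L g] n0 gn \<kappa> by (simp add: \<Gamma>_def L2_norm_minus_commute[of L \<gamma>])
    have \<gamma>1: "L2_norm L (nth_deriv 1 \<gamma>) \<le> M + 1"
      using L2_norm_le_diff[OF test_L2[OF test_nth_deriv[OF \<gamma>(1) L, of 1]] g1] n1 gM \<kappa>
        L2_norm_minus_commute[of L "nth_deriv 1 \<gamma>" "weak_deriv L 1 g"] by linarith
    define m where "m = integral {0..L} \<gamma>"
    have i\<gamma>: "\<gamma> integrable_on {0..L}" "\<eta> integrable_on {0..L}"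
      using smooth_continuous[OF test_smooth[OF \<gamma>(1)], of "{0..L}" 0]
        smooth_continuous[OF test_smooth[OF \<eta>(1)], of "{0..L}" 0]
      by (auto intro!: integrable_continuous_real)
    have cm: "(\<lambda>x. m) \<in> L2 L" by (intro L2_continuous) auto
    have "ip L \<gamma> (\<lambda>x. m) = integral {0..L} (\<lambda>x. \<gamma> x \<bullet> m)"
      by (intro ip_integral cm) simp
    also have "\<dots> = m \<bullet> m"
      unfolding m_def using integral_linear[OF i\<gamma>(1) bounded_linear_inner_left[of "integral {0..L} \<gamma>"]]
      by (simp add: o_def)
    finally have "(cmod m)\<^sup>2 = ip L \<gamma> (\<lambda>x. m)" by (simp add: power2_norm_eq_inner)
    also have "\<dots> \<le> L2_norm L \<gamma> * L2_norm L (\<lambda>x. m)"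
      using ip_bound[of \<gamma> L "\<lambda>x. m"] cm by simp
    also have "\<dots> \<le> \<Gamma> * (sqrt L * cmod m)"
      using G by (intro mult_mono \<gamma>n L2_norm_le_bound[OF L cm]) auto
    finally have mn: "cmod m \<le> \<mu>"
      using G by (cases "m = 0") (auto simp: power2_eq_square \<mu>_def mult.commute mult.left_commute)
    define \<theta> where "\<theta> x = 1 * \<gamma> x + (- m) * \<eta> x" for x
    have \<theta>t: "\<theta> \<in> test_functions L"
      unfolding \<theta>_def[abs_def] by (intro test_lin \<gamma> \<eta> L)
    have "integral {0..L} \<theta> = 0"
      using Henstock_Kurzweil_Integration.integral_diff[OF i\<gamma>(1) integrable_on_mult_right[OF i\<gamma>(2), of m]] \<eta>(2)
      by (simp add: \<theta>_def[abs_def] m_def[symmetric])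
    then obtain \<xi> where \<xi>: "\<xi> \<in> test_functions L" "nth_deriv 1 \<xi> = \<theta>"
      using test_antideriv[OF L \<theta>t] by blast
    have \<xi>2: "nth_deriv 2 \<xi> = (\<lambda>x. nth_deriv 1 \<gamma> x - m * nth_deriv 1 \<eta> x)"
      using nth_deriv_add[of 1 1 \<xi>] nth_deriv_lin[OF test_smooth test_smooth, OF \<gamma>(1) \<eta>(1), of 1 1 "-m"]
      unfolding \<xi>(2) by (simp add: \<theta>_def[abs_def] numeral_2_eq_2)
    have \<theta>n: "L2_norm L \<theta> \<le> \<Gamma> + \<mu> * L2_norm L \<eta>"
    proof -
      have "L2_norm L \<theta> \<le> L2_norm L \<gamma> + L2_norm L (\<lambda>x. m * \<eta> x)"
        using L2_norm_diff_le[of \<gamma> L "\<lambda>x. m * \<eta> x"] by (simp add: \<theta>_def[abs_def])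
      then show ?thesis
        using \<gamma>n mult_right_mono[OF mn, of "L2_norm L \<eta>"] by simp
    qed
    have \<xi>2n: "L2_norm L (nth_deriv 2 \<xi>) \<le> M + 1 + \<mu> * L2_norm L (nth_deriv 1 \<eta>)"
    proof -
      have "L2_norm L (nth_deriv 2 \<xi>) \<le> L2_norm L (nth_deriv 1 \<gamma>) + L2_norm L (\<lambda>x. m * nth_deriv 1 \<eta> x)"
        unfolding \<xi>2 by (intro L2_norm_diff_le L2_mult) auto
      then show ?thesis
        using \<gamma>1 mult_right_mono[OF mn, of "L2_norm L (nth_deriv 1 \<eta>)"] by simp
    qed
    have \<xi>n: "L2_norm L \<xi> \<le> L * (\<Gamma> + \<mu> * L2_norm L \<eta>)"
      using poincare_test[OF L \<xi>(1)] mult_left_mono[OF \<theta>n less_imp_le[OF L]]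
      unfolding \<xi>(2) by linarith
    have "ip L g \<theta> \<le> \<delta> * C"
    proof -
      have "ip L g \<theta> \<le> \<delta> * (L2_norm L \<xi> + L2_norm L \<theta> + L2_norm L (nth_deriv 2 \<xi>))"
        using *[OF \<xi>(1)] unfolding \<xi>(2) by linarith
      also have "\<dots> \<le> \<delta> * C"
        using \<xi>n \<theta>n \<xi>2n \<delta> by (intro mult_left_mono) (auto simp: C_def algebra_simps)
      finally show ?thesis .
    qed
    moreover have "ip L g (\<lambda>x. m * \<eta> x) \<le> e / 2"
    proof -
      have "ip L g (\<lambda>x. m * \<eta> x) \<le> cmod m * (sqrt d * L2_norm L (weak_deriv L 1 g))"
        using \<eta>(3)[OF g, of m] by simp
      also have "\<dots> \<le> \<mu> * (sqrt d * (M + 1))"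
        using G gM mn d by (intro mult_mono) auto
      finally show ?thesis using sd by simp
    qed
    moreover have "ip L g (\<lambda>x. g x - \<gamma> x) \<le> e / 2"
    proof -
      have "ip L g (\<lambda>x. g x - \<gamma> x) \<le> L2_norm L g * L2_norm L (\<lambda>x. g x - \<gamma> x)"
        using ip_bound[of g L "\<lambda>x. g x - \<gamma> x"] by simp
      also have "\<dots> \<le> \<Gamma> * \<kappa>"
        using gn n0 G by (intro mult_mono) (auto simp: \<Gamma>_def)
      finally show ?thesis using \<kappa> by simp
    qed
    moreover have "ip L g g = ip L g \<theta> + ip L g (\<lambda>x. m * \<eta> x) + ip L g (\<lambda>x. g x - \<gamma> x)"
      by (simp add: \<theta>_def[abs_def])
    ultimately show ?thesis by (simp add: ip_self mult.commute)
  qed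
  ultimately show ?thesis by blast
qed

section \<open>Decay of the dissipation along a contraction semigroup\<close>

text \<open>Differences and difference quotients of states are all of this form. Real coefficients
  match the real bilinear energy form.\<close>

definition comb :: "real \<Rightarrow> state \<Rightarrow> real \<Rightarrow> state \<Rightarrow> state" where
  "comb a U b V = (\<lambda>i x. a *\<^sub>R U i x + b *\<^sub>R V i x)"

lemma minus_comb: "U - V = comb 1 U (-1) V"
  by (simp add: comb_def fun_eq_iff)

text \<open>Abstracts from the beam. States are representatives and \<open>B\<close> need not be
  definite, so \<open>N\<close> is a seminorm and the semigroup laws hold only up to distance 0;
  these distances are carried along explicitly.\<close>

locale contraction_semigroup =
  fixes X :: "state set" and B :: "state \<Rightarrow> state \<Rightarrow> real" and N :: "state \<Rightarrow> real"
    and T :: "real \<Rightarrow> state \<Rightarrow> state" and D :: "state set" and A :: "state \<Rightarrow> state"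
  assumes X_comb: "\<And>U V a b. U \<in> X \<Longrightarrow> V \<in> X \<Longrightarrow> comb a U b V \<in> X"
    and B_comb: "\<And>U V W a b. U \<in> X \<Longrightarrow> V \<in> X \<Longrightarrow> W \<in> X \<Longrightarrow> B (comb a U b V) W = a * B U W + b * B V W"
    and B_commute: "\<And>U V. B U V = B V U"
    and B_nonneg: "\<And>U. B U U \<ge> 0"
    and N_def: "\<And>U. N U = sqrt (B U U)"
    and C0: "C0_contraction_semigroup X N T"
    and gen: "generated_by X N T D A"
    and D_X: "D \<subseteq> X"
    and A_X: "\<And>U. U \<in> D \<Longrightarrow> A U \<in> X"
begin

lemma N_nonneg [simp]: "N U \<ge> 0"
  by (simp add: N_def B_nonneg)

lemma N_sq: "(N U)\<^sup>2 = B U U"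
  by (simp add: N_def B_nonneg)

lemma X_diff: "U \<in> X \<Longrightarrow> V \<in> X \<Longrightarrow> U - V \<in> X"
  by (simp add: minus_comb X_comb)

lemma B_comb_right:
  "U \<in> X \<Longrightarrow> V \<in> X \<Longrightarrow> W \<in> X \<Longrightarrow> B W (comb a U b V) = a * B W U + b * B W V"
  by (simp add: B_commute[of W] B_comb)

lemma N_comb_sq:
  assumes "U \<in> X" "V \<in> X"
  shows "(N (comb a U b V))\<^sup>2 = a\<^sup>2 * (N U)\<^sup>2 + 2 * a * b * B U V + b\<^sup>2 * (N V)\<^sup>2"
  using assms unfolding N_sq
  by (simp add: B_comb B_comb_right X_comb B_commute[of V U] power2_eq_square algebra_simps)

lemma B_bound:
  assumes "U \<in> X" "V \<in> X"
  shows "\<bar>B U V\<bar> \<le> N U * N V"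
  unfolding N_def
proof (rule discriminant_bound)
  show "0 \<le> B U U + 2 * t * B U V + t\<^sup>2 * B V V" for t
    using N_comb_sq[OF assms, of 1 t] zero_le_power2[of "N (comb 1 U t V)"] by (simp add: N_sq)
qed (rule B_nonneg)

lemma N_comb_le:
  assumes "U \<in> X" "V \<in> X"
  shows "N (comb a U b V) \<le> \<bar>a\<bar> * N U + \<bar>b\<bar> * N V"
proof (rule power2_le_imp_le)
  have "2 * a * b * B U V \<le> \<bar>2 * a * b * B U V\<bar>" by simp
  also have "\<dots> = 2 * \<bar>a\<bar> * \<bar>b\<bar> * \<bar>B U V\<bar>" by (simp add: abs_mult)
  also have "\<dots> \<le> 2 * \<bar>a\<bar> * \<bar>b\<bar> * (N U * N V)"
    by (intro mult_left_mono B_bound assms) auto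
  finally show "(N (comb a U b V))\<^sup>2 \<le> (\<bar>a\<bar> * N U + \<bar>b\<bar> * N V)\<^sup>2"
    unfolding N_comb_sq[OF assms] by (simp add: power2_sum power_mult_distrib algebra_simps)
qed auto

lemma N_triangle:
  assumes "U \<in> X" "V \<in> X" "W \<in> X"
  shows "N (U - W) \<le> N (U - V) + N (V - W)"
proof -
  have "U - W = comb 1 (U - V) 1 (V - W)"
    by (simp add: comb_def fun_eq_iff)
  then show ?thesis
    using N_comb_le[of "U - V" "V - W" 1 1] assms by (simp add: X_diff)
qed

lemma N_le_add_diff:
  assumes "U \<in> X" "V \<in> X"
  shows "N U \<le> N V + N (U - V)"
proof -
  have "U = comb 1 V 1 (U - V)"
    by (simp add: comb_def fun_eq_iff)
  then show ?thesis
    using N_comb_le[of V "U - V" 1 1] assms by (simp add: X_diff)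
qed

lemma N_minus_commute:
  assumes "U \<in> X" "V \<in> X"
  shows "N (U - V) = N (V - U)"
proof -
  have "(N (U - V))\<^sup>2 = (N (V - U))\<^sup>2"
    using N_comb_sq[of U V 1 "-1"] N_comb_sq[of V U 1 "-1"] assms
    by (simp add: minus_comb B_commute[of V U])
  then show ?thesis by (simp add: power2_eq_iff_nonneg)
qed

lemma N_zero_trans:
  assumes "U \<in> X" "V \<in> X" "W \<in> X" "N (U - V) = 0" "N (V - W) = 0"
  shows "N (U - W) = 0"
  using N_triangle[OF assms(1-3)] assms(4,5) N_nonneg[of "U - W"] by linarith

section \<open>The semigroup laws up to distance zero\<close>

lemma T_X: "t \<ge> 0 \<Longrightarrow> U \<in> X \<Longrightarrow> T t U \<in> X"
  using C0 by (simp add: C0_contraction_semigroup_def)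

lemma T_contr: "t \<ge> 0 \<Longrightarrow> U \<in> X \<Longrightarrow> N (T t U) \<le> N U"
  using C0 by (simp add: C0_contraction_semigroup_def)

lemma T_zero: "U \<in> X \<Longrightarrow> N (T 0 U - U) = 0"
  using C0 by (simp add: C0_contraction_semigroup_def)

lemma T_add: "s \<ge> 0 \<Longrightarrow> t \<ge> 0 \<Longrightarrow> U \<in> X \<Longrightarrow> N (T (s + t) U - T s (T t U)) = 0"
  using C0 by (simp add: C0_contraction_semigroup_def)

lemma T_comb:
  assumes "t \<ge> 0" "U \<in> X" "V \<in> X"
  shows "N (T t (comb a U b V) - comb a (T t U) b (T t V)) = 0"
proof -
  have "\<forall>\<alpha> \<beta>. N (T t (\<lambda>i x. \<alpha> * U i x + \<beta> * V i x) - (\<lambda>i x. \<alpha> * T t U i x + \<beta> * T t V i x)) = 0"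
    using C0 assms unfolding C0_contraction_semigroup_def by blast
  from this[rule_format, of "of_real a" "of_real b"] show ?thesis
    by (simp add: comb_def scaleR_conv_of_real)
qed

lemma T_diff_le:
  assumes "t \<ge> 0" "U \<in> X" "V \<in> X"
  shows "N (T t U - T t V) \<le> N (U - V)"
proof -
  have "N (T t U - T t V) \<le> N (T t (U - V)) + N ((T t U - T t V) - T t (U - V))"
    using assms by (intro N_le_add_diff X_diff T_X)
  moreover have "N ((T t U - T t V) - T t (U - V)) = N (T t (U - V) - (T t U - T t V))"
    using assms by (intro N_minus_commute X_diff T_X)
  moreover have "N (T t (U - V) - (T t U - T t V)) = 0"
    using T_comb[OF assms, of 1 "-1"] unfolding minus_comb[symmetric] .
  moreover have "N (T t (U - V)) \<le> N (U - V)"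
    using assms by (intro T_contr X_diff)
  ultimately show ?thesis by linarith
qed

lemma T_antimono:
  assumes "0 \<le> s" "s \<le> t" "U \<in> X"
  shows "N (T t U) \<le> N (T s U)"
proof -
  have "N (T t U) \<le> N (T (t - s) (T s U)) + N (T t U - T (t - s) (T s U))"
    using assms by (intro N_le_add_diff T_X) auto
  also have "N (T t U - T (t - s) (T s U)) = 0"
    using T_add[of "t - s" s U] assms by simp
  also have "N (T (t - s) (T s U)) \<le> N (T s U)"
    using assms by (intro T_contr T_X) auto
  finally show ?thesis by simp
qed

text \<open>The graph of the generator. It is a relation, since \<open>F\<close> is determined only
  up to distance 0.\<close>

definition G :: "state \<Rightarrow> state \<Rightarrow> bool" where
  "G U F \<longleftrightarrow> U \<in> X \<and> F \<in> X \<and>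
    ((\<lambda>t. N (comb (1 / t) (T t U - U) (-1) F)) \<longlongrightarrow> 0) (at_right 0)"

lemma G_iff: "G U F \<longleftrightarrow> U \<in> X \<and> F \<in> X \<and> U \<in> D \<and> N (F - A U) = 0"
proof -
  have "comb (1 / t) (T t U - U) (-1) F = (\<lambda>i x. (1 / t) *\<^sub>R (T t U i x - U i x)) - F" for t
    by (simp add: comb_def fun_eq_iff)
  then show ?thesis
    using gen unfolding generated_by_def G_def by auto
qed

lemma G_A: "U \<in> D \<Longrightarrow> G U (A U)"
proof -
  assume U: "U \<in> D"
  have "A U - A U = comb 0 (A U) 0 (A U)"
    by (simp add: comb_def fun_eq_iff)
  then have "(N (A U - A U))\<^sup>2 = 0"
    using N_comb_sq[OF A_X[OF U] A_X[OF U], of 0 0] by simp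
  then show ?thesis using U D_X A_X by (auto simp: G_iff)
qed

text \<open>\<open>T t\<close> commutes with \<open>T h\<close> and with linear combinations, so it
  maps the difference quotient of U to that of \<open>T t U\<close>; contractivity carries the
  convergence over.\<close>

lemma G_T:
  assumes t: "t \<ge> 0" and G: "G U F"
  shows "G (T t U) (T t F)"
proof -
  have U: "U \<in> X" and F: "F \<in> X" using G by (auto simp: G_def)
  have "N (comb (1 / h) (T h (T t U) - T t U) (-1) (T t F)) \<le> N (comb (1 / h) (T h U - U) (-1) F)"
    if h: "h > 0" for h
  proof -
    \<comment> \<open>\<open>?P\<close> is the quotient wanted and \<open>T t ?Q\<close> the one
      controlled. \<open>?R\<close> and \<open>?S\<close> lie between them, so that each gap is a
      single application of commutation or linearity.\<close>
    let ?Q = "comb (1 / h) (T h U - U) (-1) F"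
    let ?P = "comb (1 / h) (T h (T t U) - T t U) (-1) (T t F)"
    let ?R = "comb (1 / h) (T t (T h U) - T t U) (-1) (T t F)"
    let ?S = "comb (1 / h) (T t (T h U - U)) (-1) (T t F)"
    note [simp] = X_comb X_diff T_X U F t less_imp_le[OF h]
    have a: "N (T h (T t U) - T t (T h U)) = 0"
    proof (rule N_zero_trans[of _ "T (t + h) U"])
      show "N (T h (T t U) - T (t + h) U) = 0"
        using T_add[of h t U] N_minus_commute[of "T h (T t U)" "T (t + h) U"] by (simp add: add.commute)
      show "N (T (t + h) U - T t (T h U)) = 0"
        by (rule T_add) auto
    qed auto
    have "?P - ?R = comb (1 / h) (T h (T t U) - T t (T h U)) 0 U"
      by (simp add: comb_def fun_eq_iff algebra_simps)
    then have 1: "N (?P - ?R) \<le> 0"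
      using N_comb_le[of "T h (T t U) - T t (T h U)" U "1 / h" 0] a by simp
    have "?R - ?S = comb (1 / h) ((T t (T h U) - T t U) - T t (T h U - U)) 0 U"
      by (simp add: comb_def fun_eq_iff algebra_simps)
    moreover have "N ((T t (T h U) - T t U) - T t (T h U - U)) = 0"
      using T_comb[of t "T h U" U 1 "-1"] N_minus_commute[of "T t (T h U) - T t U" "T t (T h U - U)"]
      by (simp add: minus_comb[symmetric])
    ultimately have 2: "N (?R - ?S) \<le> 0"
      using N_comb_le[of "(T t (T h U) - T t U) - T t (T h U - U)" U "1 / h" 0] by simp
    have 3: "N (?S - T t ?Q) = 0"
      using T_comb[of t "T h U - U" F "1 / h" "-1"] N_minus_commute[of "?S" "T t ?Q"] by simp
    have "N (?P - T t ?Q) \<le> 0"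
      using N_triangle[of ?P ?R "T t ?Q"] N_triangle[of ?R ?S "T t ?Q"] 1 2 3 by simp
    then show ?thesis
      using N_le_add_diff[of ?P "T t ?Q"] T_contr[of t ?Q] by simp
  qed
  then have "\<forall>\<^sub>F h in at_right 0. norm (N (comb (1 / h) (T h (T t U) - T t U) (-1) (T t F)))
      \<le> N (comb (1 / h) (T h U - U) (-1) F)"
    by (intro eventually_mono[OF eventually_at_right_less]) simp
  moreover have "((\<lambda>h. N (comb (1 / h) (T h U - U) (-1) F)) \<longlongrightarrow> 0) (at_right 0)"
    using G by (simp add: G_def)
  ultimately have "((\<lambda>h. N (comb (1 / h) (T h (T t U) - T t U) (-1) (T t F))) \<longlongrightarrow> 0) (at_right 0)"
    by (rule Lim_null_comparison)
  then show ?thesis using U F t by (simp add: G_def T_X)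
qed

lemma T_D:
  assumes "t \<ge> 0" "U \<in> D"
  shows "T t U \<in> D" "N (T t (A U) - A (T t U)) = 0"
  using G_T[OF assms(1) G_A[OF assms(2)]] by (auto simp: G_iff)

text \<open>Subdividing \<open>[0, h]\<close> into \<open>n\<close> pieces of length \<open>s = h / n\<close>, the difference quotients at scale \<open>s\<close>
  converge to \<open>F\<close>, and the errors add up.\<close>

lemma tendsto_subdivide:
  assumes G: "G U F" and h: "h > 0"
  shows "(\<lambda>n. N (comb (1 / (h / Suc n)) (T (h / Suc n) U - U) (-1) F)) \<longlonglongrightarrow> 0"
proof -
  have "filterlim (\<lambda>n. h / Suc n) (at_right 0) sequentially"
    unfolding filterlim_at
  proof
    show "\<forall>\<^sub>F n in sequentially. h / real (Suc n) \<in> {0<..} \<and> h / real (Suc n) \<noteq> 0"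
      using h by simp
    show "(\<lambda>n. h / real (Suc n)) \<longlonglongrightarrow> 0"
      using tendsto_mult_left[OF LIMSEQ_inverse_real_of_nat, of h] by (simp add: divide_inverse)
  qed
  moreover have "((\<lambda>t. N (comb (1 / t) (T t U - U) (-1) F)) \<longlongrightarrow> 0) (at_right 0)"
    using G by (simp add: G_def)
  ultimately show ?thesis
    by (rule filterlim_compose[rotated])
qed

text \<open>Replaces the representation of \<open>T h U - U\<close> as a time integral of
  \<open>T s F\<close>: the difference telescopes over equal steps, and by contractivity no
  increment is larger than the first.\<close>

lemma T_diff_bound:
  assumes G: "G U F" and h: "h \<ge> 0"
  shows "N (T h U - U) \<le> h * N F"
proof (cases "h = 0")
  case True
  then show ?thesis using T_zero G by (simp add: G_def)
next
  case False
  then have h: "h > 0" using assms by simp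
  have U: "U \<in> X" and F: "F \<in> X" using G by (auto simp: G_def)
  note [simp] = X_comb X_diff T_X U F
  define q where "q s = N (comb (1 / s) (T s U - U) (-1) F)" for s
  have step: "N (T s U - U) \<le> s * (q s + N F)" if "s > 0" for s
  proof -
    have "T s U - U = comb s (comb (1 / s) (T s U - U) (-1) F) s F"
      using that by (simp add: comb_def fun_eq_iff algebra_simps)
    then show ?thesis
      using N_comb_le[of "comb (1 / s) (T s U - U) (-1) F" F s s] that by (simp add: q_def algebra_simps)
  qed
  have ind: "N (T (real n * s) U - U) \<le> real n * N (T s U - U)" if s: "s > 0" for n s
  proof (induction n)
    case 0
    then show ?case using T_zero[OF U] by (simp add: fun_diff_def)
  next
    case (Suc n)
    have "N (T (real (Suc n) * s) U - U) \<le>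
      N (T (real n * s + s) U - T (real n * s) (T s U)) + N (T (real n * s) (T s U) - U)"
      using s N_triangle[of "T (real n * s + s) U" "T (real n * s) (T s U)" U] by (simp add: algebra_simps)
    also have "N (T (real n * s + s) U - T (real n * s) (T s U)) = 0"
      using s by (intro T_add) auto
    also have "N (T (real n * s) (T s U) - U) \<le> N (T (real n * s) (T s U) - T (real n * s) U) + N (T (real n * s) U - U)"
      using s by (intro N_triangle) auto
    also have "N (T (real n * s) (T s U) - T (real n * s) U) \<le> N (T s U - U)"
      using s by (intro T_diff_le) auto
    finally show ?case using Suc by (simp add: algebra_simps fun_diff_def)
  qed
  have "N (T h U - U) \<le> h * (q (h / Suc n) + N F)" for n
  proof -
    have "N (T h U - U) \<le> real (Suc n) * N (T (h / Suc n) U - U)"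
      using ind[of "h / Suc n" "Suc n"] h by simp
    also have "\<dots> \<le> real (Suc n) * ((h / Suc n) * (q (h / Suc n) + N F))"
      using h by (intro mult_left_mono step) auto
    also have "\<dots> = h * (q (h / Suc n) + N F)" by simp
    finally show ?thesis .
  qed
  moreover have "(\<lambda>n. h * (q (h / Suc n) + N F)) \<longlonglongrightarrow> h * (0 + N F)"
    unfolding q_def by (intro tendsto_intros tendsto_subdivide G h)
  ultimately show ?thesis
    by (intro LIMSEQ_le_const[of "\<lambda>n. h * (q (h / Suc n) + N F)"]) auto
qed

text \<open>Taylor's formula without integrals. A step from t to t + s reproduces the first-order
  error s q(s) and adds s (T t F - F), whose norm is at most s t N(F') by
  \<open>T_diff_bound\<close>. The constant 1 in place of 1/2 lets the induction close through s t +
  t^2 \<le> (t + s)^2.\<close>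

lemma T_taylor_bound:
  assumes G: "G U F" and G': "G F F'" and h: "h > 0"
  shows "N (comb 1 (T h U - U) (- h) F) \<le> h\<^sup>2 * N F'"
proof -
  have U: "U \<in> X" and F: "F \<in> X" using G by (auto simp: G_def)
  note [simp] = X_comb X_diff T_X U F
  define q where "q s = N (comb (1 / s) (T s U - U) (-1) F)" for s
  have ind: "N (comb 1 (T (real n * s) U - U) (- (real n * s)) F) \<le> real n * (s * q s) + (real n * s)\<^sup>2 * N F'"
    if s: "s > 0" for n s
  proof (induction n)
    case 0
    have "comb 1 (T 0 U - U) 0 F = T 0 U - U" by (simp add: comb_def fun_eq_iff)
    then show ?case using T_zero[OF U] by (simp add: fun_diff_def)
  next
    case (Suc n)
    let ?t = "real n * s"
    have t: "?t \<ge> 0" using s by simp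
    note [simp] = t less_imp_le[OF s]
    let ?R = "comb 1 (T s U - U) (- s) F"
    let ?Z = "comb 1 (T ?t (T s U) - T ?t U) (- s) (T ?t F)"
    have "?R = comb s (comb (1 / s) (T s U - U) (-1) F) 0 F"
      using s by (simp add: comb_def fun_eq_iff algebra_simps)
    then have R: "N ?R \<le> s * q s"
      using N_comb_le[of "comb (1 / s) (T s U - U) (-1) F" F s 0] s by (simp add: q_def)
    have "N (?Z - T ?t ?R) \<le> N (?Z - comb 1 (T ?t (T s U - U)) (- s) (T ?t F)) + N (comb 1 (T ?t (T s U - U)) (- s) (T ?t F) - T ?t ?R)"
      by (intro N_triangle) auto
    also have "N (comb 1 (T ?t (T s U - U)) (- s) (T ?t F) - T ?t ?R) = 0"
      using T_comb[of ?t "T s U - U" F 1 "- s"]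
        N_minus_commute[of "comb 1 (T ?t (T s U - U)) (- s) (T ?t F)" "T ?t ?R"] by simp
    also have "?Z - comb 1 (T ?t (T s U - U)) (- s) (T ?t F) = (T ?t (T s U) - T ?t U) - T ?t (T s U - U)"
      by (simp add: comb_def fun_eq_iff)
    also have "N \<dots> = 0"
      using T_comb[of ?t "T s U" U 1 "-1"] N_minus_commute[of "T ?t (T s U) - T ?t U" "T ?t (T s U - U)"]
      by (simp add: minus_comb[symmetric])
    finally have "N (?Z - T ?t ?R) \<le> 0" by (simp add: fun_diff_def)
    then have Z: "N ?Z \<le> s * q s"
      using N_le_add_diff[of ?Z "T ?t ?R"] T_contr[of ?t ?R] R by simp
    have F: "N (T ?t F - F) \<le> ?t * N F'"
      by (rule T_diff_bound[OF G' t])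
    have st: "real (Suc n) * s = ?t + s" by (simp add: algebra_simps)
    \<comment> \<open>\<open>?Y\<close> is the defect of the semigroup law, of norm 0;
      \<open>?Z\<close> is the transported error of one step; \<open>?W\<close> belongs to the
      induction hypothesis.\<close>
    let ?Y = "T (?t + s) U - T ?t (T s U)"
    let ?W = "comb 1 (T ?t U - U) (- ?t) F"
    have "comb 1 (T (real (Suc n) * s) U - U) (- (real (Suc n) * s)) F
       = comb 1 (comb 1 ?Y 1 ?Z) 1 (comb s (T ?t F - F) 1 ?W)"
      unfolding st by (simp add: comb_def fun_eq_iff algebra_simps)
    then have "N (comb 1 (T (real (Suc n) * s) U - U) (- (real (Suc n) * s)) F)
      \<le> N (comb 1 ?Y 1 ?Z) + N (comb s (T ?t F - F) 1 ?W)"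
      using N_comb_le[of "comb 1 ?Y 1 ?Z" "comb s (T ?t F - F) 1 ?W" 1 1] by simp
    also have "\<dots> \<le> (N ?Y + N ?Z) + (s * N (T ?t F - F) + N ?W)"
      using N_comb_le[of ?Y ?Z 1 1] N_comb_le[of "T ?t F - F" ?W s 1] by simp
    also have "\<dots> \<le> (0 + s * q s) + (s * (?t * N F') + (?t * q s + ?t\<^sup>2 * N F'))"
    proof (intro add_mono mult_left_mono Z F)
      show "N ?Y \<le> 0" using T_add[of ?t s U] by simp
      show "N ?W \<le> ?t * q s + ?t\<^sup>2 * N F'" using Suc by (simp add: algebra_simps fun_diff_def)
    qed auto
    also have "\<dots> \<le> real (Suc n) * (s * q s) + (real (Suc n) * s)\<^sup>2 * N F'"
    proof -
      have "s * (?t * N F') + ?t\<^sup>2 * N F' = (s * ?t + ?t\<^sup>2) * N F'" by (simp add: algebra_simps)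
      also have "\<dots> \<le> (real (Suc n) * s)\<^sup>2 * N F'"
      proof (intro mult_right_mono N_nonneg)
        have "(?t + s)\<^sup>2 = (s * ?t + ?t\<^sup>2) + (s * ?t + s\<^sup>2)"
          by (simp add: power2_eq_square algebra_simps)
        moreover have "s * ?t + s\<^sup>2 \<ge> 0" using s by simp
        ultimately show "s * ?t + ?t\<^sup>2 \<le> (real (Suc n) * s)\<^sup>2" unfolding st by linarith
      qed
      finally show ?thesis by (simp add: algebra_simps)
    qed
    finally show ?case .
  qed
  have "N (comb 1 (T h U - U) (- h) F) \<le> h * q (h / Suc n) + h\<^sup>2 * N F'" for n
    using ind[of "h / Suc n" "Suc n"] h by simp
  moreover have "(\<lambda>n. h * q (h / Suc n) + h\<^sup>2 * N F') \<longlonglongrightarrow> h * 0 + h\<^sup>2 * N F'"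
    unfolding q_def by (intro tendsto_intros tendsto_subdivide G h)
  ultimately show ?thesis
    by (intro LIMSEQ_le_const[of "\<lambda>n. h * q (h / Suc n) + h\<^sup>2 * N F'"]) auto
qed

text \<open>The norm of \<open>T h V\<close> exceeds that of V + h F by at most O(h^2), and
  expanding the square of the latter produces the dissipation 2 h B(V, F). Contractivity bounds all
  error terms by norms at time 0, so the estimate is uniform in t.\<close>

lemma dissipation_bound:
  assumes W: "W \<in> D" "A W \<in> D" and t: "t \<ge> 0" and h: "h > 0"
  shows "- (2 * h * B (T t W) (A (T t W))) \<le> (N (T t W))\<^sup>2 - (N (T (t + h) W))\<^sup>2
     + h\<^sup>2 * ((N (A W))\<^sup>2 + 2 * N (A (A W)) * N W)"
proof -
  define V F F' where "V = T t W" and "F = T t (A W)" and "F' = T t (A (A W))"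
  have G1: "G V F" and G2: "G F F'"
    unfolding V_def F_def F'_def using W by (intro G_T[OF t] G_A; simp)+
  have WX: "W \<in> X" "A W \<in> X" "A (A W) \<in> X" using W D_X A_X by auto
  have X [simp]: "V \<in> X" "F \<in> X" "F' \<in> X" "T h V \<in> X"
    using G1 G2 h by (auto simp: G_def T_X)
  have AV: "A V \<in> X" using T_D[OF t W(1)] A_X by (simp add: V_def)
  have nF: "N F \<le> N (A W)" "N F' \<le> N (A (A W))" "N V \<le> N W"
    unfolding V_def F_def F'_def using t WX by (auto intro: T_contr)
  have "B V F - B V (A V) = B (F - A V) V"
    using B_comb[of F "A V" V 1 "-1"] AV by (simp add: minus_comb B_commute[of V])
  moreover have "\<bar>B (F - A V) V\<bar> \<le> 0"
    using B_bound[OF X_diff[OF X(2) AV] X(1)] T_D(2)[OF t W(1), folded F_def V_def] by simp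
  ultimately have BF: "B V (A V) = B V F" by simp
  define y z k where "y = N (T h V)" and "z = N (comb 1 V h F)" and "k = h\<^sup>2 * N F'"
  have "T h V - comb 1 V h F = comb 1 (T h V - V) (- h) F"
    by (simp add: comb_def fun_eq_iff algebra_simps)
  then have yz: "y \<le> z + k"
    using N_le_add_diff[of "T h V" "comb 1 V h F"] T_taylor_bound[OF G1 G2 h]
    by (simp add: y_def z_def k_def X_comb)
  have nn: "y \<ge> 0" "z \<ge> 0" "k \<ge> 0" by (simp_all add: y_def z_def k_def)
  \<comment> \<open>Squaring y \<le> z + k directly would leave a product with z; this form leaves
    one with y, which is bounded by \<open>N W\<close>.\<close>
  have "y\<^sup>2 - 2 * k * y \<le> z\<^sup>2"
  proof (cases "y \<ge> k")
    case True
    have "(y - k)\<^sup>2 \<le> z\<^sup>2" using True yz by (intro power_mono) auto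
    moreover have "(y - k)\<^sup>2 = y\<^sup>2 - 2 * k * y + k\<^sup>2"
      by (simp add: power2_diff algebra_simps)
    ultimately show ?thesis using zero_le_power2[of k] by linarith
  next
    case False
    then have "y * y \<le> k * y" using nn by (intro mult_right_mono) auto
    then have "y\<^sup>2 - 2 * k * y \<le> 0"
      using mult_nonneg_nonneg[of k y] nn unfolding power2_eq_square by linarith
    also have "0 \<le> z\<^sup>2" by simp
    finally show ?thesis .
  qed
  moreover have "z\<^sup>2 = (N V)\<^sup>2 + 2 * h * B V F + h\<^sup>2 * (N F)\<^sup>2"
    unfolding z_def by (simp add: N_comb_sq)
  ultimately have "- (2 * h * B V F) \<le> (N V)\<^sup>2 - y\<^sup>2 + h\<^sup>2 * (N F)\<^sup>2 + 2 * k * y"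
    by linarith
  moreover have "h\<^sup>2 * (N F)\<^sup>2 \<le> h\<^sup>2 * (N (A W))\<^sup>2"
    by (intro mult_left_mono power_mono nF) auto
  moreover have "2 * k * y \<le> h\<^sup>2 * (2 * N (A (A W)) * N W)"
  proof -
    have "y \<le> N W" unfolding y_def using T_contr[of h V] h nF by simp
    then have "N F' * y \<le> N (A (A W)) * N W"
      using nF nn by (intro mult_mono) auto
    then have "h\<^sup>2 * (2 * (N F' * y)) \<le> h\<^sup>2 * (2 * (N (A (A W)) * N W))"
      by (intro mult_left_mono) auto
    then show ?thesis by (simp add: k_def algebra_simps)
  qed
  moreover have "y = N (T (t + h) W)"
  proof -
    have e: "N (T (h + t) W - T h V) = 0"
      unfolding V_def using T_add[of h t W] h t WX by simp
    have x: "T (h + t) W \<in> X" using h t WX by (simp add: T_X)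
    have "N (T (h + t) W) \<le> y" "y \<le> N (T (h + t) W)"
      unfolding y_def using N_le_add_diff[OF x X(4)] N_le_add_diff[OF X(4) x] e
        N_minus_commute[OF x X(4)] by auto
    then show ?thesis by (simp add: add.commute)
  qed
  ultimately show ?thesis
    unfolding BF[unfolded V_def] by (simp add: V_def algebra_simps)
qed

text \<open>The energy decreases to its infimum, so its drop over a window of fixed length h is
  eventually below h \<epsilon>. Dividing by h leaves the error C h of
  \<open>dissipation_bound\<close>, which the choice of h makes small.\<close>

lemma dissipation_tendsto_0:
  assumes W: "W \<in> D" "A W \<in> D" and dis: "\<And>U. U \<in> D \<Longrightarrow> B U (A U) \<le> 0"
  shows "((\<lambda>t. B (T t W) (A (T t W))) \<longlongrightarrow> 0) at_top"
proof (rule tendstoI)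
  fix \<epsilon> :: real assume \<epsilon>: "\<epsilon> > 0"
  have WX: "W \<in> X" using W D_X by auto
  define C where "C = (N (A W))\<^sup>2 + 2 * N (A (A W)) * N W"
  have C: "C \<ge> 0" by (simp add: C_def)
  define E where "E t = (N (T t W))\<^sup>2" for t
  \<comment> \<open>Then the quadratic error is at most h \<epsilon> / 2, and twice the dissipation
    stays below 3 \<epsilon> / 2.\<close>
  define h where "h = \<epsilon> / (2 * (C + 1))"
  have h: "h > 0" "C * h \<le> \<epsilon> / 2"
    using \<epsilon> C by (auto simp: h_def field_simps)
  define I where "I = Inf (E ` {0..})"
  have bdd: "bdd_below (E ` {0..})" by (rule bdd_belowI[of _ 0]) (auto simp: E_def)
  have "I < I + h * \<epsilon>" using h \<epsilon> by simp
  then obtain t0 where t0: "t0 \<ge> 0" "E t0 < I + h * \<epsilon>"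
    unfolding I_def using cInf_lessD[of "E ` {0..}"] by fastforce
  have "dist (B (T t W) (A (T t W))) 0 < \<epsilon>" if t: "t \<ge> t0" for t
  proof -
    have "E t \<le> E t0"
      unfolding E_def using t t0 WX by (intro power_mono T_antimono) auto
    moreover have "I \<le> E (t + h)"
      unfolding I_def using t t0 h by (intro cInf_lower bdd) auto
    ultimately have "E t - E (t + h) < h * \<epsilon>" using t0 by linarith
    moreover have "- (2 * h * B (T t W) (A (T t W))) \<le> E t - E (t + h) + h\<^sup>2 * C"
      unfolding E_def C_def using dissipation_bound[OF W _ h(1), of t] t t0 by simp
    moreover have "h\<^sup>2 * C \<le> h * (\<epsilon> / 2)"
      using mult_left_mono[OF h(2), of h] h(1) by (simp add: power2_eq_square algebra_simps)
    ultimately have "h * (- (2 * B (T t W) (A (T t W)))) < h * (\<epsilon> + \<epsilon> / 2)"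
      by (simp add: algebra_simps)
    then have "- (2 * B (T t W) (A (T t W))) < \<epsilon> + \<epsilon> / 2"
      using h(1) by (simp only: mult_less_cancel_left_pos)
    moreover have "B (T t W) (A (T t W)) \<le> 0"
      using T_D(1)[OF _ W(1), of t] t t0 by (intro dis) auto
    ultimately show ?thesis using \<epsilon> by (simp add: dist_real_def)
  qed
  then show "\<forall>\<^sub>F t in at_top. dist (B (T t W) (A (T t W))) 0 < \<epsilon>"
    unfolding eventually_at_top_linorder by blast
qed

lemma stable_if_dense:
  assumes S: "\<And>U e. U \<in> X \<Longrightarrow> e > 0 \<Longrightarrow> \<exists>V\<in>S. N (U - V) < e" "S \<subseteq> X"
    and st: "\<And>V. V \<in> S \<Longrightarrow> ((\<lambda>t. N (T t V)) \<longlongrightarrow> 0) at_top"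
    and U: "U \<in> X"
  shows "((\<lambda>t. N (T t U)) \<longlongrightarrow> 0) at_top"
proof (rule tendstoI)
  fix e :: real assume e: "e > 0"
  obtain V where V: "V \<in> S" "N (U - V) < e / 2"
    using S(1)[OF U, of "e / 2"] e by auto
  have VX: "V \<in> X" using V S by auto
  have "\<forall>\<^sub>F t in at_top. N (T t V) < e / 2"
    using order_tendstoD(2)[OF st[OF V(1)], of "e / 2"] e by simp
  with eventually_ge_at_top[of 0] show "\<forall>\<^sub>F t in at_top. dist (N (T t U)) 0 < e"
  proof eventually_elim
    case (elim t)
    then show ?case
      using N_le_add_diff[of "T t U" "T t V"] T_diff_le[of t U V] U V VX
      by (simp add: T_X dist_real_def)
  qed
qed

end

section \<open>The energy form of the beam\<close>

definition eform :: "beam \<Rightarrow> state \<Rightarrow> state \<Rightarrow> real" where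
  "eform p U V = (let i = ip (len p); D = weak_deriv (len p) in
     E1 p * h1 p * i (D 1 (U Cu1)) (D 1 (V Cu1)) + rho1 p * h1 p * i (U Cv1) (V Cv1)
   + E3 p * h3 p * i (D 1 (U Cu3)) (D 1 (V Cu3)) + rho3 p * h3 p * i (U Cv3) (V Cv3)
   + EI p * i (D 2 (U Comega)) (D 2 (V Comega)) + rho_h p * i (U Cpsi) (V Cpsi)
   + E1 p * I1 p * i (D 1 (U Cy1)) (D 1 (V Cy1)) + rho1 p * I1 p * i (U Cz1) (V Cz1)
   + E3 p * I3 p * i (D 1 (U Cy3)) (D 1 (V Cy3)) + rho3 p * I3 p * i (U Cz3) (V Cz3)
   + G1 p * h1 p * i (shear p Cy1 U) (shear p Cy1 V) + i (tau p U) (tau p V)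
   + G3 p * h3 p * i (shear p Cy3 U) (shear p Cy3 V))"

text \<open>The order of the Sobolev space of each component. Order 0 fits in because H^0_0 is L^2
  by density, so one family of conditions describes the energy space.\<close>

fun order_of :: "comp \<Rightarrow> nat" where
  "order_of Cu1 = 1" | "order_of Cy1 = 1" | "order_of Cu3 = 1" | "order_of Cy3 = 1"
| "order_of Comega = 2"
| "order_of Cv1 = 0" | "order_of Cz1 = 0" | "order_of Cv3 = 0" | "order_of Cz3 = 0" | "order_of Cpsi = 0"

locale sandwich_beam =
  fixes p :: beam
  assumes adm: "admissible p"
begin

abbreviation "l \<equiv> len p"
abbreviation "D \<equiv> weak_deriv (len p)"
abbreviation "X \<equiv> energy_space p"
abbreviation "N \<equiv> energy_norm p"
abbreviation "nrm \<equiv> L2_norm (len p)"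

lemma pos: "l > 0" "rho1 p > 0" "rho3 p > 0" "h1 p > 0" "h2 p > 0" "h3 p > 0"
  "E1 p > 0" "E3 p > 0" "I1 p > 0" "I3 p > 0" "G1 p > 0" "G3 p > 0" "EI p > 0" "rho_h p > 0"
  "damp_a p \<ge> 0" "damp_b p \<ge> 0" "damp_c p \<ge> 0" "damp_d p \<ge> 0" "damp_e p \<ge> 0"
  using adm by (auto simp: admissible_def EI_def rho_h_def add_pos_pos)

lemma X_iff: "U \<in> X \<longleftrightarrow> (\<forall>i. U i \<in> sobolev0 l (order_of i))"
proof
  assume "U \<in> X"
  then show "\<forall>i. U i \<in> sobolev0 l (order_of i)"
    using sobolev0_0[OF pos(1)] by (intro allI, case_tac i) (simp_all add: energy_space_def)
next
  assume *: "\<forall>i. U i \<in> sobolev0 l (order_of i)"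
  show "U \<in> X"
    using *[rule_format, of Cu1] *[rule_format, of Cy1] *[rule_format, of Cu3] *[rule_format, of Cy3]
      *[rule_format, of Comega] *[rule_format, of Cv1] *[rule_format, of Cz1] *[rule_format, of Cv3]
      *[rule_format, of Cz3] *[rule_format, of Cpsi] sobolev0_0[OF pos(1)]
    by (simp add: energy_space_def)
qed

lemma X_L2: "U \<in> X \<Longrightarrow> U i \<in> L2 l"
  using sobolev0_L2[OF pos(1)] by (auto simp: X_iff)

lemma X_H1:
  assumes "U \<in> X"
  shows "U Cu1 \<in> sobolev0 l 1" "U Cy1 \<in> sobolev0 l 1" "U Cu3 \<in> sobolev0 l 1" "U Cy3 \<in> sobolev0 l 1"
    "U Comega \<in> sobolev0 l 1" "U Comega \<in> sobolev0 l 2"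
proof -
  show "U Cu1 \<in> sobolev0 l 1" "U Cy1 \<in> sobolev0 l 1" "U Cu3 \<in> sobolev0 l 1" "U Cy3 \<in> sobolev0 l 1"
    and *: "U Comega \<in> sobolev0 l 2"
    using assms by (simp_all add: energy_space_def)
  show "U Comega \<in> sobolev0 l 1"
    by (rule sobolev0_mono[OF pos(1) *]) simp
qed

lemma dom_X: "U \<in> dom_A p \<Longrightarrow> U \<in> X"
  using sobolev0_L2[OF pos(1)] by (auto simp: dom_A_def energy_space_def)

lemma dom_H1:
  assumes "U \<in> dom_A p"
  shows "U Cv1 \<in> sobolev0 l 1" "U Cz1 \<in> sobolev0 l 1" "U Cv3 \<in> sobolev0 l 1" "U Cz3 \<in> sobolev0 l 1"
    "U Cpsi \<in> sobolev0 l 2" "U Cpsi \<in> sobolev0 l 1"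
proof -
  show "U Cv1 \<in> sobolev0 l 1" "U Cz1 \<in> sobolev0 l 1" "U Cv3 \<in> sobolev0 l 1" "U Cz3 \<in> sobolev0 l 1"
    and *: "U Cpsi \<in> sobolev0 l 2"
    using assms by (simp_all add: dom_A_def)
  show "U Cpsi \<in> sobolev0 l 1"
    by (rule sobolev0_mono[OF pos(1) *]) simp
qed

declare X_L2 [simp]

lemma X_D_L2 [simp]:
  assumes "U \<in> X"
  shows "D 1 (U Cu1) \<in> L2 l" "D 1 (U Cy1) \<in> L2 l" "D 1 (U Cu3) \<in> L2 l" "D 1 (U Cy3) \<in> L2 l"
    "D 1 (U Comega) \<in> L2 l" "D 2 (U Comega) \<in> L2 l"
  by (rule sobolev0_weak_deriv_L2[OF X_H1(1)[OF assms]] sobolev0_weak_deriv_L2[OF X_H1(2)[OF assms]]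
      sobolev0_weak_deriv_L2[OF X_H1(3)[OF assms]] sobolev0_weak_deriv_L2[OF X_H1(4)[OF assms]]
      sobolev0_weak_deriv_L2[OF X_H1(6)[OF assms]]; simp)+

lemmas X_D_L2' [simp] = X_D_L2[unfolded One_nat_def]

lemma D_omega_H1: "U \<in> X \<Longrightarrow> D 1 (U Comega) \<in> sobolev0 l 1"
  using weak_deriv_sobolev0[OF pos(1), of "U Comega" 1 1] X_H1(6)[of U] by (simp add: numeral_2_eq_2)

lemma shear_H1:
  assumes "U \<in> X" "U i \<in> sobolev0 l 1"
  shows "shear p i U \<in> sobolev0 l 1"
  unfolding shear_def by (intro sobolev0_add pos D_omega_H1 assms)

lemma tau_H1:
  assumes "U \<in> X" shows "tau p U \<in> sobolev0 l 1"
  unfolding tau_def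
  by (intro sobolev0_add sobolev0_diff sobolev0_scaleR sobolev0_minus pos D_omega_H1 X_H1 assms)

lemma stress_L2 [simp]:
  assumes "U \<in> X"
  shows "shear p Cy1 U \<in> L2 l" "shear p Cy3 U \<in> L2 l" "tau p U \<in> L2 l"
  using assms by (auto intro!: sobolev0_L2[OF pos(1)] shear_H1 tau_H1 X_H1)

lemma D_comb:
  assumes "f \<in> sobolev0 l k" "g \<in> sobolev0 l k" "j \<le> k"
  shows "eqv l (D j (\<lambda>x. a *\<^sub>R f x + b *\<^sub>R g x)) (\<lambda>x. a *\<^sub>R D j f x + b *\<^sub>R D j g x)"
  by (intro weak_deriv_eqv has_weak_deriv_add has_weak_deriv_scaleR pos
      sobolev0_wd[OF assms(1,3)] sobolev0_wd[OF assms(2,3)])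

lemma X_comb: "U \<in> X \<Longrightarrow> V \<in> X \<Longrightarrow> comb a U b V \<in> X"
  by (auto simp: X_iff comb_def intro!: sobolev0_lin pos)

lemma shear_comb:
  assumes "U \<in> X" "V \<in> X"
  shows "eqv l (shear p i (comb a U b V)) (\<lambda>x. a *\<^sub>R shear p i U x + b *\<^sub>R shear p i V x)"
proof -
  have "eqv l (\<lambda>x. D 1 (comb a U b V Comega) x + comb a U b V i x)
    (\<lambda>x. (a *\<^sub>R D 1 (U Comega) x + b *\<^sub>R D 1 (V Comega) x) + comb a U b V i x)"
    unfolding comb_def using assms X_H1
    by (intro eqv_add D_comb[of _ 1] eqv_refl L2_add L2_scaleR) auto
  moreover have "(\<lambda>x. (a *\<^sub>R D 1 (U Comega) x + b *\<^sub>R D 1 (V Comega) x) + comb a U b V i x)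
     = (\<lambda>x. a *\<^sub>R shear p i U x + b *\<^sub>R shear p i V x)"
    by (simp add: shear_def comb_def algebra_simps)
  ultimately show ?thesis by (simp only: shear_def)
qed

lemma tau_comb:
  assumes "U \<in> X" "V \<in> X"
  shows "eqv l (tau p (comb a U b V)) (\<lambda>x. a *\<^sub>R tau p U x + b *\<^sub>R tau p V x)"
proof -
  let ?W = "comb a U b V"
  have W: "?W \<in> X" using assms by (rule X_comb)
  have "eqv l (\<lambda>x. - ?W Cu1 x + ?W Cu3 x + h2 p *\<^sub>R D 1 (?W Comega) x - (h1 p / 2) *\<^sub>R ?W Cy1 x - (h3 p / 2) *\<^sub>R ?W Cy3 x)
    (\<lambda>x. - ?W Cu1 x + ?W Cu3 x + h2 p *\<^sub>R (a *\<^sub>R D 1 (U Comega) x + b *\<^sub>R D 1 (V Comega) x) - (h1 p / 2) *\<^sub>R ?W Cy1 x - (h3 p / 2) *\<^sub>R ?W Cy3 x)"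
    using D_comb[OF X_H1(5)[OF assms(1)] X_H1(5)[OF assms(2)], of 1 a b] assms
    by (intro eqv_add eqv_diff eqv_scaleR eqv_refl L2_add L2_scaleR L2_minus) (auto simp: comb_def)
  moreover have "(\<lambda>x. - ?W Cu1 x + ?W Cu3 x + h2 p *\<^sub>R (a *\<^sub>R D 1 (U Comega) x + b *\<^sub>R D 1 (V Comega) x) - (h1 p / 2) *\<^sub>R ?W Cy1 x - (h3 p / 2) *\<^sub>R ?W Cy3 x)
     = (\<lambda>x. a *\<^sub>R tau p U x + b *\<^sub>R tau p V x)"
    by (simp add: tau_def comb_def algebra_simps)
  ultimately show ?thesis by (simp only: tau_def)
qed

lemma ip_eqv_comb:
  "eqv L f (\<lambda>x. a *\<^sub>R g x + b *\<^sub>R h x) \<Longrightarrow> g \<in> L2 L \<Longrightarrow> h \<in> L2 L \<Longrightarrow> k \<in> L2 L \<Longrightarrow>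
    ip L f k = a * ip L g k + b * ip L h k"
  by (simp add: eqv_ip(1))

lemma eform_comb:
  assumes U: "U \<in> X" and V: "V \<in> X" and W: "W \<in> X"
  shows "eform p (comb a U b V) W = a * eform p U W + b * eform p V W"
proof -
  have d: "ip l (D j (comb a U b V i)) (D j (W i)) = a * ip l (D j (U i)) (D j (W i)) + b * ip l (D j (V i)) (D j (W i))"
    if j: "j \<le> order_of i" for i j
  proof -
    have s: "U i \<in> sobolev0 l (order_of i)" "V i \<in> sobolev0 l (order_of i)" "W i \<in> sobolev0 l (order_of i)"
      using U V W by (auto simp: X_iff)
    show ?thesis
      unfolding comb_def
      by (intro ip_eqv_comb D_comb[OF s(1,2) j] sobolev0_weak_deriv_L2[OF s(1) j]
          sobolev0_weak_deriv_L2[OF s(2) j] sobolev0_weak_deriv_L2[OF s(3) j])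
  qed
  have v: "ip l (comb a U b V i) (W i) = a * ip l (U i) (W i) + b * ip l (V i) (W i)" for i
    using U V W by (simp add: comb_def)
  have s: "ip l (shear p i (comb a U b V)) (shear p i W) = a * ip l (shear p i U) (shear p i W) + b * ip l (shear p i V) (shear p i W)"
    if "i = Cy1 \<or> i = Cy3" for i
    using that U V W by (intro ip_eqv_comb shear_comb) auto
  have t: "ip l (tau p (comb a U b V)) (tau p W) = a * ip l (tau p U) (tau p W) + b * ip l (tau p V) (tau p W)"
    using U V W by (intro ip_eqv_comb tau_comb) auto
  show ?thesis
    using d[of 1 Cu1] d[of 1 Cu3] d[of 1 Cy1] d[of 1 Cy3] d[of 2 Comega] s[of Cy1] s[of Cy3]
    unfolding eform_def Let_def v t by (simp add: algebra_simps)
qed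

lemma eform_commute: "eform p U V = eform p V U"
  by (simp add: eform_def Let_def ip_commute[of l])

lemma eform_nonneg: "eform p U U \<ge> 0"
  unfolding eform_def Let_def using pos by (intro add_nonneg_nonneg mult_nonneg_nonneg) auto

lemma N_eform: "N U = sqrt (eform p U U)"
  by (simp add: energy_norm_def eform_def Let_def ip_self)

lemma N_sq: "(N U)\<^sup>2 = eform p U U"
  by (simp add: N_eform eform_nonneg)

definition controlled :: "real \<Rightarrow> state \<Rightarrow> bool" where
  "controlled c U \<longleftrightarrow> (\<forall>i. nrm (U i) \<le> c) \<and> nrm (D 1 (U Cu1)) \<le> c
    \<and> nrm (D 1 (U Cy1)) \<le> c \<and> nrm (D 1 (U Cu3)) \<le> c \<and> nrm (D 1 (U Cy3)) \<le> c
    \<and> nrm (D 1 (U Comega)) \<le> c \<and> nrm (D 2 (U Comega)) \<le> c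
    \<and> nrm (shear p Cy1 U) \<le> c \<and> nrm (shear p Cy3 U) \<le> c \<and> nrm (tau p U) \<le> c"

text \<open>Coercivity. Of the displacements themselves the energy contains only the highest
  derivatives; the lower ones follow from the Poincare inequality, which applies twice to omega
  since omega_x vanishes at the end points as well.\<close>

lemma energy_bounds:
  "\<exists>K\<ge>0. \<forall>U\<in>X. controlled (K * N U) U"
proof -
  define cs where "cs = {E1 p * h1 p, rho1 p * h1 p, E3 p * h3 p, rho3 p * h3 p, EI p, rho_h p,
    E1 p * I1 p, rho1 p * I1 p, E3 p * I3 p, rho3 p * I3 p, G1 p * h1 p, 1, G3 p * h3 p}"
  define c where "c = Min cs"
  have fin: "finite cs" "cs \<noteq> {}" by (auto simp: cs_def)
  have cpos: "c > 0" unfolding c_def using fin pos by (subst Min_gr_iff) (auto simp: cs_def)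
  have cle: "c \<le> d" if "d \<in> cs" for d unfolding c_def using fin that by simp
  define K0 where "K0 = 1 / sqrt c"
  have K0: "K0 > 0" using cpos by (simp add: K0_def)
  \<comment> \<open>The summands 1, l and l * l stand for no, one and two uses of the Poincare
    inequality.\<close>
  define K where "K = K0 * (1 + l + l * l)"
  have K: "K0 \<le> K" "K0 * l \<le> K" "K0 * l * l \<le> K"
    using K0 pos(1) by (auto simp: K_def algebra_simps)
  have "K \<ge> 0" using K K0 by linarith
  moreover have "controlled (K * N U) U"
    if U: "U \<in> X" for U
  proof -
    have N0: "N U \<ge> 0" by (simp add: N_eform eform_nonneg)
    have basic: "nrm f \<le> K0 * N U" if "c * (nrm f)\<^sup>2 \<le> (N U)\<^sup>2" for f
    proof -
      have "nrm f = sqrt (c * (nrm f)\<^sup>2) / sqrt c"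
        using cpos by (simp add: real_sqrt_mult)
      also have "\<dots> \<le> sqrt ((N U)\<^sup>2) / sqrt c"
        using that cpos by (intro divide_right_mono real_sqrt_le_mono) auto
      finally show ?thesis using N0 by (simp add: K0_def)
    qed
    define q where "q d f = d * (nrm f)\<^sup>2" for d f
    have q0: "q d f \<ge> 0" if "d \<in> cs" for d f
      using cle[OF that] cpos by (simp add: q_def)
    have qc: "nrm f \<le> K0 * N U" if "q d f \<le> (N U)\<^sup>2" "d \<in> cs" for d f
      using that cle[OF that(2)] mult_right_mono[OF cle[OF that(2)], of "(nrm f)\<^sup>2"]
      by (intro basic) (auto simp: q_def)
    have e: "(N U)\<^sup>2 = q (E1 p * h1 p) (D 1 (U Cu1)) + q (rho1 p * h1 p) (U Cv1)
     + q (E3 p * h3 p) (D 1 (U Cu3)) + q (rho3 p * h3 p) (U Cv3) + q (EI p) (D 2 (U Comega)) + q (rho_h p) (U Cpsi)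
     + q (E1 p * I1 p) (D 1 (U Cy1)) + q (rho1 p * I1 p) (U Cz1) + q (E3 p * I3 p) (D 1 (U Cy3)) + q (rho3 p * I3 p) (U Cz3)
     + q (G1 p * h1 p) (shear p Cy1 U) + q 1 (tau p U) + q (G3 p * h3 p) (shear p Cy3 U)"
      by (simp add: N_sq eform_def Let_def ip_self q_def)
    have mem: "E1 p * h1 p \<in> cs" "rho1 p * h1 p \<in> cs" "E3 p * h3 p \<in> cs" "rho3 p * h3 p \<in> cs" "EI p \<in> cs" "rho_h p \<in> cs"
      "E1 p * I1 p \<in> cs" "rho1 p * I1 p \<in> cs" "E3 p * I3 p \<in> cs" "rho3 p * I3 p \<in> cs" "G1 p * h1 p \<in> cs" "1 \<in> cs" "G3 p * h3 p \<in> cs"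
      by (auto simp: cs_def)
    note z = q0[OF mem(1), of "D 1 (U Cu1)"]
      q0[OF mem(2), of "U Cv1"]
      q0[OF mem(3), of "D 1 (U Cu3)"]
      q0[OF mem(4), of "U Cv3"]
      q0[OF mem(5), of "D 2 (U Comega)"]
      q0[OF mem(6), of "U Cpsi"]
      q0[OF mem(7), of "D 1 (U Cy1)"]
      q0[OF mem(8), of "U Cz1"]
      q0[OF mem(9), of "D 1 (U Cy3)"]
      q0[OF mem(10), of "U Cz3"]
      q0[OF mem(11), of "shear p Cy1 U"]
      q0[OF mem(12), of "tau p U"]
      q0[OF mem(13), of "shear p Cy3 U"]
    have le: "q (E1 p * h1 p) (D 1 (U Cu1)) \<le> (N U)\<^sup>2"
      "q (rho1 p * h1 p) (U Cv1) \<le> (N U)\<^sup>2"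
      "q (E3 p * h3 p) (D 1 (U Cu3)) \<le> (N U)\<^sup>2"
      "q (rho3 p * h3 p) (U Cv3) \<le> (N U)\<^sup>2"
      "q (EI p) (D 2 (U Comega)) \<le> (N U)\<^sup>2"
      "q (rho_h p) (U Cpsi) \<le> (N U)\<^sup>2"
      "q (E1 p * I1 p) (D 1 (U Cy1)) \<le> (N U)\<^sup>2"
      "q (rho1 p * I1 p) (U Cz1) \<le> (N U)\<^sup>2"
      "q (E3 p * I3 p) (D 1 (U Cy3)) \<le> (N U)\<^sup>2"
      "q (rho3 p * I3 p) (U Cz3) \<le> (N U)\<^sup>2"
      "q (G1 p * h1 p) (shear p Cy1 U) \<le> (N U)\<^sup>2"
      "q (1) (tau p U) \<le> (N U)\<^sup>2"
      "q (G3 p * h3 p) (shear p Cy3 U) \<le> (N U)\<^sup>2"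
      unfolding e using z by linarith+
    note b = qc[OF le(1) mem(1)] qc[OF le(2) mem(2)] qc[OF le(3) mem(3)] qc[OF le(4) mem(4)] qc[OF le(5) mem(5)] qc[OF le(6) mem(6)] qc[OF le(7) mem(7)] qc[OF le(8) mem(8)] qc[OF le(9) mem(9)] qc[OF le(10) mem(10)] qc[OF le(11) mem(11)] qc[OF le(12) mem(12)] qc[OF le(13) mem(13)]
    have lift: "x \<le> K * N U" if "x \<le> K0 * N U" for x
      using that mult_right_mono[OF K(1) N0] by linarith
    have lift1: "x \<le> K * N U" if "x \<le> l * y" "y \<le> K0 * N U" for x y
      using that(1) mult_left_mono[OF that(2) less_imp_le[OF pos(1)]] mult_right_mono[OF K(2) N0]
      by (simp add: algebra_simps)
    have lift2: "x \<le> K * N U" if "x \<le> l * y" "y \<le> l * z" "z \<le> K0 * N U" for x y z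
    proof -
      have "l * y \<le> l * (l * (K0 * N U))"
        using that pos(1) by (intro mult_left_mono order_trans[OF that(2)]) auto
      also have "\<dots> \<le> K * N U"
        using mult_right_mono[OF K(3) N0] by (simp add: algebra_simps)
      finally show ?thesis using that(1) by simp
    qed
    have dd: "nrm (D 1 (D 1 (U Comega))) = nrm (D 2 (U Comega))"
      using weak_deriv_chain_eqv[OF pos(1) sobolev0_sobolev[OF X_H1(6)[OF U]], of 1 1]
      by (intro eqv_norm weak_deriv_eqv pos) (simp add: numeral_2_eq_2)
    have po: "nrm (U Cu1) \<le> l * nrm (D 1 (U Cu1))" "nrm (U Cy1) \<le> l * nrm (D 1 (U Cy1))"
      "nrm (U Cu3) \<le> l * nrm (D 1 (U Cu3))" "nrm (U Cy3) \<le> l * nrm (D 1 (U Cy3))"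
      "nrm (U Comega) \<le> l * nrm (D 1 (U Comega))" "nrm (D 1 (U Comega)) \<le> l * nrm (D 2 (U Comega))"
      using poincare[OF pos(1) X_H1(1)[OF U]] poincare[OF pos(1) X_H1(2)[OF U]] poincare[OF pos(1) X_H1(3)[OF U]]
        poincare[OF pos(1) X_H1(4)[OF U]] poincare[OF pos(1) X_H1(5)[OF U]]
        poincare[OF pos(1) D_omega_H1[OF U]] dd by simp_all
    have "nrm (U i) \<le> K * N U" for i
    proof (cases i)
      case Cu1 then show ?thesis using lift1[OF po(1) b(1)] by simp
    next
      case Cy1 then show ?thesis using lift1[OF po(2) b(7)] by simp
    next
      case Cu3 then show ?thesis using lift1[OF po(3) b(3)] by simp
    next
      case Cy3 then show ?thesis using lift1[OF po(4) b(9)] by simp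
    next
      case Comega then show ?thesis using lift2[OF po(5) po(6) b(5)] by simp
    qed (use b lift in simp_all)
    then show ?thesis
      using b[THEN lift] lift1[OF po(6) b(5)] unfolding controlled_def by blast
  qed
  ultimately show ?thesis by blast
qed

section \<open>The operator in weak form\<close>

lemma dom_D_L2:
  assumes U: "U \<in> dom_A p"
  shows "D 2 (U Cu1) \<in> L2 l" "D 2 (U Cy1) \<in> L2 l" "D 2 (U Cu3) \<in> L2 l" "D 2 (U Cy3) \<in> L2 l"
    "D 4 (U Comega) \<in> L2 l" "D 1 (shear p Cy1 U) \<in> L2 l" "D 1 (shear p Cy3 U) \<in> L2 l" "D 1 (tau p U) \<in> L2 l"
proof -
  show "D 2 (U Cu1) \<in> L2 l" "D 2 (U Cy1) \<in> L2 l" "D 2 (U Cu3) \<in> L2 l" "D 2 (U Cy3) \<in> L2 l"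
    "D 4 (U Comega) \<in> L2 l"
    using U by (auto simp: dom_A_def intro: has_weak_deriv_L2(2) sobolevD)
  show "D 1 (shear p Cy1 U) \<in> L2 l" "D 1 (shear p Cy3 U) \<in> L2 l" "D 1 (tau p U) \<in> L2 l"
    using dom_X[OF U] X_H1[OF dom_X[OF U]]
    by (auto intro!: sobolev0_weak_deriv_L2[where k = 1] shear_H1 tau_H1)
qed

lemma op_A_X:
  assumes U: "U \<in> dom_A p"
  shows "op_A p U \<in> X"
proof -
  note [simp] = dom_X[OF U] dom_D_L2[OF U] dom_D_L2[OF U, unfolded One_nat_def]
  show ?thesis
    using dom_H1[OF U] unfolding energy_space_def by (auto simp: op_A_def Let_def)
qed

section \<open>Integration by parts and the weak form of the five equations\<close>

lemma ip_second_deriv: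
  assumes "f \<in> sobolev l 2" "\<xi> \<in> sobolev0 l 1"
  shows "ip l (D 2 f) \<xi> = - ip l (D 1 f) (D 1 \<xi>)"
  using weak_deriv_chain_eqv[OF pos(1) assms(1), of 1 1] assms(2)
  by (intro ip_weak_deriv1 pos) (auto simp: numeral_2_eq_2)

lemma ip_first_deriv:
  assumes "f \<in> sobolev0 l 1" "\<xi> \<in> sobolev0 l 1"
  shows "ip l (D 1 f) \<xi> = - ip l f (D 1 \<xi>)"
  using assms by (intro ip_weak_deriv1 pos sobolev0_wd) auto

lemma ip_fourth_deriv:
  assumes "f \<in> sobolev l 4" "\<xi> \<in> sobolev0 l 2"
  shows "ip l (D 4 f) \<xi> = ip l (D 2 f) (D 2 \<xi>)"
  using weak_deriv_chain_eqv[OF pos(1) assms(1), of 2 2] assms(2)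
  by (intro ip_weak_deriv2 pos) auto

lemma weak_form_u1:
  assumes U: "U \<in> dom_A p" and \<xi>: "\<xi> \<in> sobolev0 l 1"
  shows "rho1 p * h1 p * ip l (op_A p U Cv1) \<xi> =
    - (E1 p * h1 p * ip l (D 1 (U Cu1)) (D 1 \<xi>)) + ip l (tau p U) \<xi> - damp_a p * ip l (U Cv1) \<xi>"
proof -
  note [simp] = dom_X[OF U] dom_D_L2[OF U] sobolev0_L2[OF pos(1) \<xi>]
  have "ip l (D 2 (U Cu1)) \<xi> = - ip l (D 1 (U Cu1)) (D 1 \<xi>)"
    using U \<xi> by (intro ip_second_deriv) (auto simp: dom_A_def)
  then show ?thesis using pos by (simp add: op_A_def Let_def)
qed

lemma weak_form_u3:
  assumes U: "U \<in> dom_A p" and \<xi>: "\<xi> \<in> sobolev0 l 1"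
  shows "rho3 p * h3 p * ip l (op_A p U Cv3) \<xi> =
    - (E3 p * h3 p * ip l (D 1 (U Cu3)) (D 1 \<xi>)) - ip l (tau p U) \<xi> - damp_d p * ip l (U Cv3) \<xi>"
proof -
  note [simp] = dom_X[OF U] dom_D_L2[OF U] sobolev0_L2[OF pos(1) \<xi>]
  have "ip l (D 2 (U Cu3)) \<xi> = - ip l (D 1 (U Cu3)) (D 1 \<xi>)"
    using U \<xi> by (intro ip_second_deriv) (auto simp: dom_A_def)
  then show ?thesis using pos by (simp add: op_A_def Let_def)
qed

lemma weak_form_y1:
  assumes U: "U \<in> dom_A p" and \<xi>: "\<xi> \<in> sobolev0 l 1"
  shows "rho1 p * I1 p * ip l (op_A p U Cz1) \<xi> =
    - (E1 p * I1 p * ip l (D 1 (U Cy1)) (D 1 \<xi>)) + h1 p / 2 * ip l (tau p U) \<xi>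
    - G1 p * h1 p * ip l (shear p Cy1 U) \<xi> - damp_b p * ip l (U Cz1) \<xi>"
proof -
  note [simp] = dom_X[OF U] dom_D_L2[OF U] sobolev0_L2[OF pos(1) \<xi>]
  have "ip l (D 2 (U Cy1)) \<xi> = - ip l (D 1 (U Cy1)) (D 1 \<xi>)"
    using U \<xi> by (intro ip_second_deriv) (auto simp: dom_A_def)
  then show ?thesis using pos by (simp add: op_A_def Let_def)
qed

lemma weak_form_y3:
  assumes U: "U \<in> dom_A p" and \<xi>: "\<xi> \<in> sobolev0 l 1"
  shows "rho3 p * I3 p * ip l (op_A p U Cz3) \<xi> =
    - (E3 p * I3 p * ip l (D 1 (U Cy3)) (D 1 \<xi>)) + h3 p / 2 * ip l (tau p U) \<xi>
    - G3 p * h3 p * ip l (shear p Cy3 U) \<xi> - damp_e p * ip l (U Cz3) \<xi>"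
proof -
  note [simp] = dom_X[OF U] dom_D_L2[OF U] sobolev0_L2[OF pos(1) \<xi>]
  have "ip l (D 2 (U Cy3)) \<xi> = - ip l (D 1 (U Cy3)) (D 1 \<xi>)"
    using U \<xi> by (intro ip_second_deriv) (auto simp: dom_A_def)
  then show ?thesis using pos by (simp add: op_A_def Let_def)
qed

text \<open>The coupling forces enter the plate equation as first derivatives, so integrating by
  parts leaves them paired with the derivative of \<open>\<xi>\<close>. Halving the fourth
  derivative takes \<open>\<xi>\<close> in H^2_0.\<close>

lemma weak_form_omega:
  assumes U: "U \<in> dom_A p" and \<xi>: "\<xi> \<in> sobolev0 l 2"
  shows "rho_h p * ip l (op_A p U Cpsi) \<xi> =
    - (EI p * ip l (D 2 (U Comega)) (D 2 \<xi>)) - G1 p * h1 p * ip l (shear p Cy1 U) (D 1 \<xi>)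
    - G3 p * h3 p * ip l (shear p Cy3 U) (D 1 \<xi>) - h2 p * ip l (tau p U) (D 1 \<xi>) - damp_c p * ip l (U Cpsi) \<xi>"
proof -
  note [simp] = dom_X[OF U] dom_D_L2[OF U] dom_D_L2[OF U, unfolded One_nat_def] sobolev0_L2[OF pos(1) \<xi>]
  have \<xi>1: "\<xi> \<in> sobolev0 l 1" using sobolev0_mono[OF pos(1) \<xi>] by simp
  have 1: "ip l (D 4 (U Comega)) \<xi> = ip l (D 2 (U Comega)) (D 2 \<xi>)"
    using U \<xi> by (intro ip_fourth_deriv) (auto simp: dom_A_def)
  have 2: "ip l (D 1 (shear p Cy1 U)) \<xi> = - ip l (shear p Cy1 U) (D 1 \<xi>)"
    "ip l (D 1 (shear p Cy3 U)) \<xi> = - ip l (shear p Cy3 U) (D 1 \<xi>)"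
    "ip l (D 1 (tau p U)) \<xi> = - ip l (tau p U) (D 1 \<xi>)"
    using X_H1[OF dom_X[OF U]] \<xi>1 by (auto intro!: ip_first_deriv[unfolded One_nat_def] shear_H1[unfolded One_nat_def] tau_H1[unfolded One_nat_def])
  show ?thesis using pos 1 2 by (simp add: op_A_def Let_def)
qed

text \<open>Each equation is tested with its own velocity, which satisfies the right boundary
  conditions on the domain. The elastic and coupling terms cancel against those of the form, and
  only the damping remains.\<close>

lemma dissipation:
  assumes U: "U \<in> dom_A p"
  shows "eform p U (op_A p U) = - (damp_a p * (nrm (U Cv1))\<^sup>2 + damp_b p * (nrm (U Cz1))\<^sup>2
    + damp_c p * (nrm (U Cpsi))\<^sup>2 + damp_d p * (nrm (U Cv3))\<^sup>2 + damp_e p * (nrm (U Cz3))\<^sup>2)"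
proof -
  let ?V = "op_A p U"
  note [simp] = dom_X[OF U] op_A_X[OF U]
  have psi [simp]: "D 1 (U Cpsi) \<in> L2 l" "D (Suc 0) (U Cpsi) \<in> L2 l"
    using sobolev0_weak_deriv_L2[OF dom_H1(6)[OF U], of 1] by auto
  have c: "?V Cu1 = U Cv1" "?V Cy1 = U Cz1" "?V Cu3 = U Cv3" "?V Cy3 = U Cz3" "?V Comega = U Cpsi"
    by (simp_all add: op_A_def Let_def)
  have s: "shear p i ?V = (\<lambda>x. D 1 (U Cpsi) x + ?V i x)" for i
    by (simp add: shear_def c)
  have t: "tau p ?V = (\<lambda>x. - U Cv1 x + U Cv3 x + h2 p *\<^sub>R D 1 (U Cpsi) x - (h1 p / 2) *\<^sub>R U Cz1 x - (h3 p / 2) *\<^sub>R U Cz3 x)"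
    by (simp add: tau_def c)
  have st: "ip l (shear p Cy1 U) (shear p Cy1 ?V) = ip l (shear p Cy1 U) (D 1 (U Cpsi)) + ip l (shear p Cy1 U) (U Cz1)"
    "ip l (shear p Cy3 U) (shear p Cy3 ?V) = ip l (shear p Cy3 U) (D 1 (U Cpsi)) + ip l (shear p Cy3 U) (U Cz3)"
    "ip l (tau p U) (tau p ?V) = - ip l (tau p U) (U Cv1) + ip l (tau p U) (U Cv3) + h2 p * ip l (tau p U) (D 1 (U Cpsi))
      - h1 p / 2 * ip l (tau p U) (U Cz1) - h3 p / 2 * ip l (tau p U) (U Cz3)"
    unfolding s t c by simp_all
  show ?thesis
    using weak_form_u1[OF U dom_H1(1)[OF U]] weak_form_y1[OF U dom_H1(2)[OF U]]
      weak_form_u3[OF U dom_H1(3)[OF U]] weak_form_y3[OF U dom_H1(4)[OF U]] weak_form_omega[OF U dom_H1(5)[OF U]]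
    unfolding eform_def Let_def st c ip_self[symmetric] distrib_left right_diff_distrib
      ip_commute[of l _ "?V Cv1"] ip_commute[of l _ "?V Cz1"] ip_commute[of l _ "?V Cv3"]
      ip_commute[of l _ "?V Cz3"] ip_commute[of l _ "?V Cpsi"]
    by (simp add: algebra_simps)
qed

end

section \<open>Smooth states\<close>

text \<open>Weak derivatives are arbitrary representatives, so the operator turns test functions
  into test functions only up to equality in L^2. This weaker notion is stable under it.\<close>

definition test_like :: "real \<Rightarrow> (real \<Rightarrow> complex) \<Rightarrow> bool" where
  "test_like L f \<longleftrightarrow> (\<exists>\<phi>\<in>test_functions L. eqv L f \<phi>)"

lemma test_like_add:
  assumes "L > 0" "test_like L f" "test_like L g" shows "test_like L (\<lambda>x. f x + g x)"
proof -
  obtain \<phi> \<psi> where *: "\<phi> \<in> test_functions L" "\<psi> \<in> test_functions L" "eqv L f \<phi>" "eqv L g \<psi>"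
    using assms by (auto simp: test_like_def)
  have "(\<lambda>x. \<phi> x + \<psi> x) \<in> test_functions L"
    using test_lin[OF *(1,2) assms(1), of 1 1] by simp
  then show ?thesis
    using eqv_add[OF *(3,4)] by (auto simp: test_like_def)
qed

lemma test_like_scaleR:
  assumes "L > 0" "test_like L f" shows "test_like L (\<lambda>x. (c::real) *\<^sub>R f x)"
proof -
  obtain \<phi> where *: "\<phi> \<in> test_functions L" "eqv L f \<phi>"
    using assms by (auto simp: test_like_def)
  have "(\<lambda>x. c *\<^sub>R \<phi> x) \<in> test_functions L"
    using test_lin[OF *(1,1) assms(1), of "of_real c" 0] by (simp add: scaleR_conv_of_real)
  then show ?thesis
    using eqv_scaleR[OF *(2)] by (auto simp: test_like_def)
qed

lemma test_like_minus: "L > 0 \<Longrightarrow> test_like L f \<Longrightarrow> test_like L (\<lambda>x. - f x)"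
  using test_like_scaleR[of L f "-1"] by simp

lemma test_like_diff:
  "L > 0 \<Longrightarrow> test_like L f \<Longrightarrow> test_like L g \<Longrightarrow> test_like L (\<lambda>x. f x - g x)"
  using test_like_add[of L f "\<lambda>x. - g x"] test_like_minus[of L g] by simp

lemma test_like_weak_deriv:
  assumes "L > 0" "test_like L f" shows "test_like L (weak_deriv L j f)"
proof -
  obtain \<phi> where *: "\<phi> \<in> test_functions L" "eqv L f \<phi>"
    using assms by (auto simp: test_like_def)
  have "nth_deriv j \<phi> \<in> test_functions L" using *(1) assms(1) by (rule test_nth_deriv)
  moreover have "has_weak_deriv L j f (nth_deriv j \<phi>)"
    by (rule has_weak_deriv_eqv[OF assms(1) has_weak_deriv_test[OF assms(1) *(1)] eqv_sym[OF *(2)] eqv_refl])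
       (rule test_L2, fact)
  ultimately show ?thesis
    using weak_deriv_eqv[OF assms(1)] by (auto simp: test_like_def)
qed

lemma test_like_sobolev0:
  assumes "L > 0" "test_like L f" shows "f \<in> sobolev0 L k"
proof -
  obtain \<phi> where *: "\<phi> \<in> test_functions L" "eqv L f \<phi>"
    using assms by (auto simp: test_like_def)
  show ?thesis
    by (rule sobolev0_eqv[OF assms(1) test_sobolev0[OF assms(1) *(1)] eqv_sym[OF *(2)]])
qed

definition smooth_states :: "beam \<Rightarrow> state set" where
  "smooth_states p = {U. \<forall>i. test_like (len p) (U i)}"

section \<open>Functions of time that are small or bounded in \<open>L2\<close>\<close>

text \<open>The filter is arbitrary because the calculus serves both \<open>at_top\<close> for
  trajectories and \<open>sequentially\<close> for approximations. Membership is only eventual,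
  since trajectories are controlled for t \<ge> 0 alone.\<close>

definition small :: "real \<Rightarrow> 'a filter \<Rightarrow> ('a \<Rightarrow> real \<Rightarrow> complex) \<Rightarrow> bool" where
  "small L F f \<longleftrightarrow> (\<forall>\<^sub>F t in F. f t \<in> L2 L) \<and> ((\<lambda>t. L2_norm L (f t)) \<longlongrightarrow> 0) F"

definition bnd :: "real \<Rightarrow> 'a filter \<Rightarrow> ('a \<Rightarrow> real \<Rightarrow> complex) \<Rightarrow> bool" where
  "bnd L F f \<longleftrightarrow> (\<exists>M. \<forall>\<^sub>F t in F. f t \<in> L2 L \<and> L2_norm L (f t) \<le> M)"

definition bnd_H1 :: "real \<Rightarrow> 'a filter \<Rightarrow> ('a \<Rightarrow> real \<Rightarrow> complex) \<Rightarrow> bool" where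
  "bnd_H1 L F f \<longleftrightarrow> (\<forall>\<^sub>F t in F. f t \<in> sobolev0 L 1) \<and> bnd L F f \<and> bnd L F (\<lambda>t. weak_deriv L 1 (f t))"

lemma small_by_bound:
  assumes "\<forall>\<^sub>F t in F. g t \<in> L2 L \<and> L2_norm L (g t) \<le> r t" "(r \<longlongrightarrow> 0) F"
  shows "small L F g"
  unfolding small_def
proof
  show "\<forall>\<^sub>F t in F. g t \<in> L2 L" using assms(1) by eventually_elim simp
  show "((\<lambda>t. L2_norm L (g t)) \<longlongrightarrow> 0) F"
    by (rule Lim_null_comparison[OF _ assms(2)]) (use assms(1) in eventually_elim, simp)
qed

lemma small_lin:
  assumes "small L F f" "small L F g"
  shows "small L F (\<lambda>t x. (a::real) *\<^sub>R f t x + (b::real) *\<^sub>R g t x)"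
proof (rule small_by_bound)
  show "((\<lambda>t. \<bar>a\<bar> * L2_norm L (f t) + \<bar>b\<bar> * L2_norm L (g t)) \<longlongrightarrow> 0) F"
    using assms unfolding small_def by (auto intro!: tendsto_eq_intros)
  have "\<forall>\<^sub>F t in F. f t \<in> L2 L" "\<forall>\<^sub>F t in F. g t \<in> L2 L"
    using assms by (auto simp: small_def)
  then show "\<forall>\<^sub>F t in F. (\<lambda>x. a *\<^sub>R f t x + b *\<^sub>R g t x) \<in> L2 L \<and>
    L2_norm L (\<lambda>x. a *\<^sub>R f t x + b *\<^sub>R g t x) \<le> \<bar>a\<bar> * L2_norm L (f t) + \<bar>b\<bar> * L2_norm L (g t)"
  proof eventually_elim
    case (elim t)
    then show ?case
      using L2_norm_add_le[of "\<lambda>x. a *\<^sub>R f t x" L "\<lambda>x. b *\<^sub>R g t x"] by simp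
  qed
qed

lemma small_eqv:
  assumes "small L F f" "\<forall>\<^sub>F t in F. eqv L (f t) (g t)"
  shows "small L F g"
proof (rule small_by_bound)
  show "\<forall>\<^sub>F t in F. g t \<in> L2 L \<and> L2_norm L (g t) \<le> L2_norm L (f t)"
    using assms(2) by eventually_elim (metis eqv_def eqv_norm order_refl)
qed (use assms in \<open>simp add: small_def\<close>)

lemma bnd_lin:
  assumes "bnd L F f" "bnd L F g"
  shows "bnd L F (\<lambda>t x. (a::real) *\<^sub>R f t x + (b::real) *\<^sub>R g t x)"
proof -
  obtain M M' where M: "\<forall>\<^sub>F t in F. f t \<in> L2 L \<and> L2_norm L (f t) \<le> M"
    "\<forall>\<^sub>F t in F. g t \<in> L2 L \<and> L2_norm L (g t) \<le> M'"
    using assms by (auto simp: bnd_def)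
  have "\<forall>\<^sub>F t in F. (\<lambda>x. a *\<^sub>R f t x + b *\<^sub>R g t x) \<in> L2 L \<and>
    L2_norm L (\<lambda>x. a *\<^sub>R f t x + b *\<^sub>R g t x) \<le> \<bar>a\<bar> * M + \<bar>b\<bar> * M'"
    using M
  proof eventually_elim
    case (elim t)
    then show ?case
      using L2_norm_add_le[of "\<lambda>x. a *\<^sub>R f t x" L "\<lambda>x. b *\<^sub>R g t x"]
        mult_left_mono[of "L2_norm L (f t)" M "\<bar>a\<bar>"] mult_left_mono[of "L2_norm L (g t)" M' "\<bar>b\<bar>"] by simp
  qed
  then show ?thesis by (auto simp: bnd_def)
qed

lemma bnd_eqv:
  assumes "bnd L F f" "\<forall>\<^sub>F t in F. eqv L (f t) (g t)"
  shows "bnd L F g"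
proof -
  obtain M where M: "\<forall>\<^sub>F t in F. f t \<in> L2 L \<and> L2_norm L (f t) \<le> M"
    using assms by (auto simp: bnd_def)
  have "\<forall>\<^sub>F t in F. g t \<in> L2 L \<and> L2_norm L (g t) \<le> M"
    using assms(2) M by eventually_elim (metis eqv_def eqv_norm)
  then show ?thesis by (auto simp: bnd_def)
qed

lemma bnd_H1_lin:
  assumes L: "L > 0" and "bnd_H1 L F f" "bnd_H1 L F g"
  shows "bnd_H1 L F (\<lambda>t x. (a::real) *\<^sub>R f t x + (b::real) *\<^sub>R g t x)"
  unfolding bnd_H1_def
proof (intro conjI)
  have ev: "\<forall>\<^sub>F t in F. f t \<in> sobolev0 L 1" "\<forall>\<^sub>F t in F. g t \<in> sobolev0 L 1"
    using assms by (auto simp: bnd_H1_def)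
  then show "\<forall>\<^sub>F t in F. (\<lambda>x. a *\<^sub>R f t x + b *\<^sub>R g t x) \<in> sobolev0 L 1"
    by eventually_elim (rule sobolev0_lin[OF L])
  show "bnd L F (\<lambda>t x. a *\<^sub>R f t x + b *\<^sub>R g t x)"
    using assms by (intro bnd_lin) (auto simp: bnd_H1_def)
  have "bnd L F (\<lambda>t x. a *\<^sub>R weak_deriv L 1 (f t) x + b *\<^sub>R weak_deriv L 1 (g t) x)"
    using assms(2,3) unfolding bnd_H1_def by (intro bnd_lin) blast+
  moreover have "\<forall>\<^sub>F t in F. eqv L (\<lambda>x. a *\<^sub>R weak_deriv L 1 (f t) x + b *\<^sub>R weak_deriv L 1 (g t) x)
    (weak_deriv L 1 (\<lambda>x. a *\<^sub>R f t x + b *\<^sub>R g t x))"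
    using ev
  proof eventually_elim
    case (elim t)
    then show ?case
      by (intro eqv_sym[OF weak_deriv_eqv] has_weak_deriv_add has_weak_deriv_scaleR sobolev0_wd[where k = 1] L) auto
  qed
  ultimately show "bnd L F (\<lambda>t. weak_deriv L 1 (\<lambda>x. a *\<^sub>R f t x + b *\<^sub>R g t x))"
    by (rule bnd_eqv)
qed

lemma ip_small:
  assumes "bnd L F f" "small L F g"
  shows "((\<lambda>t. ip L (f t) (g t)) \<longlongrightarrow> 0) F"
proof -
  obtain M where M: "\<forall>\<^sub>F t in F. f t \<in> L2 L \<and> L2_norm L (f t) \<le> M"
    using assms by (auto simp: bnd_def)
  have g: "\<forall>\<^sub>F t in F. g t \<in> L2 L" "((\<lambda>t. L2_norm L (g t)) \<longlongrightarrow> 0) F"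
    using assms by (auto simp: small_def)
  show ?thesis
  proof (rule Lim_null_comparison)
    show "\<forall>\<^sub>F t in F. norm (ip L (f t) (g t)) \<le> M * L2_norm L (g t)"
      using M g(1)
    proof eventually_elim
      case (elim t)
      then show ?case
        using ip_bound[of "f t" L "g t"] mult_right_mono[of "L2_norm L (f t)" M "L2_norm L (g t)"] by simp
    qed
    show "((\<lambda>t. M * L2_norm L (g t)) \<longlongrightarrow> 0) F"
      using g(2) by (auto intro!: tendsto_eq_intros)
  qed
qed

lemma ip_small': "small L F f \<Longrightarrow> bnd L F g \<Longrightarrow> ((\<lambda>t. ip L (f t) (g t)) \<longlongrightarrow> 0) F"
  using ip_small[of L F g f] by (simp add: ip_commute)

lemma small_if_ip:
  assumes "((\<lambda>t. ip L (f t) (f t)) \<longlongrightarrow> 0) F" "\<forall>\<^sub>F t in F. f t \<in> L2 L"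
  shows "small L F f"
  using tendsto_real_sqrt[OF assms(1)] assms(2) by (simp add: small_def L2_norm_ip)

lemma small_if_deriv_small:
  assumes L: "L > 0" and f: "\<forall>\<^sub>F t in F. f t \<in> sobolev0 L 1" and "small L F (\<lambda>t. weak_deriv L 1 (f t))"
  shows "small L F f"
proof (rule small_by_bound)
  show "\<forall>\<^sub>F t in F. f t \<in> L2 L \<and> L2_norm L (f t) \<le> L * L2_norm L (weak_deriv L 1 (f t))"
    using f by eventually_elim (use sobolev0_L2[OF L] poincare[OF L] in blast)
  show "((\<lambda>t. L * L2_norm L (weak_deriv L 1 (f t))) \<longlongrightarrow> 0) F"
    using assms(3) by (auto simp: small_def intro!: tendsto_eq_intros)
qed

lemma small_bnd: "small L F f \<Longrightarrow> bnd L F f"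
proof -
  assume f: "small L F f"
  then have "\<forall>\<^sub>F t in F. f t \<in> L2 L" "\<forall>\<^sub>F t in F. L2_norm L (f t) < 1"
    using order_tendstoD(2)[of "\<lambda>t. L2_norm L (f t)" 0 F 1] by (auto simp: small_def)
  then have "\<forall>\<^sub>F t in F. f t \<in> L2 L \<and> L2_norm L (f t) \<le> 1"
    by eventually_elim simp
  then show ?thesis by (auto simp: bnd_def)
qed

lemma small_nsq: "small L F f \<Longrightarrow> ((\<lambda>t. c * ip L (f t) (f t)) \<longlongrightarrow> 0) F"
  using tendsto_mult_left[OF ip_small[OF small_bnd], of L F f f c] by simp

context sandwich_beam
begin

section \<open>Invariance and density of the smooth states\<close>

lemma smooth_tau:
  assumes "U \<in> smooth_states p"
  shows "test_like l (tau p U)" "test_like l (shear p i U)"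
  using assms unfolding tau_def shear_def smooth_states_def
  by (auto intro!: test_like_add test_like_diff test_like_minus test_like_scaleR test_like_weak_deriv pos(1))

lemma smooth_dom:
  assumes "U \<in> smooth_states p"
  shows "U \<in> dom_A p"
  using assms test_like_sobolev0[OF pos(1)] sobolev0_sobolev
  unfolding dom_A_def smooth_states_def by blast

lemma smooth_op_A:
  assumes U: "U \<in> smooth_states p"
  shows "op_A p U \<in> smooth_states p"
proof -
  have c: "test_like l (U i)" for i using U by (simp add: smooth_states_def)
  note d = test_like_weak_deriv[OF pos(1)]
  have "test_like l (op_A p U i)" for i
    by (cases i)
       (auto simp: op_A_def Let_def intro!: c smooth_tau[OF U] d test_like_add test_like_diff test_like_minus
          test_like_scaleR pos(1))
  then show ?thesis by (simp add: smooth_states_def)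
qed

lemma N_tendsto_0:
  assumes X: "\<forall>\<^sub>F t in F. W t \<in> X"
    and "small l F (\<lambda>t. D 1 (W t Cu1))" "small l F (\<lambda>t. D 1 (W t Cu3))"
    "small l F (\<lambda>t. D 1 (W t Cy1))" "small l F (\<lambda>t. D 1 (W t Cy3))" "small l F (\<lambda>t. D 2 (W t Comega))"
    "small l F (\<lambda>t. W t Cv1)" "small l F (\<lambda>t. W t Cz1)" "small l F (\<lambda>t. W t Cpsi)"
    "small l F (\<lambda>t. W t Cv3)" "small l F (\<lambda>t. W t Cz3)"
    "small l F (\<lambda>t. shear p Cy1 (W t))" "small l F (\<lambda>t. shear p Cy3 (W t))" "small l F (\<lambda>t. tau p (W t))"
  shows "((\<lambda>t. N (W t)) \<longlongrightarrow> 0) F"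
proof -
  have "((\<lambda>t. eform p (W t) (W t)) \<longlongrightarrow> 0 + 0 + 0 + 0 + 0 + 0 + 0 + 0 + 0 + 0 + 0 + 0 + 0) F"
    unfolding eform_def Let_def
    using small_nsq[OF assms(14), of 1] by (intro tendsto_add small_nsq assms) simp
  from tendsto_real_sqrt[OF this] show ?thesis by (simp add: N_eform)
qed

lemma smooth_dense:
  assumes U: "U \<in> X" and e: "e > 0"
  shows "\<exists>V\<in>smooth_states p. N (U - V) < e"
proof -
  have "\<exists>\<phi>. (\<forall>n. \<phi> n \<in> test_functions l) \<and> (\<forall>j\<le>order_of i. (\<lambda>n. nrm (\<lambda>x. D j (U i) x - nth_deriv j (\<phi> n) x)) \<longlonglongrightarrow> 0)" for i
    using sobolev0_sequence[OF pos(1), of "U i" "order_of i"] U unfolding X_iff by metis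
  then obtain \<phi> where \<phi>: "\<And>i n. \<phi> i n \<in> test_functions l"
    "\<And>i j. j \<le> order_of i \<Longrightarrow> (\<lambda>n. nrm (\<lambda>x. D j (U i) x - nth_deriv j (\<phi> i n) x)) \<longlonglongrightarrow> 0"
    by metis
  define V where "V n i = \<phi> i n" for n i
  have VS: "V n \<in> smooth_states p" for n
    using \<phi>(1) by (auto simp: smooth_states_def test_like_def V_def intro!: bexI[of _ "\<phi> _ n"] eqv_refl)
  have VX: "V n \<in> X" for n using smooth_dom[OF VS] dom_X by blast
  let ?W = "\<lambda>n. U - V n"
  have WX: "?W n \<in> X" for n unfolding minus_comb by (intro X_comb U VX)
  have W: "?W n i = (\<lambda>x. U i x - \<phi> i n x)" for n i by (simp add: V_def fun_eq_iff)
  have d: "small l sequentially (\<lambda>n. D j (?W n i))" if j: "j \<le> order_of i" for i j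
  proof (rule small_eqv)
    have Ui: "U i \<in> sobolev0 l (order_of i)" using U by (simp add: X_iff)
    show "small l sequentially (\<lambda>n x. D j (U i) x - nth_deriv j (\<phi> i n) x)"
      using L2_diff[OF sobolev0_weak_deriv_L2[OF Ui j] test_L2[OF test_nth_deriv[OF \<phi>(1) pos(1)]]] \<phi>(2)[OF j]
      by (simp add: small_def)
    show "\<forall>\<^sub>F n in sequentially. eqv l (\<lambda>x. D j (U i) x - nth_deriv j (\<phi> i n) x) (D j (?W n i))"
      unfolding W using \<phi>(1)
      by (intro always_eventually allI eqv_sym[OF weak_deriv_eqv] has_weak_deriv_diff has_weak_deriv_test
          sobolev0_wd[OF Ui j] pos(1)) auto
  qed
  have z: "small l sequentially (\<lambda>n. ?W n i)" for i
  proof (rule small_eqv[OF d[of 0 i]])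
    show "\<forall>\<^sub>F n in sequentially. eqv l (D 0 (?W n i)) (?W n i)"
      by (intro always_eventually allI weak_deriv_eqv pos(1) has_weak_deriv_0 X_L2 WX)
  qed simp
  have "(\<lambda>n. N (?W n)) \<longlonglongrightarrow> 0"
  proof (rule N_tendsto_0)
    show "small l sequentially (\<lambda>n. D 1 (?W n Cu1))" "small l sequentially (\<lambda>n. D 1 (?W n Cu3))"
      "small l sequentially (\<lambda>n. D 1 (?W n Cy1))" "small l sequentially (\<lambda>n. D 1 (?W n Cy3))"
      "small l sequentially (\<lambda>n. D 2 (?W n Comega))" by (intro d; simp)+
    have o: "small l sequentially (\<lambda>n. D 1 (?W n Comega))" by (rule d) simp
    have sh: "small l sequentially (\<lambda>n. shear p i (?W n))" for i
      using small_lin[OF o z[of i], of 1 1] unfolding shear_def by simp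
    then show "small l sequentially (\<lambda>n. shear p Cy1 (?W n))" "small l sequentially (\<lambda>n. shear p Cy3 (?W n))"
      by blast+
    show "small l sequentially (\<lambda>n. tau p (?W n))"
      using small_lin[OF small_lin[OF small_lin[OF z[of Cu1] z[of Cu3], of "-1" 1]
        small_lin[OF o z[of Cy1], of "h2 p" "-(h1 p / 2)"], of 1 1] z[of Cy3], of 1 "-(h3 p / 2)"]
      unfolding tau_def by (simp add: algebra_simps)
  qed (use WX z in auto)
  then obtain n where "N (?W n) < e"
    using order_tendstoD(2)[of _ 0 sequentially e] e eventually_happens'[OF sequentially_bot] by blast
  then show ?thesis using VS by blast
qed

end

section \<open>Smooth trajectories\<close>

text \<open>\<open>Y k\<close> stands for the \<open>k\<close>-th time derivative of a smooth trajectory.\<close>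

locale smooth_trajectory = sandwich_beam +
  fixes Y :: "nat \<Rightarrow> real \<Rightarrow> state"
  assumes Y_dom: "\<And>k t. t \<ge> 0 \<Longrightarrow> Y k t \<in> dom_A p"
    and Y_step: "\<And>k t. t \<ge> 0 \<Longrightarrow> N (op_A p (Y k t) - Y (Suc k) t) = 0"
    and Y_bound: "\<And>k. \<exists>M. \<forall>t\<ge>0. N (Y k t) \<le> M"
    and Y_dissipation: "\<And>k. ((\<lambda>t. eform p (Y k t) (op_A p (Y k t))) \<longlongrightarrow> 0) at_top"
begin

abbreviation "sm \<equiv> small l (at_top :: real filter)"
abbreviation "bd \<equiv> bnd l (at_top :: real filter)"
abbreviation "bd1 \<equiv> bnd_H1 l (at_top :: real filter)"

lemma ev0: "(\<And>t. t \<ge> 0 \<Longrightarrow> P t) \<Longrightarrow> \<forall>\<^sub>F t in at_top. P (t::real)"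
  using eventually_ge_at_top[of 0] by (rule eventually_mono)

lemma Y_X [simp]: "t \<ge> 0 \<Longrightarrow> Y k t \<in> X"
  using Y_dom dom_X by blast

text \<open>By \<open>energy_bounds\<close> the energy norm controls every component in L^2, so
  states at distance 0 agree componentwise.\<close>

lemma Y_comp:
  assumes t: "t \<ge> 0"
  shows "eqv l (op_A p (Y k t) i) (Y (Suc k) t i)"
proof -
  obtain K where K: "\<And>U i. U \<in> X \<Longrightarrow> nrm (U i) \<le> K * N U"
    using energy_bounds unfolding controlled_def by blast
  have A: "op_A p (Y k t) \<in> X" using Y_dom[OF t] by (rule op_A_X)
  have "op_A p (Y k t) - Y (Suc k) t \<in> X"
    unfolding minus_comb using A t by (intro X_comb) auto
  from K[OF this, of i] have "nrm (\<lambda>x. op_A p (Y k t) i x - Y (Suc k) t i x) \<le> 0"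
    using Y_step[OF t] by (simp add: fun_diff_def)
  then show ?thesis
    using L2_norm_nonneg[of l "\<lambda>x. op_A p (Y k t) i x - Y (Suc k) t i x"] A t
    unfolding eqv_def by (simp del: L2_norm_nonneg)
qed

lemma Y_velocity:
  assumes "t \<ge> 0"
  shows "eqv l (Y k t Cv1) (Y (Suc k) t Cu1)" "eqv l (Y k t Cz1) (Y (Suc k) t Cy1)"
    "eqv l (Y k t Cpsi) (Y (Suc k) t Comega)" "eqv l (Y k t Cv3) (Y (Suc k) t Cu3)"
    "eqv l (Y k t Cz3) (Y (Suc k) t Cy3)"
  using Y_comp[OF assms, of k Cu1] Y_comp[OF assms, of k Cy1] Y_comp[OF assms, of k Comega]
    Y_comp[OF assms, of k Cu3] Y_comp[OF assms, of k Cy3]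
  by (simp_all add: op_A_def Let_def)

lemma Y_acceleration:
  assumes "t \<ge> 0"
  shows "eqv l (op_A p (Y k t) Cv1) (Y (Suc (Suc k)) t Cu1)" "eqv l (op_A p (Y k t) Cz1) (Y (Suc (Suc k)) t Cy1)"
    "eqv l (op_A p (Y k t) Cpsi) (Y (Suc (Suc k)) t Comega)" "eqv l (op_A p (Y k t) Cv3) (Y (Suc (Suc k)) t Cu3)"
    "eqv l (op_A p (Y k t) Cz3) (Y (Suc (Suc k)) t Cy3)"
  using Y_comp[OF assms, of k] Y_velocity[OF assms, of "Suc k"] by (blast intro: eqv_trans)+

text \<open>Factors such as \<open>1 *\<close> keep the right-hand side in the three-term form in
  which \<open>wave_limit\<close> and \<open>force_small\<close> take an equation.\<close>

lemma wave_u1: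
  assumes t: "t \<ge> 0" and \<xi>: "\<xi> \<in> sobolev0 l 1"
  shows "E1 p * h1 p * ip l (D 1 (Y k t Cu1)) (D 1 \<xi>) = - (rho1 p * h1 p) * ip l (Y (Suc (Suc k)) t Cu1) \<xi>
    + 1 * ip l (tau p (Y k t)) \<xi> + (- damp_a p) * ip l (Y (Suc k) t Cu1) \<xi>"
  using weak_form_u1[OF Y_dom[OF t] \<xi>, of k]
    eqv_ip(1)[OF Y_acceleration(1)[OF t] sobolev0_L2[OF pos(1) \<xi>], of k]
    eqv_ip(1)[OF Y_velocity(1)[OF t] sobolev0_L2[OF pos(1) \<xi>], of k]
  by simp

lemma wave_u3:
  assumes t: "t \<ge> 0" and \<xi>: "\<xi> \<in> sobolev0 l 1"
  shows "E3 p * h3 p * ip l (D 1 (Y k t Cu3)) (D 1 \<xi>) = - (rho3 p * h3 p) * ip l (Y (Suc (Suc k)) t Cu3) \<xi>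
    + (- 1) * ip l (tau p (Y k t)) \<xi> + (- damp_d p) * ip l (Y (Suc k) t Cu3) \<xi>"
  using weak_form_u3[OF Y_dom[OF t] \<xi>, of k]
    eqv_ip(1)[OF Y_acceleration(4)[OF t] sobolev0_L2[OF pos(1) \<xi>], of k]
    eqv_ip(1)[OF Y_velocity(4)[OF t] sobolev0_L2[OF pos(1) \<xi>], of k]
  by simp

lemma wave_y1:
  assumes t: "t \<ge> 0" and \<xi>: "\<xi> \<in> sobolev0 l 1"
  shows "E1 p * I1 p * ip l (D 1 (Y k t Cy1)) (D 1 \<xi>) = - (rho1 p * I1 p) * ip l (Y (Suc (Suc k)) t Cy1) \<xi>
    + 1 * ip l (\<lambda>x. (h1 p / 2) *\<^sub>R tau p (Y k t) x + (- (G1 p * h1 p)) *\<^sub>R shear p Cy1 (Y k t) x) \<xi>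
    + (- damp_b p) * ip l (Y (Suc k) t Cy1) \<xi>"
  using weak_form_y1[OF Y_dom[OF t] \<xi>, of k] sobolev0_L2[OF pos(1) \<xi>] t
    eqv_ip(1)[OF Y_acceleration(2)[OF t] sobolev0_L2[OF pos(1) \<xi>], of k]
    eqv_ip(1)[OF Y_velocity(2)[OF t] sobolev0_L2[OF pos(1) \<xi>], of k]
  by simp

lemma wave_y3:
  assumes t: "t \<ge> 0" and \<xi>: "\<xi> \<in> sobolev0 l 1"
  shows "E3 p * I3 p * ip l (D 1 (Y k t Cy3)) (D 1 \<xi>) = - (rho3 p * I3 p) * ip l (Y (Suc (Suc k)) t Cy3) \<xi>
    + 1 * ip l (\<lambda>x. (h3 p / 2) *\<^sub>R tau p (Y k t) x + (- (G3 p * h3 p)) *\<^sub>R shear p Cy3 (Y k t) x) \<xi>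
    + (- damp_e p) * ip l (Y (Suc k) t Cy3) \<xi>"
  using weak_form_y3[OF Y_dom[OF t] \<xi>, of k] sobolev0_L2[OF pos(1) \<xi>] t
    eqv_ip(1)[OF Y_acceleration(5)[OF t] sobolev0_L2[OF pos(1) \<xi>], of k]
    eqv_ip(1)[OF Y_velocity(5)[OF t] sobolev0_L2[OF pos(1) \<xi>], of k]
  by simp

text \<open>The force of the plate equation. Each summand belongs to H^1_0, which is what excludes a
  nonzero constant limit; the factor 1 fits the pattern of \<open>bnd_H1_lin\<close>.\<close>

definition stress :: "nat \<Rightarrow> real \<Rightarrow> real \<Rightarrow> complex" where
  "stress k t = (\<lambda>x. 1 *\<^sub>R ((G1 p * h1 p) *\<^sub>R shear p Cy1 (Y k t) x + (G3 p * h3 p) *\<^sub>R shear p Cy3 (Y k t) x)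
     + h2 p *\<^sub>R tau p (Y k t) x)"

lemma plate:
  assumes t: "t \<ge> 0" and \<xi>: "\<xi> \<in> sobolev0 l 2"
  shows "ip l (stress k t) (D 1 \<xi>) = - (EI p * ip l (D 2 (Y k t Comega)) (D 2 \<xi>))
    - rho_h p * ip l (Y (Suc (Suc k)) t Comega) \<xi> - damp_c p * ip l (Y (Suc k) t Comega) \<xi>"
proof -
  have d: "D 1 \<xi> \<in> L2 l" "D (Suc 0) \<xi> \<in> L2 l" using sobolev0_weak_deriv_L2[OF \<xi>, of 1] by simp_all
  show ?thesis
    using weak_form_omega[OF Y_dom[OF t] \<xi>, of k] sobolev0_L2[OF pos(1) \<xi>] t d
      eqv_ip(1)[OF Y_acceleration(3)[OF t] sobolev0_L2[OF pos(1) \<xi>], of k]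
      eqv_ip(1)[OF Y_velocity(3)[OF t] sobolev0_L2[OF pos(1) \<xi>], of k]
    by (simp add: stress_def)
qed

section \<open>Bounds along the trajectory for large times\<close>

lemma bd_all:
  "bd (\<lambda>t. Y k t i)" "bd (\<lambda>t. D 1 (Y k t Cu1))" "bd (\<lambda>t. D 1 (Y k t Cy1))" "bd (\<lambda>t. D 1 (Y k t Cu3))"
  "bd (\<lambda>t. D 1 (Y k t Cy3))" "bd (\<lambda>t. D 1 (Y k t Comega))" "bd (\<lambda>t. D 2 (Y k t Comega))"
  "bd (\<lambda>t. shear p Cy1 (Y k t))" "bd (\<lambda>t. shear p Cy3 (Y k t))" "bd (\<lambda>t. tau p (Y k t))"
proof -
  obtain K where K: "K \<ge> 0" "\<forall>U\<in>X. controlled (K * N U) U"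
    using energy_bounds by blast
  obtain M where M: "\<And>t. t \<ge> 0 \<Longrightarrow> N (Y k t) \<le> M" using Y_bound by blast
  have bdI: "bd f" if "\<And>t. t \<ge> 0 \<Longrightarrow> f t \<in> L2 l" "\<And>t. t \<ge> 0 \<Longrightarrow> nrm (f t) \<le> K * N (Y k t)" for f
    unfolding bnd_def
    using that M mult_left_mono[OF M K(1)] by (intro exI[of _ "K * M"] ev0) (meson order_trans)
  show "bd (\<lambda>t. Y k t i)" "bd (\<lambda>t. D 1 (Y k t Cu1))" "bd (\<lambda>t. D 1 (Y k t Cy1))" "bd (\<lambda>t. D 1 (Y k t Cu3))"
    "bd (\<lambda>t. D 1 (Y k t Cy3))" "bd (\<lambda>t. D 1 (Y k t Comega))" "bd (\<lambda>t. D 2 (Y k t Comega))"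
    "bd (\<lambda>t. shear p Cy1 (Y k t))" "bd (\<lambda>t. shear p Cy3 (Y k t))" "bd (\<lambda>t. tau p (Y k t))"
    using K(2) unfolding controlled_def by (intro bdI; simp)+
qed

lemma bd1_comp:
  "bd1 (\<lambda>t. Y k t Cu1)" "bd1 (\<lambda>t. Y k t Cy1)" "bd1 (\<lambda>t. Y k t Cu3)" "bd1 (\<lambda>t. Y k t Cy3)"
  "bd1 (\<lambda>t. D 1 (Y k t Comega))"
proof -
  have h: "\<forall>\<^sub>F t in at_top. Y k t Cu1 \<in> sobolev0 l 1" "\<forall>\<^sub>F t in at_top. Y k t Cy1 \<in> sobolev0 l 1"
    "\<forall>\<^sub>F t in at_top. Y k t Cu3 \<in> sobolev0 l 1" "\<forall>\<^sub>F t in at_top. Y k t Cy3 \<in> sobolev0 l 1"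
    "\<forall>\<^sub>F t in at_top. D 1 (Y k t Comega) \<in> sobolev0 l 1"
    by (rule ev0, rule X_H1 D_omega_H1, erule Y_X)+
  show "bd1 (\<lambda>t. Y k t Cu1)" "bd1 (\<lambda>t. Y k t Cy1)" "bd1 (\<lambda>t. Y k t Cu3)" "bd1 (\<lambda>t. Y k t Cy3)"
    unfolding bnd_H1_def by (intro conjI h bd_all)+
  have "bd (\<lambda>t. D 1 (D 1 (Y k t Comega)))"
  proof (rule bnd_eqv[OF bd_all(7)[of k]], rule ev0)
    fix t :: real assume t: "t \<ge> 0"
    show "eqv l (D 2 (Y k t Comega)) (D 1 (D 1 (Y k t Comega)))"
      using weak_deriv_chain_eqv[OF pos(1) sobolev0_sobolev[OF X_H1(6)[OF Y_X[OF t]]], of 1 1 k]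
      by (intro eqv_sym[OF weak_deriv_eqv] pos(1)) (simp add: numeral_2_eq_2)
  qed
  then show "bd1 (\<lambda>t. D 1 (Y k t Comega))"
    unfolding bnd_H1_def by (intro conjI h bd_all)
qed

lemma bd1_shear: "bd1 (\<lambda>t. shear p Cy1 (Y k t))" "bd1 (\<lambda>t. shear p Cy3 (Y k t))"
  using bnd_H1_lin[OF pos(1) bd1_comp(5) bd1_comp(2), of 1 k 1 k] bnd_H1_lin[OF pos(1) bd1_comp(5) bd1_comp(4), of 1 k 1 k]
  by (simp_all add: shear_def)

lemma bd1_tau: "bd1 (\<lambda>t. tau p (Y k t))"
  using bnd_H1_lin[OF pos(1) bnd_H1_lin[OF pos(1) bnd_H1_lin[OF pos(1) bd1_comp(1)[of k] bd1_comp(3)[of k], of "-1" 1]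
        bnd_H1_lin[OF pos(1) bd1_comp(5)[of k] bd1_comp(2)[of k], of "h2 p" "-(h1 p / 2)"], of 1 1] bd1_comp(4)[of k], of 1 "-(h3 p / 2)"]
  by (simp add: tau_def algebra_simps)

lemma bd1_bd: "bd1 f \<Longrightarrow> bd f" "bd1 f \<Longrightarrow> bd (\<lambda>t. D 1 (f t))" "bd1 f \<Longrightarrow> \<forall>\<^sub>F t in at_top. f t \<in> sobolev0 l 1"
  by (auto simp: bnd_H1_def)

text \<open>The derivative of \<open>s\<close> is not known to be small. The equation for
  \<open>f\<close> trades the pairing with it for pairings of bounded functions with
  \<open>s\<close> itself.\<close>

lemma wave_limit:
  assumes c: "c \<noteq> 0" and s: "sm s" "bd1 s" and g: "bd g1" "bd g2" "bd g3"
    and eq: "\<And>t \<xi>. t \<ge> 0 \<Longrightarrow> \<xi> \<in> sobolev0 l 1 \<Longrightarrow>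
      c * ip l (f t) (D 1 \<xi>) = c1 * ip l (g1 t) \<xi> + c2 * ip l (g2 t) \<xi> + c3 * ip l (g3 t) \<xi>"
  shows "((\<lambda>t. ip l (f t) (D 1 (s t))) \<longlongrightarrow> 0) at_top"
proof -
  have "((\<lambda>t. (c1 * ip l (g1 t) (s t) + c2 * ip l (g2 t) (s t) + c3 * ip l (g3 t) (s t)) / c)
    \<longlongrightarrow> (c1 * 0 + c2 * 0 + c3 * 0) / c) at_top"
    by (intro tendsto_intros ip_small g s c)
  moreover have "\<forall>\<^sub>F t in at_top. (c1 * ip l (g1 t) (s t) + c2 * ip l (g2 t) (s t) + c3 * ip l (g3 t) (s t)) / c
     = ip l (f t) (D 1 (s t))"
    using bd1_bd(3)[OF s(2)] eventually_ge_at_top[of 0]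
    by eventually_elim (use eq c in \<open>simp add: field_simps\<close>)
  ultimately show ?thesis by (simp add: Lim_transform_eventually)
qed

lemma deriv_pairing:
  assumes "sm s" "bd1 s"
  shows "((\<lambda>t. ip l (D 1 (Y k t Cu1)) (D 1 (s t))) \<longlongrightarrow> 0) at_top"
    "((\<lambda>t. ip l (D 1 (Y k t Cu3)) (D 1 (s t))) \<longlongrightarrow> 0) at_top"
    "((\<lambda>t. ip l (D 1 (Y k t Cy1)) (D 1 (s t))) \<longlongrightarrow> 0) at_top"
    "((\<lambda>t. ip l (D 1 (Y k t Cy3)) (D 1 (s t))) \<longlongrightarrow> 0) at_top"
proof -
  have b: "bd (\<lambda>t x. (h1 p / 2) *\<^sub>R tau p (Y k t) x + (- (G1 p * h1 p)) *\<^sub>R shear p Cy1 (Y k t) x)"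
    "bd (\<lambda>t x. (h3 p / 2) *\<^sub>R tau p (Y k t) x + (- (G3 p * h3 p)) *\<^sub>R shear p Cy3 (Y k t) x)"
    by (intro bnd_lin bd_all)+
  have c: "E1 p * h1 p \<noteq> 0" "E3 p * h3 p \<noteq> 0" "E1 p * I1 p \<noteq> 0" "E3 p * I3 p \<noteq> 0" using pos by auto
  show "((\<lambda>t. ip l (D 1 (Y k t Cu1)) (D 1 (s t))) \<longlongrightarrow> 0) at_top"
    by (rule wave_limit[OF c(1) assms bd_all(1) bd_all(10) bd_all(1) wave_u1])
  show "((\<lambda>t. ip l (D 1 (Y k t Cu3)) (D 1 (s t))) \<longlongrightarrow> 0) at_top"
    by (rule wave_limit[OF c(2) assms bd_all(1) bd_all(10) bd_all(1) wave_u3])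
  show "((\<lambda>t. ip l (D 1 (Y k t Cy1)) (D 1 (s t))) \<longlongrightarrow> 0) at_top"
    by (rule wave_limit[OF c(3) assms bd_all(1) b(1) bd_all(1) wave_y1])
  show "((\<lambda>t. ip l (D 1 (Y k t Cy3)) (D 1 (s t))) \<longlongrightarrow> 0) at_top"
    by (rule wave_limit[OF c(4) assms bd_all(1) b(2) bd_all(1) wave_y3])
qed

text \<open>When \<open>s\<close> is the component itself, the pairing in
  \<open>deriv_pairing\<close> is the squared norm of its derivative.\<close>

lemma deriv_small:
  "sm (\<lambda>t. Y k t Cu1) \<Longrightarrow> sm (\<lambda>t. D 1 (Y k t Cu1))"
  "sm (\<lambda>t. Y k t Cu3) \<Longrightarrow> sm (\<lambda>t. D 1 (Y k t Cu3))"
  "sm (\<lambda>t. Y k t Cy1) \<Longrightarrow> sm (\<lambda>t. D 1 (Y k t Cy1))"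
  "sm (\<lambda>t. Y k t Cy3) \<Longrightarrow> sm (\<lambda>t. D 1 (Y k t Cy3))"
  using deriv_pairing[of _ k] bd1_comp[of k]
  by (intro small_if_ip ev0; simp)+

text \<open>The equation is tested with the force \<open>g2\<close> itself, which is possible
  because it is bounded in H^1_0. Every other term then has a decaying factor, and the squared norm
  of \<open>g2\<close> remains.\<close>

lemma force_small:
  assumes s: "sm f" "sm (\<lambda>t. D 1 (f t))" and g: "sm g1" "sm g3" "bd1 g2"
    and c: "c2 \<noteq> 0"
    and eq: "\<And>t \<xi>. t \<ge> 0 \<Longrightarrow> \<xi> \<in> sobolev0 l 1 \<Longrightarrow>
      c * ip l (D 1 (f t)) (D 1 \<xi>) = c1 * ip l (g1 t) \<xi> + c2 * ip l (g2 t) \<xi> + c3 * ip l (g3 t) \<xi>"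
  shows "sm g2"
proof (rule small_if_ip)
  have "((\<lambda>t. (c * ip l (D 1 (f t)) (D 1 (g2 t)) - c1 * ip l (g1 t) (g2 t) - c3 * ip l (g3 t) (g2 t)) / c2)
    \<longlongrightarrow> (c * 0 - c1 * 0 - c3 * 0) / c2) at_top"
    by (intro tendsto_intros ip_small' bd1_bd s g c)
  moreover have "\<forall>\<^sub>F t in at_top. (c * ip l (D 1 (f t)) (D 1 (g2 t)) - c1 * ip l (g1 t) (g2 t) - c3 * ip l (g3 t) (g2 t)) / c2
     = ip l (g2 t) (g2 t)"
    using bd1_bd(3)[OF g(3)] eventually_ge_at_top[of 0]
    by eventually_elim (use eq c in \<open>simp add: field_simps\<close>)
  ultimately show "((\<lambda>t. ip l (g2 t) (g2 t)) \<longlongrightarrow> 0) at_top" by (simp add: Lim_transform_eventually)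
  show "\<forall>\<^sub>F t in at_top. g2 t \<in> L2 l"
    using bd1_bd(3)[OF g(3)] by eventually_elim (rule sobolev0_L2[OF pos(1)])
qed

text \<open>Indices start at \<open>1\<close> because damping only controls velocities, that is, displacements of \<open>Y 1\<close>.\<close>

definition vanish :: "comp \<Rightarrow> bool" where
  "vanish i \<longleftrightarrow> (\<forall>k. sm (\<lambda>t. Y (Suc k) t i))"

definition vanish_fun :: "(state \<Rightarrow> real \<Rightarrow> complex) \<Rightarrow> bool" where
  "vanish_fun f \<longleftrightarrow> (\<forall>k. sm (\<lambda>t. f (Y (Suc k) t)))"

lemma vanish_iff: "vanish i \<longleftrightarrow> vanish_fun (\<lambda>U. U i)"
  by (simp add: vanish_def vanish_fun_def)

lemma vanish_lin: "vanish_fun f \<Longrightarrow> vanish_fun g \<Longrightarrow> vanish_fun (\<lambda>U x. (a::real) *\<^sub>R f U x + (b::real) *\<^sub>R g U x)"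
  by (simp add: vanish_fun_def small_lin)

section \<open>From decaying displacements to decaying forces\<close>

lemma tau_vanishes:
  assumes "vanish Cu1"
  shows "vanish_fun (tau p)"
  unfolding vanish_fun_def
proof
  fix k
  have s: "sm (\<lambda>t. Y (Suc k) t Cu1)" for k using assms by (simp add: vanish_def)
  show "sm (\<lambda>t. tau p (Y (Suc k) t))"
    by (rule force_small[OF s[of k] deriv_small(1)[OF s] s s bd1_tau _ wave_u1]) simp
qed

lemma y1_force_vanishes:
  assumes "vanish Cy1"
  shows "vanish_fun (\<lambda>U x. (h1 p / 2) *\<^sub>R tau p U x + (- (G1 p * h1 p)) *\<^sub>R shear p Cy1 U x)"
  unfolding vanish_fun_def
proof
  fix k
  have s: "sm (\<lambda>t. Y (Suc k) t Cy1)" for k using assms by (simp add: vanish_def)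
  show "sm (\<lambda>t x. (h1 p / 2) *\<^sub>R tau p (Y (Suc k) t) x + (- (G1 p * h1 p)) *\<^sub>R shear p Cy1 (Y (Suc k) t) x)"
    by (rule force_small[OF s[of k] deriv_small(3)[OF s] s s bnd_H1_lin[OF pos(1) bd1_tau bd1_shear(1)] _ wave_y1]) simp
qed

lemma y3_force_vanishes:
  assumes "vanish Cy3"
  shows "vanish_fun (\<lambda>U x. (h3 p / 2) *\<^sub>R tau p U x + (- (G3 p * h3 p)) *\<^sub>R shear p Cy3 U x)"
  unfolding vanish_fun_def
proof
  fix k
  have s: "sm (\<lambda>t. Y (Suc k) t Cy3)" for k using assms by (simp add: vanish_def)
  show "sm (\<lambda>t x. (h3 p / 2) *\<^sub>R tau p (Y (Suc k) t) x + (- (G3 p * h3 p)) *\<^sub>R shear p Cy3 (Y (Suc k) t) x)"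
    by (rule force_small[OF s[of k] deriv_small(4)[OF s] s s bnd_H1_lin[OF pos(1) bd1_tau bd1_shear(2)] _ wave_y3]) simp
qed

text \<open>Interpolation: the squared norm of omega_x is minus the pairing of omega with omega_xx,
  which is bounded.\<close>

lemma D_omega_small:
  assumes s: "sm (\<lambda>t. Y k t Comega)"
  shows "sm (\<lambda>t. D 1 (Y k t Comega))"
proof (rule small_if_ip)
  have "((\<lambda>t. - ip l (Y k t Comega) (D 1 (D 1 (Y k t Comega)))) \<longlongrightarrow> - 0) at_top"
    by (intro tendsto_minus ip_small' s bd1_bd(2) bd1_comp)
  moreover have "\<forall>\<^sub>F t in at_top. - ip l (Y k t Comega) (D 1 (D 1 (Y k t Comega))) = ip l (D 1 (Y k t Comega)) (D 1 (Y k t Comega))"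
    by (rule ev0) (rule ip_first_deriv[symmetric, OF X_H1(5) D_omega_H1]; simp)
  ultimately show "((\<lambda>t. ip l (D 1 (Y k t Comega)) (D 1 (Y k t Comega))) \<longlongrightarrow> 0) at_top"
    by (simp add: Lim_transform_eventually)
  show "\<forall>\<^sub>F t in at_top. D 1 (Y k t Comega) \<in> L2 l"
    by (rule ev0) simp
qed

lemma stress_L2 [simp]: "t \<ge> 0 \<Longrightarrow> stress k t \<in> L2 l"
  unfolding stress_def by (intro L2_add L2_scaleR) auto

lemma bd1_stress: "bd1 (stress k)"
  unfolding stress_def by (intro bnd_H1_lin pos(1) bd1_shear bd1_tau)

text \<open>The plate equation tested with omega: each term besides the bending energy pairs a
  bounded function with omega or omega_x.\<close>

lemma D2_omega_small:
  assumes s: "sm (\<lambda>t. Y k t Comega)"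
  shows "sm (\<lambda>t. D 2 (Y k t Comega))"
proof (rule small_if_ip)
  have "((\<lambda>t. (- ip l (stress k t) (D 1 (Y k t Comega)) - rho_h p * ip l (Y (Suc (Suc k)) t Comega) (Y k t Comega)
      - damp_c p * ip l (Y (Suc k) t Comega) (Y k t Comega)) / EI p) \<longlongrightarrow> (- 0 - rho_h p * 0 - damp_c p * 0) / EI p) at_top"
    using pos(13) by (intro tendsto_intros ip_small s D_omega_small bd_all bd1_bd(1) bd1_stress) auto
  moreover have "\<forall>\<^sub>F t in at_top. (- ip l (stress k t) (D 1 (Y k t Comega)) - rho_h p * ip l (Y (Suc (Suc k)) t Comega) (Y k t Comega)
      - damp_c p * ip l (Y (Suc k) t Comega) (Y k t Comega)) / EI p = ip l (D 2 (Y k t Comega)) (D 2 (Y k t Comega))"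
  proof (rule ev0)
    fix t :: real assume t: "t \<ge> 0"
    show "(- ip l (stress k t) (D 1 (Y k t Comega)) - rho_h p * ip l (Y (Suc (Suc k)) t Comega) (Y k t Comega)
      - damp_c p * ip l (Y (Suc k) t Comega) (Y k t Comega)) / EI p = ip l (D 2 (Y k t Comega)) (D 2 (Y k t Comega))"
      using plate[OF t X_H1(6)[OF Y_X[OF t]], of k k] pos(13) by (simp add: field_simps)
  qed
  ultimately show "((\<lambda>t. ip l (D 2 (Y k t Comega)) (D 2 (Y k t Comega))) \<longlongrightarrow> 0) at_top"
    by (simp add: Lim_transform_eventually)
  show "\<forall>\<^sub>F t in at_top. D 2 (Y k t Comega) \<in> L2 l"
    by (rule ev0) simp
qed

text \<open>All terms of the plate equation other than the stress decay. So the stress is almost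
  orthogonal to derivatives of test functions, with an error \<open>\<delta>\<close> measured in up
  to two derivatives, and \<open>small_if_almost_constant\<close> applies at each large
  time.\<close>

lemma stress_vanishes:
  assumes "vanish Comega"
  shows "sm (stress (Suc k))"
proof (rule small_if_ip)
  have s: "sm (\<lambda>t. Y (Suc k) t Comega)" for k using assms by (simp add: vanish_def)
  let ?g = "stress (Suc k)"
  define \<delta> where "\<delta> t = EI p * nrm (D 2 (Y (Suc k) t Comega)) + rho_h p * nrm (Y (Suc (Suc (Suc k))) t Comega)
    + damp_c p * nrm (Y (Suc (Suc k)) t Comega)" for t
  have \<delta>0: "(\<delta> \<longlongrightarrow> 0) at_top"
  proof -
    have "(\<delta> \<longlongrightarrow> EI p * 0 + rho_h p * 0 + damp_c p * 0) at_top"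
      unfolding \<delta>_def using s D2_omega_small[OF s] by (intro tendsto_intros) (auto simp: small_def)
    then show ?thesis by simp
  qed
  have \<delta>nn: "\<delta> t \<ge> 0" for t unfolding \<delta>_def using pos by (intro add_nonneg_nonneg mult_nonneg_nonneg) auto
  have pl: "\<bar>ip l (?g t) (nth_deriv 1 \<xi>)\<bar> \<le> \<delta> t * (nrm \<xi> + nrm (nth_deriv 1 \<xi>) + nrm (nth_deriv 2 \<xi>))"
    if t: "t \<ge> 0" and \<xi>: "\<xi> \<in> test_functions l" for t \<xi>
  proof -
    have m: "nth_deriv 1 \<xi> \<in> L2 l" "nth_deriv 2 \<xi> \<in> L2 l" "\<xi> \<in> L2 l" using \<xi> pos(1) by (auto intro: test_nth_deriv)
    have e: "eqv l (D j \<xi>) (nth_deriv j \<xi>)" for j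
      by (rule weak_deriv_eqv[OF pos(1) has_weak_deriv_test[OF pos(1) \<xi>]])
    define n where "n = nrm \<xi> + nrm (nth_deriv 1 \<xi>) + nrm (nth_deriv 2 \<xi>)"
    have n: "nrm \<xi> \<le> n" "nrm (nth_deriv 2 \<xi>) \<le> n" by (simp_all add: n_def)
    have ipn: "\<bar>ip l f g\<bar> \<le> nrm f * n" if "f \<in> L2 l" "g \<in> L2 l" "nrm g \<le> n" for f g
      using ip_bound[OF that(1,2)] mult_left_mono[OF that(3), of "nrm f"] by simp
    have "ip l (?g t) (nth_deriv 1 \<xi>) = ip l (?g t) (D 1 \<xi>)"
      using eqv_ip(2)[OF e, of "?g t"] t by simp
    also have "\<dots> = - (EI p * ip l (D 2 (Y (Suc k) t Comega)) (nth_deriv 2 \<xi>))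
      - rho_h p * ip l (Y (Suc (Suc (Suc k))) t Comega) \<xi> - damp_c p * ip l (Y (Suc (Suc k)) t Comega) \<xi>"
      using plate[OF t test_sobolev0[OF pos(1) \<xi>], of "Suc k"] eqv_ip(2)[OF e, of "D 2 (Y (Suc k) t Comega)" 2] t by simp
    finally have "\<bar>ip l (?g t) (nth_deriv 1 \<xi>)\<bar> \<le> \<bar>EI p * ip l (D 2 (Y (Suc k) t Comega)) (nth_deriv 2 \<xi>)\<bar>
      + \<bar>rho_h p * ip l (Y (Suc (Suc (Suc k))) t Comega) \<xi>\<bar> + \<bar>damp_c p * ip l (Y (Suc (Suc k)) t Comega) \<xi>\<bar>"
      by linarith
    also have "\<dots> \<le> EI p * (nrm (D 2 (Y (Suc k) t Comega)) * n) + rho_h p * (nrm (Y (Suc (Suc (Suc k))) t Comega) * n)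
      + damp_c p * (nrm (Y (Suc (Suc k)) t Comega) * n)"
      unfolding abs_mult using pos t m n
      by (intro add_mono mult_mono ipn) auto
    also have "\<dots> = \<delta> t * n" by (simp add: \<delta>_def algebra_simps)
    finally show ?thesis by (simp add: n_def)
  qed
  obtain M0 where M0: "\<forall>\<^sub>F t in at_top. D 1 (?g t) \<in> L2 l \<and> nrm (D 1 (?g t)) \<le> M0"
    using bd1_bd(2)[OF bd1_stress] unfolding bnd_def by blast
  define M where "M = max M0 0"
  show "((\<lambda>t. ip l (?g t) (?g t)) \<longlongrightarrow> 0) at_top"
  proof (rule tendstoI)
    fix e :: real assume e: "e > 0"
    have "\<exists>C\<ge>0. \<forall>g\<in>sobolev0 l 1. \<forall>\<delta>\<ge>0. nrm (D 1 g) \<le> M \<longrightarrow>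
      (\<forall>\<xi>\<in>test_functions l. \<bar>ip l g (nth_deriv 1 \<xi>)\<bar> \<le> \<delta> * (nrm \<xi> + nrm (nth_deriv 1 \<xi>) + nrm (nth_deriv 2 \<xi>))) \<longrightarrow>
      (nrm g)\<^sup>2 \<le> e / 2 + C * \<delta>"
      using e by (intro small_if_almost_constant pos(1)) (auto simp: M_def)
    then obtain C where C: "\<And>g \<delta>. g \<in> sobolev0 l 1 \<Longrightarrow> \<delta> \<ge> 0 \<Longrightarrow> nrm (D 1 g) \<le> M \<Longrightarrow>
      (\<forall>\<xi>\<in>test_functions l. \<bar>ip l g (nth_deriv 1 \<xi>)\<bar> \<le> \<delta> * (nrm \<xi> + nrm (nth_deriv 1 \<xi>) + nrm (nth_deriv 2 \<xi>))) \<Longrightarrow>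
      (nrm g)\<^sup>2 \<le> e / 2 + C * \<delta>" by blast
    have "((\<lambda>t. C * \<delta> t) \<longlongrightarrow> C * 0) at_top" by (intro tendsto_intros \<delta>0)
    then have "\<forall>\<^sub>F t in at_top. C * \<delta> t < e / 2"
      using order_tendstoD(2)[of "\<lambda>t. C * \<delta> t" "C * 0" at_top "e / 2"] e by simp
    then show "\<forall>\<^sub>F t in at_top. dist (ip l (?g t) (?g t)) 0 < e"
      using M0 bd1_bd(3)[OF bd1_stress[of "Suc k"]] eventually_ge_at_top[of 0]
    proof eventually_elim
      case (elim t)
      have "(nrm (?g t))\<^sup>2 \<le> e / 2 + C * \<delta> t"
        using elim pl[of t] by (intro C \<delta>nn) (auto simp: M_def)
      then show ?case using elim(1) by (simp add: ip_self dist_real_def)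
    qed
  qed
  show "\<forall>\<^sub>F t in at_top. ?g t \<in> L2 l" by (rule ev0) simp
qed

section \<open>From decaying forces back to displacements\<close>

lemma vanish_cong: "vanish_fun f \<Longrightarrow> (\<And>U x. f U x = g U x) \<Longrightarrow> vanish_fun g"
  by (metis (no_types, lifting) ext)

lemma D_omega_vanishes: "vanish Comega \<Longrightarrow> vanish_fun (\<lambda>U. D 1 (U Comega))"
  unfolding vanish_def vanish_fun_def using D_omega_small by blast

lemma omega_vanishes:
  assumes "vanish_fun (\<lambda>U. D 1 (U Comega))"
  shows "vanish Comega"
  unfolding vanish_def
proof
  fix k
  have "\<forall>\<^sub>F t in at_top. Y (Suc k) t Comega \<in> sobolev0 l 1"
    by (rule ev0) (rule X_H1, simp)
  then show "sm (\<lambda>t. Y (Suc k) t Comega)"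
    using assms unfolding vanish_fun_def by (blast intro: small_if_deriv_small pos(1))
qed

lemma stress_fun_vanishes:
  assumes "vanish Comega"
  shows "vanish_fun (\<lambda>U x. 1 *\<^sub>R ((G1 p * h1 p) *\<^sub>R shear p Cy1 U x + (G3 p * h3 p) *\<^sub>R shear p Cy3 U x)
     + h2 p *\<^sub>R tau p U x)"
  using stress_vanishes[OF assms] unfolding vanish_fun_def stress_def by blast

text \<open>Removing the contributions of tau and of the third layer from the stress leaves a
  multiple of omega_x + y1.\<close>

lemma y1_vanishes:
  assumes "vanish Comega" "vanish_fun (tau p)" "vanish Cy3"
  shows "vanish Cy1"
proof -
  note o = D_omega_vanishes[OF assms(1)]
  have sh3: "vanish_fun (\<lambda>U x. 1 *\<^sub>R D 1 (U Comega) x + 1 *\<^sub>R U Cy3 x)"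
    using vanish_lin[OF o, of "\<lambda>U. U Cy3" 1 1] assms(3) by (simp add: vanish_iff)
  have 1: "vanish_fun (\<lambda>U x. 1 *\<^sub>R (1 *\<^sub>R (1 *\<^sub>R ((G1 p * h1 p) *\<^sub>R shear p Cy1 U x + (G3 p * h3 p) *\<^sub>R shear p Cy3 U x)
     + h2 p *\<^sub>R tau p U x) + (- h2 p) *\<^sub>R tau p U x) + (- (G3 p * h3 p)) *\<^sub>R (1 *\<^sub>R D 1 (U Comega) x + 1 *\<^sub>R U Cy3 x))"
    by (rule vanish_lin[OF vanish_lin[OF stress_fun_vanishes[OF assms(1)] assms(2)] sh3])
  have "vanish_fun (\<lambda>U. U Cy1)"
    by (rule vanish_cong[OF vanish_lin[OF 1 o, of "1 / (G1 p * h1 p)" "-1"]])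
       (use pos in \<open>simp add: shear_def algebra_simps\<close>)
  then show ?thesis by (simp add: vanish_iff)
qed

lemma y3_vanishes:
  assumes "vanish Comega" "vanish_fun (tau p)" "vanish Cy1"
  shows "vanish Cy3"
proof -
  note o = D_omega_vanishes[OF assms(1)]
  have sh1: "vanish_fun (\<lambda>U x. 1 *\<^sub>R D 1 (U Comega) x + 1 *\<^sub>R U Cy1 x)"
    using vanish_lin[OF o, of "\<lambda>U. U Cy1" 1 1] assms(3) by (simp add: vanish_iff)
  have 1: "vanish_fun (\<lambda>U x. 1 *\<^sub>R (1 *\<^sub>R (1 *\<^sub>R ((G1 p * h1 p) *\<^sub>R shear p Cy1 U x + (G3 p * h3 p) *\<^sub>R shear p Cy3 U x)
     + h2 p *\<^sub>R tau p U x) + (- h2 p) *\<^sub>R tau p U x) + (- (G1 p * h1 p)) *\<^sub>R (1 *\<^sub>R D 1 (U Comega) x + 1 *\<^sub>R U Cy1 x))"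
    by (rule vanish_lin[OF vanish_lin[OF stress_fun_vanishes[OF assms(1)] assms(2)] sh1])
  have "vanish_fun (\<lambda>U. U Cy3)"
    by (rule vanish_cong[OF vanish_lin[OF 1 o, of "1 / (G3 p * h3 p)" "-1"]])
       (use pos in \<open>simp add: shear_def algebra_simps\<close>)
  then show ?thesis by (simp add: vanish_iff)
qed

text \<open>All terms of tau other than u3 - u1 decay, and so does tau.\<close>

lemma difference_vanishes:
  assumes "vanish Comega" "vanish_fun (tau p)" "vanish Cy1" "vanish Cy3"
  shows "vanish_fun (\<lambda>U x. 1 *\<^sub>R U Cu3 x + (-1) *\<^sub>R U Cu1 x)"
proof -
  note o = D_omega_vanishes[OF assms(1)]
  have y: "vanish_fun (\<lambda>U. U Cy1)" "vanish_fun (\<lambda>U. U Cy3)" using assms by (auto simp: vanish_iff)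
  show ?thesis
    by (rule vanish_cong[OF vanish_lin[OF vanish_lin[OF assms(2) o, of 1 "- h2 p"] vanish_lin[OF y, of "h1 p / 2" "h3 p / 2"], of 1 1]])
       (simp add: tau_def algebra_simps)
qed

lemma u3_vanishes:
  assumes "vanish Comega" "vanish_fun (tau p)" "vanish Cy1" "vanish Cy3" "vanish Cu1"
  shows "vanish Cu3"
proof -
  have "vanish_fun (\<lambda>U. U Cu1)" using assms(5) by (simp add: vanish_iff)
  have "vanish_fun (\<lambda>U. U Cu3)"
    by (rule vanish_cong[OF vanish_lin[OF difference_vanishes[OF assms(1-4)] \<open>vanish_fun (\<lambda>U. U Cu1)\<close>, of 1 1]]) simp
  then show ?thesis by (simp add: vanish_iff)
qed

text \<open>If \<open>u\<^sup>1\<close> and \<open>u\<^sup>3\<close> asymptotically coincide and are force-free, they would solve two wave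
  equations with different speeds.\<close>

lemma u_vanish_if_speeds_differ:
  assumes d: "vanish_fun (\<lambda>U x. 1 *\<^sub>R U Cu3 x + (-1) *\<^sub>R U Cu1 x)" and \<tau>: "vanish_fun (tau p)"
    and damp: "damp_a p = 0" "damp_d p = 0" and ne: "E1 p / rho1 p \<noteq> E3 p / rho3 p"
  shows "vanish Cu1" "vanish Cu3"
proof -
  have u1: "sm (\<lambda>t. Y (Suc k) t Cu1)" for k
  proof -
    let ?u = "\<lambda>t. Y (Suc k) t Cu1" and ?v = "\<lambda>t. Y (Suc k) t Cu3"
    define s where "s = (\<lambda>k t x. 1 *\<^sub>R Y k t Cu3 x + (-1) *\<^sub>R Y k t Cu1 x)"
    have s: "sm (s (Suc k))" for k
      using d unfolding vanish_fun_def s_def by blast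
    have s1: "bd1 (s k)" for k
      unfolding s_def by (intro bnd_H1_lin pos(1) bd1_comp)
    define q where "q = E3 p / rho3 p - E1 p / rho1 p"
    have q: "q \<noteq> 0" using ne by (simp add: q_def)
    \<comment> \<open>Both wave equations are tested with u1, divided by their mass coefficients and
      subtracted. The derivative of u3 is rewritten through \<open>s\<close>, which leaves the
      squared norm of the derivative of u1 with the factor q, the difference of the squared
      speeds.\<close>
    let ?F = "\<lambda>t. (- ip l (s (Suc (Suc (Suc k))) t) (?u t) - (1 / (rho3 p * h3 p) + 1 / (rho1 p * h1 p)) * ip l (tau p (Y (Suc k) t)) (?u t)
        - E3 p / rho3 p * ip l (D 1 (?u t)) (D 1 (s (Suc k) t))) / q"
    have lim: "(?F \<longlongrightarrow> (- 0 - (1 / (rho3 p * h3 p) + 1 / (rho1 p * h1 p)) * 0 - E3 p / rho3 p * 0) / q) at_top"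
      using \<tau> q unfolding vanish_fun_def
      by (intro tendsto_intros ip_small' s bd_all deriv_pairing s1) auto
    have "\<forall>\<^sub>F t in at_top. ?F t = ip l (D 1 (?u t)) (D 1 (?u t))"
    proof (rule ev0)
      fix t :: real assume t: "t \<ge> 0"
      have u: "?u t \<in> sobolev0 l 1" "?v t \<in> sobolev0 l 1" using X_H1[OF Y_X[OF t]] by blast+
      have D: "D 1 (?u t) \<in> L2 l" "D 1 (?v t) \<in> L2 l" using X_D_L2[OF Y_X[OF t]] by blast+
      have "eqv l (D 1 (s (Suc k) t)) (\<lambda>x. 1 *\<^sub>R D 1 (?v t) x + (-1) *\<^sub>R D 1 (?u t) x)"
        unfolding s_def by (rule D_comb[OF u(2,1)]) simp
      then have "ip l (D 1 (?u t)) (D 1 (s (Suc k) t)) = ip l (D 1 (?u t)) (\<lambda>x. 1 *\<^sub>R D 1 (?v t) x + (-1) *\<^sub>R D 1 (?u t) x)"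
        using D by (intro eqv_ip)
      also have "\<dots> = ip l (D 1 (?v t)) (D 1 (?u t)) - ip l (D 1 (?u t)) (D 1 (?u t))"
        unfolding ip_commute[of l "D 1 (?u t)" "\<lambda>x. 1 *\<^sub>R D 1 (?v t) x + (-1) *\<^sub>R D 1 (?u t) x"] using D by simp
      finally have a: "ip l (D 1 (?u t)) (D 1 (s (Suc k) t)) = ip l (D 1 (?v t)) (D 1 (?u t)) - ip l (D 1 (?u t)) (D 1 (?u t))" .
      have b: "ip l (s (Suc (Suc (Suc k))) t) (?u t) = ip l (Y (Suc (Suc (Suc k))) t Cu3) (?u t) - ip l (Y (Suc (Suc (Suc k))) t Cu1) (?u t)"
        using t by (simp add: s_def)
      have w1: "E1 p / rho1 p * ip l (D 1 (?u t)) (D 1 (?u t)) = - ip l (Y (Suc (Suc (Suc k))) t Cu1) (?u t) + 1 / (rho1 p * h1 p) * ip l (tau p (Y (Suc k) t)) (?u t)"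
        using wave_u1[OF t u(1), of "Suc k"] pos damp by (simp add: field_simps)
      have w3: "E3 p / rho3 p * ip l (D 1 (?v t)) (D 1 (?u t)) = - ip l (Y (Suc (Suc (Suc k))) t Cu3) (?u t) - 1 / (rho3 p * h3 p) * ip l (tau p (Y (Suc k) t)) (?u t)"
        using wave_u3[OF t u(1), of "Suc k"] pos damp by (simp add: field_simps)
      have "- ip l (s (Suc (Suc (Suc k))) t) (?u t) - (1 / (rho3 p * h3 p) + 1 / (rho1 p * h1 p)) * ip l (tau p (Y (Suc k) t)) (?u t)
        - E3 p / rho3 p * ip l (D 1 (?u t)) (D 1 (s (Suc k) t)) = q * ip l (D 1 (?u t)) (D 1 (?u t))"
        unfolding a b q_def distrib_right right_diff_distrib left_diff_distrib w3 w1 by simp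
      then show "?F t = ip l (D 1 (?u t)) (D 1 (?u t))"
        using q by simp
    qed
    then have "((\<lambda>t. ip l (D 1 (?u t)) (D 1 (?u t))) \<longlongrightarrow> 0) at_top"
      using lim by (simp add: Lim_transform_eventually)
    moreover have "\<forall>\<^sub>F t in at_top. D 1 (?u t) \<in> L2 l"
      by (rule ev0) simp
    ultimately have "sm (\<lambda>t. D 1 (?u t))" by (rule small_if_ip)
    then show ?thesis
      by (rule small_if_deriv_small[OF pos(1) bd1_bd(3)[OF bd1_comp(1)]])
  qed
  then show 1: "vanish Cu1" by (simp add: vanish_def)
  then have "vanish_fun (\<lambda>U. U Cu1)" by (simp add: vanish_iff)
  have "vanish_fun (\<lambda>U. U Cu3)"
    by (rule vanish_cong[OF vanish_lin[OF d \<open>vanish_fun (\<lambda>U. U Cu1)\<close>, of 1 1]]) simp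
  then show "vanish Cu3" by (simp add: vanish_iff)
qed

text \<open>Here \<open>u\<^sup>3\<close> and \<open>y\<^sup>3\<close> are asymptotically proportional, and their equations have the same wave
  speed but differ by the zero-order term \<open>G\<^sub>3 h\<^sub>3 y\<^sup>3\<close>.\<close>

lemma y3_vanishes_if_proportional:
  assumes d: "vanish_fun (\<lambda>U x. \<alpha> *\<^sub>R U Cu3 x + \<beta> *\<^sub>R U Cy3 x)" and \<beta>: "\<beta> \<noteq> 0" and \<tau>: "vanish_fun (tau p)"
    and o: "vanish_fun (\<lambda>U. D 1 (U Comega))" and damp: "damp_d p = 0" "damp_e p = 0"
  shows "vanish Cy3"
  unfolding vanish_def
proof
  fix k
  let ?z = "\<lambda>t. Y (Suc k) t Cy3" and ?v = "\<lambda>t. Y (Suc k) t Cu3" and ?o = "\<lambda>t. D 1 (Y (Suc k) t Comega)"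
  define s where "s = (\<lambda>k t x. \<alpha> *\<^sub>R Y k t Cu3 x + \<beta> *\<^sub>R Y k t Cy3 x)"
  have s: "sm (s (Suc k))" for k
    using d unfolding vanish_fun_def s_def by blast
  have s1: "bd1 (s k)" for k
    unfolding s_def by (intro bnd_H1_lin pos(1) bd1_comp)
  \<comment> \<open>The equations of u3 and y3 are tested with y3, divided by their mass
    coefficients and combined with the weights \<alpha> and \<beta>. The elastic parts merge into E3
    / rho3 times a pairing with the derivative of \<open>s\<close>; what survives is the zero-order
    term with factor \<open>q\<close>, while \<open>r\<close> collects the contributions of
    tau.\<close>
  define q where "q = \<beta> * (G3 p * h3 p / (rho3 p * I3 p))"
  have q: "q \<noteq> 0" using \<beta> pos by (simp add: q_def)
  define r where "r = \<beta> * (h3 p / 2 / (rho3 p * I3 p)) - \<alpha> / (rho3 p * h3 p)"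
  let ?F = "\<lambda>t. (r * ip l (tau p (Y (Suc k) t)) (?z t) - ip l (s (Suc (Suc (Suc k))) t) (?z t)
    - E3 p / rho3 p * ip l (D 1 (?z t)) (D 1 (s (Suc k) t)) - q * ip l (?o t) (?z t)) / q"
  have lim: "(?F \<longlongrightarrow> (r * 0 - 0 - E3 p / rho3 p * 0 - q * 0) / q) at_top"
    using \<tau> o q unfolding vanish_fun_def
    by (intro tendsto_intros ip_small' s bd_all deriv_pairing s1) auto
  have "\<forall>\<^sub>F t in at_top. ?F t = ip l (?z t) (?z t)"
  proof (rule ev0)
    fix t :: real assume t: "t \<ge> 0"
    have u: "?z t \<in> sobolev0 l 1" "?v t \<in> sobolev0 l 1" using X_H1[OF Y_X[OF t]] by blast+
    have D: "D 1 (?z t) \<in> L2 l" "D 1 (?v t) \<in> L2 l" "?o t \<in> L2 l" using X_D_L2[OF Y_X[OF t]] by blast+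
    have "eqv l (D 1 (s (Suc k) t)) (\<lambda>x. \<alpha> *\<^sub>R D 1 (?v t) x + \<beta> *\<^sub>R D 1 (?z t) x)"
      unfolding s_def by (rule D_comb[OF u(2,1)]) simp
    then have "ip l (D 1 (?z t)) (D 1 (s (Suc k) t)) = ip l (D 1 (?z t)) (\<lambda>x. \<alpha> *\<^sub>R D 1 (?v t) x + \<beta> *\<^sub>R D 1 (?z t) x)"
      using D by (intro eqv_ip)
    also have "\<dots> = \<alpha> * ip l (D 1 (?v t)) (D 1 (?z t)) + \<beta> * ip l (D 1 (?z t)) (D 1 (?z t))"
      unfolding ip_commute[of l "D 1 (?z t)" "\<lambda>x. \<alpha> *\<^sub>R D 1 (?v t) x + \<beta> *\<^sub>R D 1 (?z t) x"] using D by simp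
    finally have a: "ip l (D 1 (?z t)) (D 1 (s (Suc k) t)) = \<alpha> * ip l (D 1 (?v t)) (D 1 (?z t)) + \<beta> * ip l (D 1 (?z t)) (D 1 (?z t))" .
    have b: "ip l (s (Suc (Suc (Suc k))) t) (?z t) = \<alpha> * ip l (Y (Suc (Suc (Suc k))) t Cu3) (?z t) + \<beta> * ip l (Y (Suc (Suc (Suc k))) t Cy3) (?z t)"
      using t by (simp add: s_def)
    have sh: "ip l (shear p Cy3 (Y (Suc k) t)) (?z t) = ip l (?o t) (?z t) + ip l (?z t) (?z t)"
      unfolding shear_def using t D by simp
    have w3: "E3 p / rho3 p * ip l (D 1 (?v t)) (D 1 (?z t)) = - ip l (Y (Suc (Suc (Suc k))) t Cu3) (?z t) - 1 / (rho3 p * h3 p) * ip l (tau p (Y (Suc k) t)) (?z t)"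
      using wave_u3[OF t u(1), of "Suc k"] pos damp by (simp add: field_simps)
    have wy: "E3 p / rho3 p * ip l (D 1 (?z t)) (D 1 (?z t)) = - ip l (Y (Suc (Suc (Suc k))) t Cy3) (?z t)
      + h3 p / 2 / (rho3 p * I3 p) * ip l (tau p (Y (Suc k) t)) (?z t) - G3 p * h3 p / (rho3 p * I3 p) * (ip l (?o t) (?z t) + ip l (?z t) (?z t))"
    proof -
      have "E3 p / rho3 p * ip l (D 1 (?z t)) (D 1 (?z t)) = E3 p * I3 p * ip l (D 1 (?z t)) (D 1 (?z t)) / (rho3 p * I3 p)"
        using pos by simp
      also have "E3 p * I3 p * ip l (D 1 (?z t)) (D 1 (?z t)) = - (rho3 p * I3 p) * ip l (Y (Suc (Suc (Suc k))) t Cy3) (?z t)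
        + (h3 p / 2 * ip l (tau p (Y (Suc k) t)) (?z t) - G3 p * h3 p * (ip l (?o t) (?z t) + ip l (?z t) (?z t)))"
        unfolding sh[symmetric] using wave_y3[OF t u(1), of "Suc k"] damp t by simp
      finally show ?thesis
        using pos by (simp add: add_divide_distrib diff_divide_distrib)
    qed
    have "E3 p / rho3 p * ip l (D 1 (?z t)) (D 1 (s (Suc k) t)) =
      \<alpha> * (E3 p / rho3 p * ip l (D 1 (?v t)) (D 1 (?z t))) + \<beta> * (E3 p / rho3 p * ip l (D 1 (?z t)) (D 1 (?z t)))"
      unfolding a by (simp add: algebra_simps)
    then have "r * ip l (tau p (Y (Suc k) t)) (?z t) - ip l (s (Suc (Suc (Suc k))) t) (?z t)
      - E3 p / rho3 p * ip l (D 1 (?z t)) (D 1 (s (Suc k) t)) - q * ip l (?o t) (?z t) = q * ip l (?z t) (?z t)"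
      unfolding w3 wy b r_def q_def by (simp add: algebra_simps)
    then show "?F t = ip l (?z t) (?z t)"
      using q by simp
  qed
  then have "((\<lambda>t. ip l (?z t) (?z t)) \<longlongrightarrow> 0) at_top"
    using lim by (simp add: Lim_transform_eventually)
  moreover have "\<forall>\<^sub>F t in at_top. ?z t \<in> L2 l" by (rule ev0) simp
  ultimately show "sm ?z" by (rule small_if_ip)
qed

text \<open>All damping terms are nonnegative, so each is dominated by the total dissipation, which
  tends to 0. A damped velocity at level k is a displacement at level k + 1.\<close>

lemma damped_vanish:
  "damp_a p > 0 \<Longrightarrow> vanish Cu1" "damp_b p > 0 \<Longrightarrow> vanish Cy1" "damp_c p > 0 \<Longrightarrow> vanish Comega" "damp_e p > 0 \<Longrightarrow> vanish Cy3"
proof -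
  have *: "vanish i" if c: "c > 0" and e: "\<And>k t. t \<ge> 0 \<Longrightarrow> eqv l (Y k t j) (Y (Suc k) t i)"
    and le: "\<And>k t. t \<ge> 0 \<Longrightarrow> c * (nrm (Y k t j))\<^sup>2 \<le> - eform p (Y k t) (op_A p (Y k t))" for c i j
    unfolding vanish_def
  proof
    fix k
    have "((\<lambda>t. ip l (Y k t j) (Y k t j)) \<longlongrightarrow> 0) at_top"
    proof (rule Lim_null_comparison)
      show "\<forall>\<^sub>F t in at_top. norm (ip l (Y k t j) (Y k t j)) \<le> - eform p (Y k t) (op_A p (Y k t)) / c"
        by (rule ev0) (use le c in \<open>simp add: ip_self field_simps\<close>)
      have "((\<lambda>t. - eform p (Y k t) (op_A p (Y k t)) / c) \<longlongrightarrow> - 0 / c) at_top"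
        using c by (intro tendsto_intros Y_dissipation) simp
      then show "((\<lambda>t. - eform p (Y k t) (op_A p (Y k t)) / c) \<longlongrightarrow> 0) at_top" by simp
    qed
    then have "sm (\<lambda>t. Y k t j)" by (rule small_if_ip) (rule ev0, simp)
    then show "sm (\<lambda>t. Y (Suc k) t i)" by (rule small_eqv) (rule ev0, rule e)
  qed
  have nn: "damp_a p * (nrm f)\<^sup>2 \<ge> 0" "damp_b p * (nrm f)\<^sup>2 \<ge> 0" "damp_c p * (nrm f)\<^sup>2 \<ge> 0"
    "damp_d p * (nrm f)\<^sup>2 \<ge> 0" "damp_e p * (nrm f)\<^sup>2 \<ge> 0" for f
    using pos by simp_all
  have d: "- eform p (Y k t) (op_A p (Y k t)) = damp_a p * (nrm (Y k t Cv1))\<^sup>2 + damp_b p * (nrm (Y k t Cz1))\<^sup>2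
    + damp_c p * (nrm (Y k t Cpsi))\<^sup>2 + damp_d p * (nrm (Y k t Cv3))\<^sup>2 + damp_e p * (nrm (Y k t Cz3))\<^sup>2" if "t \<ge> 0" for k t
    using dissipation[OF Y_dom[OF that]] by simp
  have le: "damp_a p * (nrm (Y k t Cv1))\<^sup>2 \<le> - eform p (Y k t) (op_A p (Y k t))"
    "damp_b p * (nrm (Y k t Cz1))\<^sup>2 \<le> - eform p (Y k t) (op_A p (Y k t))"
    "damp_c p * (nrm (Y k t Cpsi))\<^sup>2 \<le> - eform p (Y k t) (op_A p (Y k t))"
    "damp_e p * (nrm (Y k t Cz3))\<^sup>2 \<le> - eform p (Y k t) (op_A p (Y k t))" if t: "t \<ge> 0" for k t
    unfolding d[OF t] using nn(1)[of "Y k t Cv1"] nn(2)[of "Y k t Cz1"] nn(3)[of "Y k t Cpsi"]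
      nn(4)[of "Y k t Cv3"] nn(5)[of "Y k t Cz3"] by linarith+
  show "damp_a p > 0 \<Longrightarrow> vanish Cu1" by (rule *[OF _ Y_velocity(1) le(1)])
  show "damp_b p > 0 \<Longrightarrow> vanish Cy1" by (rule *[OF _ Y_velocity(2) le(2)])
  show "damp_c p > 0 \<Longrightarrow> vanish Comega" by (rule *[OF _ Y_velocity(3) le(3)])
  show "damp_e p > 0 \<Longrightarrow> vanish Cy3" by (rule *[OF _ Y_velocity(5) le(4)])
qed

text \<open>A virial identity: each equation tested with its own displacement gives its share of the
  elastic energy, and the coupling terms assemble into the squares of tau and of the two shears. The
  kinetic energy is read off from the displacements at level 1.\<close>

lemma energy_identity:
  assumes t: "t \<ge> 0"
  shows "eform p (Y 0 t) (Y 0 t) =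
    rho1 p * h1 p * (nrm (Y 1 t Cu1))\<^sup>2 + rho3 p * h3 p * (nrm (Y 1 t Cu3))\<^sup>2 + rho_h p * (nrm (Y 1 t Comega))\<^sup>2
    + rho1 p * I1 p * (nrm (Y 1 t Cy1))\<^sup>2 + rho3 p * I3 p * (nrm (Y 1 t Cy3))\<^sup>2
    - rho1 p * h1 p * ip l (Y 2 t Cu1) (Y 0 t Cu1) - rho3 p * h3 p * ip l (Y 2 t Cu3) (Y 0 t Cu3)
    - rho_h p * ip l (Y 2 t Comega) (Y 0 t Comega)
    - rho1 p * I1 p * ip l (Y 2 t Cy1) (Y 0 t Cy1) - rho3 p * I3 p * ip l (Y 2 t Cy3) (Y 0 t Cy3)
    - damp_a p * ip l (Y 1 t Cu1) (Y 0 t Cu1) - damp_d p * ip l (Y 1 t Cu3) (Y 0 t Cu3)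
    - damp_c p * ip l (Y 1 t Comega) (Y 0 t Comega)
    - damp_b p * ip l (Y 1 t Cy1) (Y 0 t Cy1) - damp_e p * ip l (Y 1 t Cy3) (Y 0 t Cy3)"
proof -
  let ?U = "Y 0 t"
  have X [simp]: "?U \<in> X" using t by simp
  have v: "ip l (?U Cv1) (?U Cv1) = (nrm (Y 1 t Cu1))\<^sup>2" "ip l (?U Cz1) (?U Cz1) = (nrm (Y 1 t Cy1))\<^sup>2"
    "ip l (?U Cpsi) (?U Cpsi) = (nrm (Y 1 t Comega))\<^sup>2" "ip l (?U Cv3) (?U Cv3) = (nrm (Y 1 t Cu3))\<^sup>2"
    "ip l (?U Cz3) (?U Cz3) = (nrm (Y 1 t Cy3))\<^sup>2"
    using Y_velocity[OF t, of 0, THEN eqv_norm] by (simp_all add: ip_self)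
  have sh: "ip l (shear p i ?U) (shear p i ?U) = ip l (shear p i ?U) (D 1 (?U Comega)) + ip l (shear p i ?U) (?U i)"
    if "i = Cy1 \<or> i = Cy3" for i
  proof -
    have "shear p i ?U \<in> L2 l" using that by auto
    then have "ip l (shear p i ?U) (\<lambda>x. D 1 (?U Comega) x + ?U i x) = ip l (shear p i ?U) (D 1 (?U Comega)) + ip l (shear p i ?U) (?U i)"
      by simp
    then show ?thesis by (simp only: shear_def[of p i ?U, symmetric])
  qed
  have "ip l (tau p ?U) (\<lambda>x. - ?U Cu1 x + ?U Cu3 x + h2 p *\<^sub>R D 1 (?U Comega) x - (h1 p / 2) *\<^sub>R ?U Cy1 x - (h3 p / 2) *\<^sub>R ?U Cy3 x)
    = - ip l (tau p ?U) (?U Cu1) + ip l (tau p ?U) (?U Cu3) + h2 p * ip l (tau p ?U) (D 1 (?U Comega))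
    - h1 p / 2 * ip l (tau p ?U) (?U Cy1) - h3 p / 2 * ip l (tau p ?U) (?U Cy3)"
    by simp
  then have ta: "ip l (tau p ?U) (tau p ?U) = - ip l (tau p ?U) (?U Cu1) + ip l (tau p ?U) (?U Cu3) + h2 p * ip l (tau p ?U) (D 1 (?U Comega))
    - h1 p / 2 * ip l (tau p ?U) (?U Cy1) - h3 p / 2 * ip l (tau p ?U) (?U Cy3)"
    by (simp only: tau_def[of p ?U, symmetric])
  have st: "ip l (stress 0 t) (D 1 (?U Comega)) = G1 p * h1 p * ip l (shear p Cy1 ?U) (D 1 (?U Comega))
    + G3 p * h3 p * ip l (shear p Cy3 ?U) (D 1 (?U Comega)) + h2 p * ip l (tau p ?U) (D 1 (?U Comega))"
    by (simp add: stress_def)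
  show ?thesis
    using wave_u1[OF t X_H1(1)[OF X], of 0] wave_u3[OF t X_H1(3)[OF X], of 0] wave_y1[OF t X_H1(2)[OF X], of 0]
      wave_y3[OF t X_H1(4)[OF X], of 0] plate[OF t X_H1(6)[OF X], of 0] sh[of Cy1] sh[of Cy3]
    unfolding eform_def Let_def v ta st
    by (simp add: algebra_simps numeral_2_eq_2)
qed

lemma decay_if_all_vanish:
  assumes "vanish Cu1" "vanish Cu3" "vanish Comega" "vanish Cy1" "vanish Cy3"
  shows "((\<lambda>t. N (Y 0 t)) \<longlongrightarrow> 0) at_top"
proof -
  have s: "sm (\<lambda>t. Y 1 t i)" "sm (\<lambda>t. Y 2 t i)" if "vanish i" for i
    using that unfolding vanish_def One_nat_def numeral_2_eq_2 by blast+
  note s1 = assms[THEN s(1)] and s2 = assms[THEN s(2)]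
  have n: "((\<lambda>t. nrm (Y 1 t i)) \<longlongrightarrow> 0) at_top" if "vanish i" for i
    using s(1)[OF that] by (simp add: small_def)
  note n1 = assms[THEN n]
  define R where "R t = rho1 p * h1 p * (nrm (Y 1 t Cu1))\<^sup>2 + rho3 p * h3 p * (nrm (Y 1 t Cu3))\<^sup>2 + rho_h p * (nrm (Y 1 t Comega))\<^sup>2
    + rho1 p * I1 p * (nrm (Y 1 t Cy1))\<^sup>2 + rho3 p * I3 p * (nrm (Y 1 t Cy3))\<^sup>2
    - rho1 p * h1 p * ip l (Y 2 t Cu1) (Y 0 t Cu1) - rho3 p * h3 p * ip l (Y 2 t Cu3) (Y 0 t Cu3)
    - rho_h p * ip l (Y 2 t Comega) (Y 0 t Comega)
    - rho1 p * I1 p * ip l (Y 2 t Cy1) (Y 0 t Cy1) - rho3 p * I3 p * ip l (Y 2 t Cy3) (Y 0 t Cy3)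
    - damp_a p * ip l (Y 1 t Cu1) (Y 0 t Cu1) - damp_d p * ip l (Y 1 t Cu3) (Y 0 t Cu3)
    - damp_c p * ip l (Y 1 t Comega) (Y 0 t Comega)
    - damp_b p * ip l (Y 1 t Cy1) (Y 0 t Cy1) - damp_e p * ip l (Y 1 t Cy3) (Y 0 t Cy3)" for t
  have "(R \<longlongrightarrow> rho1 p * h1 p * 0\<^sup>2 + rho3 p * h3 p * 0\<^sup>2 + rho_h p * 0\<^sup>2 + rho1 p * I1 p * 0\<^sup>2 + rho3 p * I3 p * 0\<^sup>2
    - rho1 p * h1 p * 0 - rho3 p * h3 p * 0 - rho_h p * 0 - rho1 p * I1 p * 0 - rho3 p * I3 p * 0
    - damp_a p * 0 - damp_d p * 0 - damp_c p * 0 - damp_b p * 0 - damp_e p * 0) at_top"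
    unfolding R_def
    by (intro tendsto_add tendsto_diff tendsto_mult_left tendsto_power n1 ip_small' s1 s2 bd_all)
  then have "(R \<longlongrightarrow> 0) at_top" by simp
  moreover have "\<forall>\<^sub>F t in at_top. R t = eform p (Y 0 t) (Y 0 t)"
    by (rule ev0) (simp only: R_def energy_identity)
  ultimately have "((\<lambda>t. eform p (Y 0 t) (Y 0 t)) \<longlongrightarrow> 0) at_top"
    by (rule Lim_transform_eventually)
  from tendsto_real_sqrt[OF this] show ?thesis by (simp add: N_eform)
qed

lemma decay:
  assumes "(damp_a p > 0 \<and> damp_b p > 0 \<and> damp_c p = 0 \<and> damp_d p = 0 \<and> damp_e p = 0)
      \<or> (damp_a p > 0 \<and> damp_c p > 0 \<and> damp_b p = 0 \<and> damp_d p = 0 \<and> damp_e p = 0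
           \<and> G1 p \<noteq> G3 p)
      \<or> (damp_b p > 0 \<and> damp_c p > 0 \<and> damp_a p = 0 \<and> damp_d p = 0 \<and> damp_e p = 0
           \<and> E1 p / rho1 p \<noteq> E3 p / rho3 p)
      \<or> (damp_b p > 0 \<and> damp_e p > 0 \<and> damp_a p = 0 \<and> damp_c p = 0 \<and> damp_d p = 0
           \<and> G1 p \<noteq> G3 p \<and> E1 p / rho1 p \<noteq> E3 p / rho3 p)
      \<or> (damp_a p > 0 \<and> damp_e p > 0 \<and> damp_b p = 0 \<and> damp_c p = 0 \<and> damp_d p = 0)"
  shows "((\<lambda>t. N (Y 0 t)) \<longlongrightarrow> 0) at_top"
  using assms
proof (elim disjE conjE)
  assume d: "damp_a p > 0" "damp_b p > 0"
  have v: "vanish Cu1" "vanish Cy1" using d by (auto intro: damped_vanish)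
  have \<tau>: "vanish_fun (tau p)" by (rule tau_vanishes[OF v(1)])
  have y: "vanish_fun (\<lambda>U. U Cy1)" using v by (simp add: vanish_iff)
  \<comment> \<open>The force on y1 is h1/2 tau - G1 h1 (omega_x + y1); since it, tau and y1 decay,
    so does omega_x.\<close>
  have "vanish_fun (\<lambda>U. D 1 (U Comega))"
    by (rule vanish_cong[OF vanish_lin[OF vanish_lin[OF y1_force_vanishes[OF v(2)] \<tau>, of 1 "-(h1 p / 2)"] y, of "-(1 / (G1 p * h1 p))" "-1"]])
       (use pos in \<open>simp add: shear_def algebra_simps\<close>)
  then have o: "vanish Comega" by (rule omega_vanishes)
  have y3: "vanish Cy3" by (rule y3_vanishes[OF o \<tau> v(2)])
  show ?thesis by (rule decay_if_all_vanish[OF v(1) u3_vanishes[OF o \<tau> v(2) y3 v(1)] o v(2) y3])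
next
  assume d: "damp_a p > 0" "damp_c p > 0" and z: "damp_d p = 0" "damp_e p = 0" and G: "G1 p \<noteq> G3 p"
  have v: "vanish Cu1" and o: "vanish Comega" using d by (auto intro: damped_vanish)
  have u: "vanish_fun (\<lambda>U. U Cu1)" using v by (simp add: vanish_iff)
  have \<tau>: "vanish_fun (tau p)" by (rule tau_vanishes[OF v])
  note o' = D_omega_vanishes[OF o]
  have p1: "vanish_fun (\<lambda>U x. (G1 p * h1 p) *\<^sub>R U Cy1 x + (G3 p * h3 p) *\<^sub>R U Cy3 x)"
    by (rule vanish_cong[OF vanish_lin[OF vanish_lin[OF stress_fun_vanishes[OF o] \<tau>, of 1 "- h2 p"] o', of 1 "- (G1 p * h1 p + G3 p * h3 p)"]])
       (simp add: shear_def algebra_simps)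
  have p2: "vanish_fun (\<lambda>U x. U Cu3 x - (h1 p / 2) *\<^sub>R U Cy1 x - (h3 p / 2) *\<^sub>R U Cy3 x)"
    by (rule vanish_cong[OF vanish_lin[OF vanish_lin[OF \<tau> u, of 1 1] o', of 1 "- h2 p"]])
       (simp add: tau_def algebra_simps)
  \<comment> \<open>Eliminates y1 between \<open>p1\<close> and \<open>p2\<close>. The coefficient
    of y3 that is left is nonzero because G1 \<noteq> G3.\<close>
  have p3: "vanish_fun (\<lambda>U x. (G1 p * h1 p) *\<^sub>R U Cu3 x + (h1 p * h3 p / 2 * (G3 p - G1 p)) *\<^sub>R U Cy3 x)"
    by (rule vanish_cong[OF vanish_lin[OF p2 p1, of "G1 p * h1 p" "h1 p / 2"]])
       (simp add: scaleR_conv_of_real field_simps)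
  have y3: "vanish Cy3"
    using G pos by (intro y3_vanishes_if_proportional[OF p3 _ \<tau> o' z]) auto
  have y1: "vanish Cy1" by (rule y1_vanishes[OF o \<tau> y3])
  show ?thesis by (rule decay_if_all_vanish[OF v u3_vanishes[OF o \<tau> y1 y3 v] o y1 y3])
next
  assume d: "damp_b p > 0" "damp_c p > 0" and z: "damp_a p = 0" "damp_d p = 0" and ne: "E1 p / rho1 p \<noteq> E3 p / rho3 p"
  have v: "vanish Cy1" and o: "vanish Comega" using d by (auto intro: damped_vanish)
  have y: "vanish_fun (\<lambda>U. U Cy1)" using v by (simp add: vanish_iff)
  \<comment> \<open>Here the force on y1 is solved for tau, since y1 and omega_x decay.\<close>
  have \<tau>: "vanish_fun (tau p)"
    by (rule vanish_cong[OF vanish_lin[OF y1_force_vanishes[OF v] vanish_lin[OF D_omega_vanishes[OF o] y, of 1 1], of "2 / h1 p" "2 / h1 p * (G1 p * h1 p)"]])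
       (use pos in \<open>simp add: shear_def algebra_simps\<close>)
  have y3: "vanish Cy3" by (rule y3_vanishes[OF o \<tau> v])
  show ?thesis
    using u_vanish_if_speeds_differ[OF difference_vanishes[OF o \<tau> v y3] \<tau> z ne] o v y3
    by (intro decay_if_all_vanish)
next
  assume d: "damp_b p > 0" "damp_e p > 0" and z: "damp_a p = 0" "damp_d p = 0"
    and G: "G1 p \<noteq> G3 p" and ne: "E1 p / rho1 p \<noteq> E3 p / rho3 p"
  have v: "vanish Cy1" "vanish Cy3" using d by (auto intro: damped_vanish)
  have y: "vanish_fun (\<lambda>U. U Cy1)" "vanish_fun (\<lambda>U. U Cy3)" using v by (auto simp: vanish_iff)
  have 1: "vanish_fun (\<lambda>U x. tau p U x - (2 * G1 p) *\<^sub>R D 1 (U Comega) x)"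
    by (rule vanish_cong[OF vanish_lin[OF y1_force_vanishes[OF v(1)] y(1), of "2 / h1 p" "2 * G1 p"]])
       (use pos in \<open>simp add: shear_def algebra_simps\<close>)
  have 3: "vanish_fun (\<lambda>U x. tau p U x - (2 * G3 p) *\<^sub>R D 1 (U Comega) x)"
    by (rule vanish_cong[OF vanish_lin[OF y3_force_vanishes[OF v(2)] y(2), of "2 / h3 p" "2 * G3 p"]])
       (use pos in \<open>simp add: shear_def algebra_simps\<close>)
  \<comment> \<open>The forces on y1 and y3 determine tau twice, as 2 G1 omega_x and as 2 G3 omega_x
    up to decaying terms; their difference isolates omega_x.\<close>
  have 4: "vanish_fun (\<lambda>U x. (2 * (G3 p - G1 p)) *\<^sub>R D 1 (U Comega) x)"
    by (rule vanish_cong[OF vanish_lin[OF 1 3, of 1 "-1"]]) (simp add: algebra_simps)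
  have o': "vanish_fun (\<lambda>U. D 1 (U Comega))"
    by (rule vanish_cong[OF vanish_lin[OF 4 4, of "1 / (2 * (G3 p - G1 p))" 0]]) (use G in simp)
  then have o: "vanish Comega" by (rule omega_vanishes)
  have \<tau>: "vanish_fun (tau p)"
    by (rule vanish_cong[OF vanish_lin[OF 1 o', of 1 "2 * G1 p"]]) simp
  show ?thesis
    using u_vanish_if_speeds_differ[OF difference_vanishes[OF o \<tau> v] \<tau> z ne] o v
    by (intro decay_if_all_vanish)
next
  assume d: "damp_a p > 0" "damp_e p > 0"
  have v: "vanish Cu1" "vanish Cy3" using d by (auto intro: damped_vanish)
  have \<tau>: "vanish_fun (tau p)" by (rule tau_vanishes[OF v(1)])
  have y: "vanish_fun (\<lambda>U. U Cy3)" using v by (simp add: vanish_iff)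
  \<comment> \<open>The elimination from the case a, b > 0, with the third layer in place of the
    first.\<close>
  have "vanish_fun (\<lambda>U. D 1 (U Comega))"
    by (rule vanish_cong[OF vanish_lin[OF vanish_lin[OF y3_force_vanishes[OF v(2)] \<tau>, of 1 "-(h3 p / 2)"] y, of "-(1 / (G3 p * h3 p))" "-1"]])
       (use pos in \<open>simp add: shear_def algebra_simps\<close>)
  then have o: "vanish Comega" by (rule omega_vanishes)
  have y1: "vanish Cy1" by (rule y1_vanishes[OF o \<tau> v(2)])
  show ?thesis by (rule decay_if_all_vanish[OF v(1) u3_vanishes[OF o \<tau> y1 v(2) v(1)] o y1 v(2)])
qed

end

theorem theorem2p2:
  fixes p :: beam and T :: "real \<Rightarrow> state \<Rightarrow> state"
  assumes "admissible p"
    and "C0_contraction_semigroup (energy_space p) (energy_norm p) T"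
    and "generated_by (energy_space p) (energy_norm p) T (dom_A p) (op_A p)"
    and "(damp_a p > 0 \<and> damp_b p > 0 \<and> damp_c p = 0 \<and> damp_d p = 0 \<and> damp_e p = 0)
      \<or> (damp_a p > 0 \<and> damp_c p > 0 \<and> damp_b p = 0 \<and> damp_d p = 0 \<and> damp_e p = 0
           \<and> G1 p \<noteq> G3 p)
      \<or> (damp_b p > 0 \<and> damp_c p > 0 \<and> damp_a p = 0 \<and> damp_d p = 0 \<and> damp_e p = 0
           \<and> E1 p / rho1 p \<noteq> E3 p / rho3 p)
      \<or> (damp_b p > 0 \<and> damp_e p > 0 \<and> damp_a p = 0 \<and> damp_c p = 0 \<and> damp_d p = 0
           \<and> G1 p \<noteq> G3 p \<and> E1 p / rho1 p \<noteq> E3 p / rho3 p)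
      \<or> (damp_a p > 0 \<and> damp_e p > 0 \<and> damp_b p = 0 \<and> damp_c p = 0 \<and> damp_d p = 0)"
  shows "\<forall>U0 \<in> energy_space p. ((\<lambda>t. energy_norm p (T t U0)) \<longlongrightarrow> 0) at_top"
proof
  fix U0 assume U0: "U0 \<in> energy_space p"
  interpret sandwich_beam p by standard (rule assms(1))
  interpret S: contraction_semigroup X "eform p" N T "dom_A p" "op_A p"
    by standard (use assms(2,3) in \<open>auto intro: X_comb eform_comb eform_commute eform_nonneg N_eform dom_X op_A_X\<close>)
  have dis: "eform p U (op_A p U) \<le> 0" if "U \<in> dom_A p" for U
    unfolding dissipation[OF that] neg_le_0_iff_le
    using pos by (intro add_nonneg_nonneg mult_nonneg_nonneg) auto
  show "((\<lambda>t. N (T t U0)) \<longlongrightarrow> 0) at_top"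
  proof (rule S.stable_if_dense[where S = "smooth_states p"])
    show "\<exists>V\<in>smooth_states p. N (U - V) < e" if "U \<in> X" "e > 0" for U e
      using that by (rule smooth_dense)
    show "smooth_states p \<subseteq> X" using smooth_dom dom_X by blast
    fix V assume V: "V \<in> smooth_states p"
    \<comment> \<open>Since \<open>T t\<close> commutes with the operator up to distance 0, the
      orbit of \<open>V' k\<close> serves as the level \<open>Y k\<close> of the trajectory.\<close>
    define V' where "V' k = (op_A p ^^ k) V" for k
    have V': "V' k \<in> smooth_states p" for k
      unfolding V'_def by (induction k) (auto simp: V smooth_op_A)
    have V'_Suc: "V' (Suc k) = op_A p (V' k)" for k by (simp add: V'_def)
    interpret smooth_trajectory p "\<lambda>k t. T t (V' k)"
    proof
      fix k and t :: real
      show "t \<ge> 0 \<Longrightarrow> T t (V' k) \<in> dom_A p"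
        by (rule S.T_D(1)[OF _ smooth_dom[OF V']])
      show "N (op_A p (T t (V' k)) - T t (V' (Suc k))) = 0" if t: "t \<ge> 0"
      proof -
        have "T t (V' (Suc k)) \<in> X" "op_A p (T t (V' k)) \<in> X"
          using t smooth_dom[OF V'] dom_X op_A_X by (auto intro: S.T_X S.T_D(1))
        then show ?thesis
          using S.T_D(2)[OF t smooth_dom[OF V'], of k] S.N_minus_commute by (simp add: V'_Suc)
      qed
      show "\<exists>M. \<forall>t\<ge>0. N (T t (V' k)) \<le> M"
        using S.T_contr dom_X[OF smooth_dom[OF V']] by blast
      show "((\<lambda>t. eform p (T t (V' k)) (op_A p (T t (V' k)))) \<longlongrightarrow> 0) at_top"
        using dis smooth_dom[OF V'] V'_Suc[symmetric] by (intro S.dissipation_tendsto_0) (simp_all add: V'_Suc[symmetric])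
    qed
    show "((\<lambda>t. N (T t V)) \<longlongrightarrow> 0) at_top"
      using decay[OF assms(4)] by (simp add: V'_def)
  qed (rule U0)
qed

end
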